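(* Let $\mathbf{k}$ be an algebraically closed field of characteristic zero, and let $X$ be a normal toric affine variety over $\mathbf{k}$ with no torus factor, with acting torus $\mathbb{T}$. Let $G$ be the subgroup of $\mathrm{Aut}(X)$ generated by a finite collection $U_1,\ldots,U_s$ of one-parameter unipotent subgroups of $\mathrm{Aut}(X)$, each normalized by the acting torus $\mathbb{T}$. Then either (i) $G$ is a unipotent algebraic group, or (ii) $G$ contains the free group $\mathbf{F}_2$ of rank two as a subgroup.
   Context: A toric affine variety $X$ of dimension $n$ is an affine variety equipped with an effective regular action of an algebraic torus $\mathbb{T}=(\mathbb{G}_m)^n$ having an open orbit. $X$ has a torus factor if $X\cong Y\times(\mathbf{k}\setminus\{0\})$ for some variety $Y$ (for toric affine $X$: iff there is a nonconstant invertible regular function on $X$). A one-parameter unipotent subgroup ($\mathbb{G}_a$-subgroup) of $\mathrm{Aut}(X)$ is the image in $\mathrm{Aut}(X)$ of the additive group $\mathbb{G}_a$ of $\mathbf{k}$ under an effective regular action $\mathbb{G}_a\times X\to X$; equivalently a subgroup $\{\exp(t\partial)\mid t\in\mathbf{k}\}$ with $\partial$ a nonzero locally nilpotent derivation of $\mathcal{O}(X)$. "$G$ is a unipotent algebraic group" means that $G\subset\mathrm{Aut}(X)$ carries the structure of a unipotent linear algebraic group acting regularly on $X$. *)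

theory Defs
  imports
    "HOL-Computational_Algebra.Polynomial"
    "HOL-Algebra.Group_Action"
    "HOL-Algebra.Generated_Groups"
    "Jordan_Normal_Form.Determinant"
begin

section \<open>Varieties as sets of points with regular functions\<close>

text \<open>
  Over an algebraically closed field, a (classical, reduced) affine variety is determined by its
  points together with its algebra of regular functions. A space consists of its points and of a
  set of functions which generate the algebra of regular functions over the base field. The values
  of these functions outside of the set of points are irrelevant.
\<close>

record ('p, 'k) space =
  pts :: "'p set"
  coords :: "('p \<Rightarrow> 'k) set"

inductive_set polyfuns :: "('p \<Rightarrow> 'k::field) set \<Rightarrow> ('p \<Rightarrow> 'k) set" for C where
  const: "(\<lambda>_. c) \<in> polyfuns C"
| coord: "f \<in> C \<Longrightarrow> f \<in> polyfuns C"
| add: "f \<in> polyfuns C \<Longrightarrow> g \<in> polyfuns C \<Longrightarrow> (\<lambda>x. f x + g x) \<in> polyfuns C"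
| mult: "f \<in> polyfuns C \<Longrightarrow> g \<in> polyfuns C \<Longrightarrow> (\<lambda>x. f x * g x) \<in> polyfuns C"

definition regular :: "('p, 'k::field) space \<Rightarrow> ('p \<Rightarrow> 'k) \<Rightarrow> bool" where
  "regular V f \<longleftrightarrow> (\<exists>p \<in> polyfuns (coords V). \<forall>x \<in> pts V. f x = p x)"

definition morphism :: "('p, 'k::field) space \<Rightarrow> ('q, 'k) space \<Rightarrow> ('p \<Rightarrow> 'q) \<Rightarrow> bool" where
  "morphism V W \<phi> \<longleftrightarrow> \<phi> ` pts V \<subseteq> pts W \<and> (\<forall>f \<in> coords W. regular V (f \<circ> \<phi>))"

definition isomorphism :: "('p, 'k::field) space \<Rightarrow> ('q, 'k) space \<Rightarrow> ('p \<Rightarrow> 'q) \<Rightarrow> bool" where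
  "isomorphism V W \<phi> \<longleftrightarrow>
     bij_betw \<phi> (pts V) (pts W) \<and> morphism V W \<phi> \<and> morphism W V (inv_into (pts V) \<phi>)"

definition prod_space :: "('p, 'k) space \<Rightarrow> ('q, 'k) space \<Rightarrow> ('p \<times> 'q, 'k) space" where
  "prod_space V W =
     \<lparr>pts = pts V \<times> pts W,
      coords = (\<lambda>f. f \<circ> fst) ` coords V \<union> (\<lambda>f. f \<circ> snd) ` coords W\<rparr>"

definition zariski_closed :: "('p, 'k::field) space \<Rightarrow> 'p set \<Rightarrow> bool" where
  "zariski_closed V Z \<longleftrightarrow>
     (\<exists>P. (\<forall>f \<in> P. regular V f) \<and> Z = {x \<in> pts V. \<forall>f \<in> P. f x = 0})"

definition zariski_open :: "('p, 'k::field) space \<Rightarrow> 'p set \<Rightarrow> bool" where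
  "zariski_open V U \<longleftrightarrow> U \<subseteq> pts V \<and> zariski_closed V (pts V - U)"

definition irreducible_space :: "('p, 'k::field) space \<Rightarrow> bool" where
  "irreducible_space V \<longleftrightarrow> pts V \<noteq> {} \<and>
     (\<forall>A B. zariski_closed V A \<and> zariski_closed V B \<and> pts V = A \<union> B \<longrightarrow> A = pts V \<or> B = pts V)"

text \<open>Points of affine \<open>N\<close>-space are sequences that vanish from position \<open>N\<close> on.\<close>

definition affine_space :: "nat \<Rightarrow> (nat \<Rightarrow> 'k::field, 'k) space" where
  "affine_space N = \<lparr>pts = {x. \<forall>i\<ge>N. x i = 0}, coords = {\<lambda>x. x i | i. i < N}\<rparr>"

definition affine_variety :: "(nat \<Rightarrow> 'k::field, 'k) space \<Rightarrow> bool" where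
  "affine_variety V \<longleftrightarrow>
     (\<exists>N Z. zariski_closed (affine_space N) Z \<and> V = (affine_space N)\<lparr>pts := Z\<rparr>) \<and>
     irreducible_space V"

text \<open>
  The coordinate ring is integrally closed in its field of fractions. A fraction \<open>a / b\<close> is
  a function on the nonempty open set where \<open>b\<close> does not vanish; since \<open>V\<close> is irreducible,
  identities in the function field can be tested on that set.
\<close>

definition normal_variety :: "('p, 'k::field) space \<Rightarrow> bool" where
  "normal_variety V \<longleftrightarrow>
     (\<forall>a b. regular V a \<and> regular V b \<and> (\<exists>x \<in> pts V. b x \<noteq> 0) \<and>
        (\<exists>m>0. \<exists>c :: nat \<Rightarrow> 'p \<Rightarrow> 'k. (\<forall>i<m. regular V (c i)) \<and>
           (\<forall>x \<in> pts V. b x \<noteq> 0 \<longrightarrow>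
              (a x / b x) ^ m + (\<Sum>i<m. c i x * (a x / b x) ^ i) = 0)) \<longrightarrow>
        (\<exists>f. regular V f \<and> (\<forall>x \<in> pts V. b x \<noteq> 0 \<longrightarrow> f x = a x / b x)))"

definition punctured_line :: "('k::field, 'k) space" where
  "punctured_line = \<lparr>pts = UNIV - {0}, coords = {\<lambda>z. z, \<lambda>z. inverse z}\<rparr>"

text \<open>
  There is no loss in taking \<open>Y\<close> affine: if \<open>X\<close> is affine and isomorphic to
  \<open>Y \<times> (k - {0})\<close>, then \<open>Y\<close> is isomorphic to a closed subvariety of \<open>X\<close>.
\<close>

definition has_torus_factor :: "('p, 'k::field) space \<Rightarrow> bool" where
  "has_torus_factor X \<longleftrightarrow>
     (\<exists>Y :: (nat \<Rightarrow> 'k, 'k) space. affine_variety Y \<and>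
        (\<exists>\<phi>. isomorphism X (prod_space Y punctured_line) \<phi>))"


section \<open>Automorphisms and regular group actions\<close>

definition Aut :: "('p, 'k::field) space \<Rightarrow> ('p \<Rightarrow> 'p) monoid" where
  "Aut X = (BijGroup (pts X))\<lparr>carrier := {\<phi> \<in> Bij (pts X). isomorphism X X \<phi>}\<rparr>"

text \<open>
  \<open>C\<close> is a set of generators for the regular functions on the acting group \<open>\<Gamma>\<close>.
\<close>

definition effective_regular_action ::
  "'g monoid \<Rightarrow> ('g \<Rightarrow> 'k::field) set \<Rightarrow> ('p, 'k) space \<Rightarrow> ('g \<Rightarrow> 'p \<Rightarrow> 'p) \<Rightarrow> bool" where
  "effective_regular_action \<Gamma> C X \<alpha> \<longleftrightarrow>
     faithful_action \<Gamma> (pts X) \<alpha> \<and>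
     morphism (prod_space \<lparr>pts = carrier \<Gamma>, coords = C\<rparr> X) X (\<lambda>(g, x). \<alpha> g x)"

definition torus :: "nat \<Rightarrow> (nat \<Rightarrow> 'k::field) monoid" where
  "torus n =
     \<lparr>carrier = {t. (\<forall>i<n. t i \<noteq> 0) \<and> (\<forall>i\<ge>n. t i = 1)},
      monoid.mult = (\<lambda>s t i. s i * t i),
      one = (\<lambda>_. 1)\<rparr>"

definition torus_coords :: "nat \<Rightarrow> ((nat \<Rightarrow> 'k::field) \<Rightarrow> 'k) set" where
  "torus_coords n = {\<lambda>t. t i | i. i < n} \<union> {\<lambda>t. inverse (t i) | i. i < n}"

text \<open>The dimension of \<open>X\<close> is \<open>n\<close>, since the action is effective with an open orbit.\<close>

definition toric_action ::
  "nat \<Rightarrow> ('p, 'k::field) space \<Rightarrow> ((nat \<Rightarrow> 'k) \<Rightarrow> 'p \<Rightarrow> 'p) \<Rightarrow> bool" where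
  "toric_action n X \<tau> \<longleftrightarrow>
     effective_regular_action (torus n) (torus_coords n) X \<tau> \<and>
     (\<exists>x \<in> pts X. zariski_open X (orbit (torus n) \<tau> x))"

definition additive_group :: "'k::field monoid" where
  "additive_group = \<lparr>carrier = UNIV, monoid.mult = (+), one = 0\<rparr>"

definition Ga_subgroup :: "('p, 'k::field) space \<Rightarrow> ('p \<Rightarrow> 'p) set \<Rightarrow> bool" where
  "Ga_subgroup X U \<longleftrightarrow>
     (\<exists>\<alpha>. effective_regular_action additive_group {\<lambda>t. t} X \<alpha> \<and> U = range \<alpha>)"


section \<open>Unipotent linear algebraic groups\<close>

definition GL :: "nat \<Rightarrow> 'k::field mat monoid" where
  "GL m = \<lparr>carrier = {A \<in> carrier_mat m m. det A \<noteq> 0}, monoid.mult = (*), one = 1\<^sub>m m\<rparr>"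

definition GL_coords :: "nat \<Rightarrow> ('k::field mat \<Rightarrow> 'k) set" where
  "GL_coords m = {\<lambda>A. A $$ (i, j) | i j. i < m \<and> j < m} \<union> {\<lambda>A. inverse (det A)}"

definition unipotent_mat :: "nat \<Rightarrow> 'k::field mat \<Rightarrow> bool" where
  "unipotent_mat m A \<longleftrightarrow> A \<in> carrier_mat m m \<and> (\<exists>r. (A - 1\<^sub>m m) ^\<^sub>m r = 0\<^sub>m m m)"

definition unipotent_linear_group :: "nat \<Rightarrow> 'k::field mat set \<Rightarrow> bool" where
  "unipotent_linear_group m H \<longleftrightarrow>
     subgroup H (GL m) \<and>
     zariski_closed \<lparr>pts = carrier (GL m), coords = GL_coords m\<rparr> H \<and>
     (\<forall>A \<in> H. unipotent_mat m A)"

definition is_unipotent_algebraic_group :: "('p, 'k::field) space \<Rightarrow> ('p \<Rightarrow> 'p) set \<Rightarrow> bool" where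
  "is_unipotent_algebraic_group X G \<longleftrightarrow>
     (\<exists>m (H :: 'k mat set) \<rho>. unipotent_linear_group m H \<and>
        effective_regular_action ((GL m)\<lparr>carrier := H\<rparr>) (GL_coords m) X \<rho> \<and>
        G = \<rho> ` H)"


section \<open>The free group of rank two\<close>

text \<open>
  A letter \<open>(a, e)\<close> stands for the generator \<open>a\<close> or, if \<open>e\<close> holds, for its inverse. Elements
  are the reduced words; the product is the reduced form of the concatenation.
\<close>

type_synonym letter = "bool \<times> bool"

definition inv_letter :: "letter \<Rightarrow> letter" where
  "inv_letter l = (fst l, \<not> snd l)"

fun push_letter :: "letter \<Rightarrow> letter list \<Rightarrow> letter list" where
  "push_letter l [] = [l]"
| "push_letter l (k # w) = (if k = inv_letter l then w else l # k # w)"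

definition F2 :: "letter list monoid" where
  "F2 = \<lparr>carrier = {w. successively (\<lambda>l k. k \<noteq> inv_letter l) w},
         monoid.mult = (\<lambda>u v. foldr push_letter u v),
         one = []\<rparr>"

definition contains_F2 :: "('g, 'b) monoid_scheme \<Rightarrow> 'g set \<Rightarrow> bool" where
  "contains_F2 A G \<longleftrightarrow> (\<exists>h \<in> hom F2 A. inj_on h (carrier F2) \<and> h ` carrier F2 \<subseteq> G)"

end

theory Submission
  imports Defs "HOL-Library.Function_Algebras"
begin

text \<open>
  The algebra of regular functions on \<open>X\<close> is spanned by weight functions \<open>\<chi>\<^sub>m\<close>, with \<open>m\<close> in a
  monoid \<open>S\<close> of characters of the torus. An additive one-parameter subgroup normalized by the torus
  acts by \<open>\<chi>\<^sub>m \<mapsto> \<chi>\<^sub>m (1 + c \<chi>\<^sub>e) ^ \<rho> m\<close> for a root, that is, a character \<open>e\<close> and a functional \<open>\<rho>\<close> which is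
  nonnegative on \<open>S\<close>, with \<open>\<rho> e = -1\<close>. Such maps are composed like triangular substitutions
  of independent variables, one for each functional, without passing to the Cox ring.

  Consider all roots whose one-parameter subgroups lie in \<open>G\<close>. If two of them satisfy \<open>\<rho>\<^sub>2 e\<^sub>1 > 0\<close> and
  \<open>\<rho>\<^sub>1 e\<^sub>2 > 0\<close>, then the parameters \<open>c = 3\<close> in the two subgroups generate a free group, by
  ping-pong for the rational numbers \<open>\<chi>\<^bsub>e1\<^esub>\<close> and \<open>\<chi>\<^bsub>e2\<^esub>\<close> along the orbit of the base point.
  Otherwise commutators of one-parameter subgroups show that the relation
  \<open>\<rho>\<^sub>2 e\<^sub>1 > 0\<close> is a strict order on the functionals, so that \<open>G\<close> is triangular: every element has a
  unique normal form as a product of root elements. On a suitable finite-dimensional invariant space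
  of functions, the parameters of the normal form are matrix entries. This yields polynomial equations
  for \<open>G\<close> as a group of unipotent matrices.
\<close>

section \<open>Regular functions and automorphisms\<close>

text \<open>The pairs \<open>(\<rho>, e)\<close> are Demazure roots, with \<rho> in the place of a
  primitive ray generator; \<open>root_nonneg\<close> supplies the sign condition at the other rays
  that the cone would give. Three obstacles shape the proof. The factors
  \<open>1 + c \<chi>_e\<close> have zeros, so substitutions can be composed pointwise only off a
  hypersurface; identities are proved there and spread by irreducibility. Next, the generating roots
  may show only longer cycles of the relation \<open>\<rho>2 e1 > 0\<close>. Commutators produce
  roots that shorten a cycle to length two, which is why the dichotomy speaks of all roots in
  \<open>G\<close>. Finally, it is not clear beforehand that these roots are finite in number. A
  finite set \<open>B\<close> of characters, closed under the generating roots, spans a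
  \<open>G\<close>-stable space; stability makes \<open>B\<close> closed under all roots in
  \<open>G\<close>, and the dual characters in \<open>B\<close> then bound their number. The
  ping-pong parameter is 3 so that \<open>s a \<ge> -1\<close> implies both
  \<open>s (a + 3 s) = s a + 3 > 1\<close> and \<open>|a| \<le> |a + 3 s|\<close>. Rational
  coordinates provide absolute values although the field is not ordered.\<close>

text \<open>Dedekind's argument: the relation at \<open>f b a\<close> minus
  \<open>\<psi> j b\<close> times the relation at \<open>a\<close> loses the term of
  \<open>j\<close>, and \<open>b\<close> is chosen such that the coefficient of \<open>i\<close>
  survives. Only closure of \<open>A\<close> under \<open>f\<close> enters, so \<open>A\<close> may
  later consist of pairs of a positive integer and a torus element.\<close>

lemma characters_independent:
  fixes \<psi> :: "'i \<Rightarrow> 'a \<Rightarrow> 'k::field"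
  assumes "finite I"
    and cl: "\<And>a b. a \<in> A \<Longrightarrow> b \<in> A \<Longrightarrow> f a b \<in> A"
    and hom: "\<And>i a b. i \<in> I \<Longrightarrow> a \<in> A \<Longrightarrow> b \<in> A \<Longrightarrow> \<psi> i (f a b) = \<psi> i a * \<psi> i b"
    and dist: "\<And>i j. i \<in> I \<Longrightarrow> j \<in> I \<Longrightarrow> i \<noteq> j \<Longrightarrow> \<exists>a\<in>A. \<psi> i a \<noteq> \<psi> j a"
    and nz: "\<And>i. i \<in> I \<Longrightarrow> \<exists>a\<in>A. \<psi> i a \<noteq> 0"
    and sum: "\<And>a. a \<in> A \<Longrightarrow> (\<Sum>i\<in>I. c i * \<psi> i a) = 0"
    and "i \<in> I"
  shows "c i = 0"
  using assms(1,3-)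
proof (induction I arbitrary: c i rule: finite_induct)
  case empty
  then show ?case by simp
next
  case (insert j I)
  have *: "c i = 0" if i: "i \<in> I" for i
  proof -
    have "i \<noteq> j" using i insert.hyps by blast
    then obtain b where b: "b \<in> A" "\<psi> i b \<noteq> \<psi> j b"
      using insert.prems(2)[of i j] i by auto
    have "(\<Sum>i\<in>I. (c i * (\<psi> i b - \<psi> j b)) * \<psi> i a) = 0" if a: "a \<in> A" for a
    proof -
      have 1: "c j * \<psi> j a + (\<Sum>i\<in>I. c i * \<psi> i a) = 0"
        using insert.prems(4)[OF a] insert.hyps by simp
      have "c j * \<psi> j (f b a) + (\<Sum>i\<in>I. c i * \<psi> i (f b a)) = 0"
        using insert.prems(4)[OF cl[OF b(1) a]] insert.hyps by simp
      then have 2: "c j * (\<psi> j b * \<psi> j a) + (\<Sum>i\<in>I. c i * (\<psi> i b * \<psi> i a)) = 0"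
        using insert.prems(1)[OF _ b(1) a] by simp
      have "(\<Sum>i\<in>I. (c i * (\<psi> i b - \<psi> j b)) * \<psi> i a) =
          (\<Sum>i\<in>I. c i * (\<psi> i b * \<psi> i a)) - \<psi> j b * (\<Sum>i\<in>I. c i * \<psi> i a)"
        by (simp add: algebra_simps sum_subtractf sum_distrib_left)
      also have "\<dots> = - (c j * (\<psi> j b * \<psi> j a)) - \<psi> j b * (- (c j * \<psi> j a))"
        using 1 2 unfolding add_eq_0_iff by simp
      finally show ?thesis by simp
    qed
    then have "c i * (\<psi> i b - \<psi> j b) = 0"
      using insert.IH[of "\<lambda>i. c i * (\<psi> i b - \<psi> j b)" i] insert.prems that by blast
    then show ?thesis using b by simp
  qed
  show ?case
  proof (cases "i = j")
    case True
    obtain a where a: "a \<in> A" "\<psi> j a \<noteq> 0" using insert.prems(3)[of j] by blast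
    have "c j * \<psi> j a + (\<Sum>i\<in>I. c i * \<psi> i a) = 0"
      using insert.prems(4)[OF a(1)] insert.hyps by simp
    then show ?thesis using a * True by simp
  qed (use * insert.prems in auto)
qed

lemma polyfuns_sum:
  "finite F \<Longrightarrow> (\<And>i. i \<in> F \<Longrightarrow> g i \<in> polyfuns C) \<Longrightarrow> (\<lambda>x. \<Sum>i\<in>F. g i x) \<in> polyfuns C"
  by (induction F rule: finite_induct) (auto intro: polyfuns.intros)

lemma regular_coord: "f \<in> coords V \<Longrightarrow> regular V f"
  unfolding regular_def by (blast intro: polyfuns.coord)

lemma regular_polyfun: "f \<in> polyfuns (coords V) \<Longrightarrow> regular V f"
  unfolding regular_def by blast

lemma regular_const [simp]: "regular V (\<lambda>_. c)"
  by (blast intro: regular_polyfun polyfuns.const)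

lemma regular_add: "regular V f \<Longrightarrow> regular V g \<Longrightarrow> regular V (\<lambda>x. f x + g x)"
  unfolding regular_def by (fastforce intro: polyfuns.add)

lemma regular_mult: "regular V f \<Longrightarrow> regular V g \<Longrightarrow> regular V (\<lambda>x. f x * g x)"
  unfolding regular_def by (fastforce intro: polyfuns.mult)

lemma regular_diff: "regular V f \<Longrightarrow> regular V g \<Longrightarrow> regular V (\<lambda>x. f x - g x)"
  using regular_add[of V f "\<lambda>x. (- 1) * g x"] regular_mult[of V "\<lambda>_. - 1" g] by simp

lemma regular_power: "regular V f \<Longrightarrow> regular V (\<lambda>x. f x ^ n)"
  by (induction n) (auto intro: regular_mult)

lemma regular_sum:
  "(\<And>i. i \<in> F \<Longrightarrow> regular V (g i)) \<Longrightarrow> regular V (\<lambda>x. \<Sum>i\<in>F. g i x)"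
  by (induction F rule: infinite_finite_induct) (auto intro: regular_add)

lemma regular_cong: "(\<And>x. x \<in> pts V \<Longrightarrow> f x = g x) \<Longrightarrow> regular V f \<longleftrightarrow> regular V g"
  unfolding regular_def by simp

lemma regular_comp:
  assumes "regular W f" and "morphism V W \<phi>"
  shows "regular V (f \<circ> \<phi>)"
proof -
  obtain p where p: "p \<in> polyfuns (coords W)" "\<And>x. x \<in> pts W \<Longrightarrow> f x = p x"
    using assms(1) unfolding regular_def by blast
  have "regular V (p \<circ> \<phi>)"
    using p(1)
  proof induction
    case (coord f)
    then show ?case using assms(2) unfolding morphism_def by blast
  qed (auto simp: comp_def intro: regular_add regular_mult)
  moreover have "f (\<phi> x) = p (\<phi> x)" if "x \<in> pts V" for x
    using assms(2) p(2) that unfolding morphism_def by blast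
  ultimately show ?thesis
    using regular_cong[of V "f \<circ> \<phi>" "p \<circ> \<phi>"] by simp
qed

lemma morphism_comp: "morphism U V \<phi> \<Longrightarrow> morphism V W \<psi> \<Longrightarrow> morphism U W (\<psi> \<circ> \<phi>)"
  unfolding morphism_def
  by (auto simp: comp_assoc[symmetric] intro!: regular_comp[of V _ U \<phi>] simp: morphism_def)

lemma morphism_cong:
  assumes "\<And>x. x \<in> pts V \<Longrightarrow> \<phi> x = \<psi> x"
  shows "morphism V W \<phi> \<longleftrightarrow> morphism V W \<psi>"
proof -
  have "regular V (f \<circ> \<phi>) \<longleftrightarrow> regular V (f \<circ> \<psi>)" for f
    by (rule regular_cong) (simp add: assms)
  moreover have "\<phi> ` pts V = \<psi> ` pts V" using assms by (rule image_cong[OF refl])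
  ultimately show ?thesis unfolding morphism_def by simp
qed

lemma irreducible_mult_zero:
  assumes irr: "irreducible_space V" and f: "regular V f" and g: "regular V g"
    and fg: "\<And>x. x \<in> pts V \<Longrightarrow> f x * g x = 0"
  shows "(\<forall>x \<in> pts V. f x = 0) \<or> (\<forall>x \<in> pts V. g x = 0)"
proof -
  define Z where "Z h = {x \<in> pts V. h x = (0::'b)}" for h
  have cl: "zariski_closed V (Z h)" if "regular V h" for h
    unfolding zariski_closed_def by (rule exI[of _ "{h}"]) (use that in \<open>auto simp: Z_def\<close>)
  have "pts V = Z f \<union> Z g" using fg by (auto simp: Z_def)
  then have "Z f = pts V \<or> Z g = pts V"
    using irr cl[OF f] cl[OF g] unfolding irreducible_space_def by blast
  then show ?thesis by (auto simp: Z_def)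
qed

text \<open>The complement of \<open>O'\<close> is cut out by regular functions, one of which,
  \<open>h\<close>, does not vanish at a chosen point of \<open>O'\<close>. The product of
  \<open>f\<close> and \<open>h\<close> is zero everywhere, and irreducibility removes the factor
  \<open>h\<close>.\<close>

lemma zariski_open_dense:
  assumes irr: "irreducible_space V" and O: "zariski_open V O'" "O' \<noteq> {}"
    and f: "regular V f" and 0: "\<And>x. x \<in> O' \<Longrightarrow> f x = 0" and x: "x \<in> pts V"
  shows "f x = 0"
proof -
  obtain P where P: "\<And>h. h \<in> P \<Longrightarrow> regular V h" "pts V - O' = {x \<in> pts V. \<forall>h \<in> P. h x = 0}"
    using O unfolding zariski_open_def zariski_closed_def by blast
  obtain y where y: "y \<in> O'" "y \<in> pts V" using O unfolding zariski_open_def by blast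
  then obtain h where h: "h \<in> P" "h y \<noteq> 0" using P(2) by blast
  have "f x * h x = 0" if "x \<in> pts V" for x
    using that P(2) 0 h by (cases "x \<in> O'") auto
  then show ?thesis
    using irreducible_mult_zero[OF irr f P(1)[OF h(1)]] h y x by blast
qed

lemma polyfuns_slice:
  assumes "p \<in> polyfuns (coords (prod_space A V))"
  shows "(\<lambda>x. p (a, x)) \<in> polyfuns (coords V)"
  using assms
  by induction (auto simp: prod_space_def intro: polyfuns.intros)

text \<open>A multiplicative family \<psi> that contains the coordinates of the first factor spans
  the polynomial functions there, so products of sums regroup by the index \<open>i + j\<close>. It
  is used with the characters of the torus and with the powers of the additive parameter.\<close>

lemma polyfuns_prod_expansion:
  fixes \<psi> :: "'i::comm_monoid_add \<Rightarrow> 'a \<Rightarrow> 'k::field"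
  assumes K: "0 \<in> K" "\<And>i j. i \<in> K \<Longrightarrow> j \<in> K \<Longrightarrow> i + j \<in> K"
    and \<psi>: "\<And>a. a \<in> pts A \<Longrightarrow> \<psi> 0 a = 1"
      "\<And>i j a. i \<in> K \<Longrightarrow> j \<in> K \<Longrightarrow> a \<in> pts A \<Longrightarrow> \<psi> (i + j) a = \<psi> i a * \<psi> j a"
    and C: "\<And>c. c \<in> coords A \<Longrightarrow> \<exists>i\<in>K. \<forall>a\<in>pts A. c a = \<psi> i a"
    and p: "p \<in> polyfuns (coords (prod_space A V))"
  shows "\<exists>F f. finite F \<and> F \<subseteq> K \<and> (\<forall>i. f i \<in> polyfuns (coords V)) \<and>
      (\<forall>a\<in>pts A. \<forall>x. p (a, x) = (\<Sum>i\<in>F. \<psi> i a * f i x))"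
  using p
proof induction
  case (const c)
  show ?case
    by (rule exI[of _ "{0}"], rule exI[of _ "\<lambda>_ _. c"])
      (auto simp: K \<psi> intro: polyfuns.const)
next
  case (coord f)
  then consider c where "c \<in> coords A" "f = c \<circ> fst" | g where "g \<in> coords V" "f = g \<circ> snd"
    unfolding prod_space_def by auto
  then show ?case
  proof cases
    case 1
    then obtain i where "i \<in> K" "\<forall>a\<in>pts A. c a = \<psi> i a" using C by blast
    then show ?thesis
      by (intro exI[of _ "{i}"] exI[of _ "\<lambda>_ _. 1"]) (auto simp: 1 intro: polyfuns.const)
  next
    case 2
    then show ?thesis
      by (intro exI[of _ "{0}"] exI[of _ "\<lambda>_. g"]) (auto simp: K \<psi> intro: polyfuns.coord)
  qed
next
  case (add p q)
  from add.IH(1) obtain F f where F: "finite F" "F \<subseteq> K" "\<forall>i. f i \<in> polyfuns (coords V)"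
      "\<forall>a\<in>pts A. \<forall>x. p (a, x) = (\<Sum>i\<in>F. \<psi> i a * f i x)"
    by (elim exE conjE) (rule that)
  from add.IH(2) obtain G g where G: "finite G" "G \<subseteq> K" "\<forall>i. g i \<in> polyfuns (coords V)"
      "\<forall>a\<in>pts A. \<forall>x. q (a, x) = (\<Sum>i\<in>G. \<psi> i a * g i x)"
    by (elim exE conjE) (rule that)
  define h where "h i = (\<lambda>x. (if i \<in> F then f i x else 0) + (if i \<in> G then g i x else 0))" for i
  have "h i \<in> polyfuns (coords V)" for i
    unfolding h_def using F(3)[rule_format, of i] G(3)[rule_format, of i]
    by (cases "i \<in> F"; cases "i \<in> G") (auto intro: polyfuns.add polyfuns.const)
  moreover have "p (a, x) + q (a, x) = (\<Sum>i\<in>F \<union> G. \<psi> i a * h i x)" if "a \<in> pts A" for a x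
  proof -
    have "(\<Sum>i\<in>F \<union> G. \<psi> i a * h i x) =
        (\<Sum>i\<in>F \<union> G. \<psi> i a * (if i \<in> F then f i x else 0)) +
        (\<Sum>i\<in>F \<union> G. \<psi> i a * (if i \<in> G then g i x else 0))"
      by (simp add: h_def distrib_left sum.distrib)
    also have "(\<Sum>i\<in>F \<union> G. \<psi> i a * (if i \<in> F then f i x else 0)) = (\<Sum>i\<in>F. \<psi> i a * f i x)"
      by (rule sum.mono_neutral_cong_right) (use F G in auto)
    also have "(\<Sum>i\<in>F \<union> G. \<psi> i a * (if i \<in> G then g i x else 0)) = (\<Sum>i\<in>G. \<psi> i a * g i x)"
      by (rule sum.mono_neutral_cong_right) (use F G in auto)
    finally show ?thesis using F(4) G(4) that by simp
  qed
  ultimately show ?case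
    using F(1,2) G(1,2) by (intro exI[of _ "F \<union> G"] exI[of _ h]) auto
next
  case (mult p q)
  from mult.IH(1) obtain F f where F: "finite F" "F \<subseteq> K" "\<forall>i. f i \<in> polyfuns (coords V)"
      "\<forall>a\<in>pts A. \<forall>x. p (a, x) = (\<Sum>i\<in>F. \<psi> i a * f i x)"
    by (elim exE conjE) (rule that)
  from mult.IH(2) obtain G g where G: "finite G" "G \<subseteq> K" "\<forall>i. g i \<in> polyfuns (coords V)"
      "\<forall>a\<in>pts A. \<forall>x. q (a, x) = (\<Sum>i\<in>G. \<psi> i a * g i x)"
    by (elim exE conjE) (rule that)
  define s where "s = (\<lambda>(i, j). i + j :: 'i)"
  define h where "h k = (\<lambda>x. \<Sum>(i, j)\<in>{ij \<in> F \<times> G. s ij = k}. f i x * g j x)" for k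
  have fin: "finite {ij \<in> F \<times> G. s ij = k}" for k
    by (rule finite_subset[of _ "F \<times> G"]) (use F(1) G(1) in auto)
  have "h k \<in> polyfuns (coords V)" for k
    unfolding h_def split_def
    by (rule polyfuns_sum[OF fin]) (auto intro: F(3)[rule_format] G(3)[rule_format] polyfuns.mult)
  moreover have "p (a, x) * q (a, x) = (\<Sum>k\<in>s ` (F \<times> G). \<psi> k a * h k x)" if a: "a \<in> pts A" for a x
  proof -
    have "p (a, x) * q (a, x) = (\<Sum>(i, j)\<in>F \<times> G. (\<psi> i a * f i x) * (\<psi> j a * g j x))"
      using F(4) G(4) a by (simp add: sum_product sum.cartesian_product)
    also have "\<dots> = (\<Sum>ij\<in>F \<times> G. \<psi> (s ij) a * (f (fst ij) x * g (snd ij) x))"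
      by (rule sum.cong) (use F(2) G(2) a \<psi>(2) in \<open>auto simp: s_def subset_iff\<close>)
    also have "\<dots> = (\<Sum>k\<in>s ` (F \<times> G). \<Sum>ij\<in>{ij \<in> F \<times> G. s ij = k}.
        \<psi> (s ij) a * (f (fst ij) x * g (snd ij) x))"
      by (rule sum.image_gen) (use F G in auto)
    also have "\<dots> = (\<Sum>k\<in>s ` (F \<times> G). \<psi> k a * h k x)"
      by (rule sum.cong) (auto simp: h_def sum_distrib_left split_def intro!: sum.cong)
    finally show ?thesis .
  qed
  moreover have "s ` (F \<times> G) \<subseteq> K" using F(2) G(2) by (auto simp: s_def intro!: K(2))
  ultimately show ?case
    using F(1) G(1) by (intro exI[of _ "s ` (F \<times> G)"] exI[of _ h]) auto
qed

section \<open>Automorphism groups and regular actions\<close>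

lemma mem_Aut: "g \<in> carrier (Aut X) \<longleftrightarrow> g \<in> Bij (pts X) \<and> isomorphism X X g"
  by (simp add: Aut_def)

lemma Bij_in: "g \<in> Bij P \<Longrightarrow> x \<in> P \<Longrightarrow> g x \<in> P"
  using Bij_imp_funcset by blast

lemma Aut_in: "g \<in> carrier (Aut X) \<Longrightarrow> x \<in> pts X \<Longrightarrow> g x \<in> pts X"
  by (auto simp: mem_Aut Bij_in)

lemma Aut_mult:
  "g \<in> carrier (Aut X) \<Longrightarrow> h \<in> carrier (Aut X) \<Longrightarrow> g \<otimes>\<^bsub>Aut X\<^esub> h = compose (pts X) g h"
  by (simp add: Aut_def BijGroup_def)

lemma Aut_mult_apply:
  "g \<in> carrier (Aut X) \<Longrightarrow> h \<in> carrier (Aut X) \<Longrightarrow> x \<in> pts X \<Longrightarrow> (g \<otimes>\<^bsub>Aut X\<^esub> h) x = g (h x)"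
  by (simp add: Aut_mult compose_eq)

lemma Aut_one_apply: "x \<in> pts X \<Longrightarrow> \<one>\<^bsub>Aut X\<^esub> x = x"
  by (simp add: Aut_def BijGroup_def)

lemma Aut_eqI:
  assumes "g \<in> carrier (Aut X)" "h \<in> carrier (Aut X)" "\<And>x. x \<in> pts X \<Longrightarrow> g x = h x"
  shows "g = h"
  using assms by (intro extensionalityI[of g "pts X" h]) (auto simp: mem_Aut Bij_def)

lemma Aut_regular:
  "g \<in> carrier (Aut X) \<Longrightarrow> regular X f \<Longrightarrow> regular X (\<lambda>x. f (g x))"
  using regular_comp[of X f X g] by (auto simp: mem_Aut isomorphism_def comp_def)

text \<open>\<open>isomorphism\<close> speaks of \<open>inv_into\<close>, while the group of
  bijections has its own extensional inverse; both agree on \<open>pts X\<close>. In this form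
  closure under inverses is evident.\<close>

lemma Aut_iff:
  "g \<in> carrier (Aut X) \<longleftrightarrow> g \<in> carrier (BijGroup (pts X)) \<and> morphism X X g \<and>
     morphism X X (inv\<^bsub>BijGroup (pts X)\<^esub> g)"
proof (cases "g \<in> Bij (pts X)")
  case True
  have "morphism X X (inv_into (pts X) g) \<longleftrightarrow> morphism X X (inv\<^bsub>BijGroup (pts X)\<^esub> g)"
    unfolding inv_BijGroup[OF True] by (rule morphism_cong) simp
  then show ?thesis using True by (auto simp: mem_Aut isomorphism_def BijGroup_def Bij_def)
qed (simp add: mem_Aut BijGroup_def)

lemma subgroup_Aut: "subgroup (carrier (Aut X)) (BijGroup (pts X))"
proof -
  interpret group "BijGroup (pts X)" by (rule group_BijGroup)
  have mult: "morphism X X (f \<otimes>\<^bsub>BijGroup (pts X)\<^esub> g)"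
    if "f \<in> carrier (BijGroup (pts X))" "g \<in> carrier (BijGroup (pts X))"
      "morphism X X f" "morphism X X g" for f g
    using that(1,2) morphism_comp[OF that(4,3)] morphism_cong[of X "f \<circ> g" "compose (pts X) f g" X]
    by (simp add: BijGroup_def compose_eq)
  have one: "morphism X X \<one>\<^bsub>BijGroup (pts X)\<^esub>"
    using morphism_cong[of X "\<lambda>x. x" "\<lambda>x\<in>pts X. x" X]
    by (simp add: BijGroup_def morphism_def comp_def regular_coord)
  show ?thesis
    by (rule subgroup.intro) (auto simp: Aut_iff inv_mult_group mult one)
qed

lemma Aut_eq: "Aut X = (BijGroup (pts X))\<lparr>carrier := carrier (Aut X)\<rparr>"
  by (simp add: Aut_def)

lemma group_Aut: "group (Aut X)"
  using group.subgroup_imp_group[OF group_BijGroup subgroup_Aut[of X]] Aut_eq[of X] by simp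

text \<open>Slicing the action morphism at \<open>g\<close> gives a morphism of \<open>X\<close>,
  and its inverse is the slice at the inverse of \<open>g\<close>.\<close>

lemma action_in_Aut:
  assumes act: "effective_regular_action \<Gamma> C X \<alpha>" and g: "g \<in> carrier \<Gamma>"
  shows "\<alpha> g \<in> carrier (Aut X)"
proof -
  interpret faithful_action \<Gamma> "pts X" \<alpha>
    using act by (simp add: effective_regular_action_def)
  interpret group_hom \<Gamma> "BijGroup (pts X)" \<alpha> by (rule group_hom)
  have mor: "morphism X X (\<alpha> g)" if g: "g \<in> carrier \<Gamma>" for g
  proof -
    have a: "\<alpha> g ` pts X \<subseteq> pts X"
      using hom_closed[OF g] by (auto simp: BijGroup_def Bij_in)
    have "regular X (f \<circ> \<alpha> g)" if "f \<in> coords X" for f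
    proof -
      have "regular (prod_space \<lparr>pts = carrier \<Gamma>, coords = C\<rparr> X) (f \<circ> (\<lambda>(g, x). \<alpha> g x))"
        using act that unfolding effective_regular_action_def morphism_def by blast
      then obtain p where p: "p \<in> polyfuns (coords (prod_space \<lparr>pts = carrier \<Gamma>, coords = C\<rparr> X))"
        "\<And>x. x \<in> pts X \<Longrightarrow> f (\<alpha> g x) = p (g, x)"
        using g unfolding regular_def by (auto simp: prod_space_def)
      show ?thesis unfolding regular_def
        using polyfuns_slice[OF p(1), of g] p(2) by auto
    qed
    then show ?thesis using a by (simp add: morphism_def)
  qed
  have "morphism X X (inv\<^bsub>BijGroup (pts X)\<^esub> (\<alpha> g))"
    using mor[of "inv\<^bsub>\<Gamma>\<^esub> g"] hom_inv[OF g] g by simp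
  then show ?thesis using hom_closed[OF g] mor[OF g] by (simp add: Aut_iff)
qed

lemma action_mult:
  assumes act: "effective_regular_action \<Gamma> C X \<alpha>" and g: "g \<in> carrier \<Gamma>" "h \<in> carrier \<Gamma>"
    and x: "x \<in> pts X"
  shows "\<alpha> (g \<otimes>\<^bsub>\<Gamma>\<^esub> h) x = \<alpha> g (\<alpha> h x)"
proof -
  interpret faithful_action \<Gamma> "pts X" \<alpha>
    using act by (simp add: effective_regular_action_def)
  interpret group_hom \<Gamma> "BijGroup (pts X)" \<alpha> by (rule group_hom)
  show ?thesis
    using hom_mult[OF g] hom_closed[OF g(1)] hom_closed[OF g(2)] x
    by (simp add: BijGroup_def compose_eq)
qed

lemma action_mult_Aut:
  assumes act: "effective_regular_action \<Gamma> C X \<alpha>" and g: "g \<in> carrier \<Gamma>" "h \<in> carrier \<Gamma>"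
  shows "\<alpha> (g \<otimes>\<^bsub>\<Gamma>\<^esub> h) = \<alpha> g \<otimes>\<^bsub>Aut X\<^esub> \<alpha> h"
proof -
  interpret faithful_action \<Gamma> "pts X" \<alpha>
    using act by (simp add: effective_regular_action_def)
  interpret group_hom \<Gamma> "BijGroup (pts X)" \<alpha> by (rule group_hom)
  show ?thesis using hom_mult[OF g] by (simp add: Aut_def)
qed

lemma action_inj:
  assumes "effective_regular_action \<Gamma> C X \<alpha>"
  shows "inj_on \<alpha> (carrier \<Gamma>)"
proof -
  interpret faithful_action \<Gamma> "pts X" \<alpha>
    using assms by (simp add: effective_regular_action_def)
  show ?thesis by (rule faithful)
qed

lemma action_expansion:
  fixes \<psi> :: "'i::comm_monoid_add \<Rightarrow> 'a \<Rightarrow> 'k::field"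
  assumes act: "effective_regular_action \<Gamma> C X \<alpha>"
    and K: "0 \<in> K" "\<And>i j. i \<in> K \<Longrightarrow> j \<in> K \<Longrightarrow> i + j \<in> K"
    and \<psi>: "\<And>a. a \<in> carrier \<Gamma> \<Longrightarrow> \<psi> 0 a = 1"
      "\<And>i j a. i \<in> K \<Longrightarrow> j \<in> K \<Longrightarrow> a \<in> carrier \<Gamma> \<Longrightarrow> \<psi> (i + j) a = \<psi> i a * \<psi> j a"
    and C: "\<And>c. c \<in> C \<Longrightarrow> \<exists>i\<in>K. \<forall>a\<in>carrier \<Gamma>. c a = \<psi> i a"
    and f: "regular X f"
  shows "\<exists>F h. finite F \<and> F \<subseteq> K \<and> (\<forall>i. regular X (h i)) \<and>
      (\<forall>a\<in>carrier \<Gamma>. \<forall>x\<in>pts X. f (\<alpha> a x) = (\<Sum>i\<in>F. \<psi> i a * h i x))"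
proof -
  let ?A = "\<lparr>pts = carrier \<Gamma>, coords = C\<rparr>"
  have "regular (prod_space ?A X) (f \<circ> (\<lambda>(g, x). \<alpha> g x))"
    using act f by (auto intro: regular_comp simp: effective_regular_action_def)
  then obtain p where p: "p \<in> polyfuns (coords (prod_space ?A X))"
    "\<And>a x. a \<in> carrier \<Gamma> \<Longrightarrow> x \<in> pts X \<Longrightarrow> f (\<alpha> a x) = p (a, x)"
    unfolding regular_def by (auto simp: prod_space_def)
  have "\<exists>F h. finite F \<and> F \<subseteq> K \<and> (\<forall>i. h i \<in> polyfuns (coords X)) \<and>
      (\<forall>a\<in>pts ?A. \<forall>x. p (a, x) = (\<Sum>i\<in>F. \<psi> i a * h i x))"
    by (rule polyfuns_prod_expansion[OF K]) (use \<psi> C p(1) in auto)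
  then obtain F h where "finite F" "F \<subseteq> K" "\<forall>i. h i \<in> polyfuns (coords X)"
      "\<forall>a\<in>pts ?A. \<forall>x. p (a, x) = (\<Sum>i\<in>F. \<psi> i a * h i x)"
    by (elim exE conjE) (rule that)
  then show ?thesis
    using p(2) by (intro exI[of _ F] exI[of _ h]) (auto intro: regular_polyfun)
qed

section \<open>Functions graded by a monoid of characters\<close>

text \<open>All that remains of the torus in the study of roots: a monoid of weights, weight
  functions with value 1 at \<open>x0\<close>, and their density, independence and separation
  properties. The characters live in an arbitrary abelian group, realized later by integer exponent
  vectors.\<close>

locale toric_data =
  fixes X :: "('p, 'k::field_char_0) space"
    and S :: "'m::ab_group_add set"
    and \<chi> :: "'m \<Rightarrow> 'p \<Rightarrow> 'k"
    and x0 :: 'p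
  assumes irreducible: "irreducible_space X"
    and S_zero: "0 \<in> S"
    and S_add: "m \<in> S \<Longrightarrow> m' \<in> S \<Longrightarrow> m + m' \<in> S"
    and chi_zero: "x \<in> pts X \<Longrightarrow> \<chi> 0 x = 1"
    and chi_add: "m \<in> S \<Longrightarrow> m' \<in> S \<Longrightarrow> x \<in> pts X \<Longrightarrow> \<chi> (m + m') x = \<chi> m x * \<chi> m' x"
    and chi_regular: "m \<in> S \<Longrightarrow> regular X (\<chi> m)"
    and regular_span: "regular X f \<Longrightarrow>
      \<exists>F a. finite F \<and> F \<subseteq> S \<and> (\<forall>x\<in>pts X. f x = (\<Sum>m\<in>F. a m * \<chi> m x))"
    and base_in: "x0 \<in> pts X"
    and chi_base: "m \<in> S \<Longrightarrow> \<chi> m x0 = 1"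
    and dense: "regular X h \<Longrightarrow> (\<And>x. x \<in> pts X \<Longrightarrow> \<forall>m\<in>S. \<chi> m x \<noteq> 0 \<Longrightarrow> h x = 0) \<Longrightarrow>
      x \<in> pts X \<Longrightarrow> h x = 0"
    and chi_independent: "finite F \<Longrightarrow> F \<subseteq> S \<Longrightarrow>
      (\<And>x. x \<in> pts X \<Longrightarrow> (\<Sum>m\<in>F. a m * \<chi> m x) = 0) \<Longrightarrow> m \<in> F \<Longrightarrow> a m = 0"
    and chi_separates: "x \<in> pts X \<Longrightarrow> y \<in> pts X \<Longrightarrow> (\<And>m. m \<in> S \<Longrightarrow> \<chi> m x = \<chi> m y) \<Longrightarrow> x = y"
begin

abbreviation aut_mult (infixl "\<cdot>" 70) where
  "g \<cdot> h \<equiv> g \<otimes>\<^bsub>Aut X\<^esub> h"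

definition Xo :: "'p set" where
  "Xo = {x \<in> pts X. \<forall>m\<in>S. \<chi> m x \<noteq> 0}"

text \<open>On \<open>Xo\<close>, where no weight function vanishes, \<open>ch\<close> extends \<open>\<chi>\<close> to the group \<open>M\<close> generated by \<open>S\<close>.\<close>

definition M :: "'m set" where
  "M = {a - b | a b. a \<in> S \<and> b \<in> S}"

definition ch :: "'m \<Rightarrow> 'p \<Rightarrow> 'k" where
  "ch d x = (let p = SOME p. fst p \<in> S \<and> snd p \<in> S \<and> d = fst p - snd p
     in \<chi> (fst p) x / \<chi> (snd p) x)"

lemma Xo_pts: "x \<in> Xo \<Longrightarrow> x \<in> pts X"
  by (simp add: Xo_def)

lemma Xo_nz: "x \<in> Xo \<Longrightarrow> m \<in> S \<Longrightarrow> \<chi> m x \<noteq> 0"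
  by (simp add: Xo_def)

lemma base_Xo: "x0 \<in> Xo"
  by (simp add: Xo_def base_in chi_base)

text \<open>Two presentations of one difference give \<open>a + snd p = fst p + b\<close> in
  \<open>S\<close>, and multiplicativity of \<chi> turns this into equality of the quotients. The
  choice made in \<open>ch\<close> is therefore harmless.\<close>

lemma ch_diff:
  assumes "a \<in> S" "b \<in> S" "x \<in> Xo"
  shows "ch (a - b) x = \<chi> a x / \<chi> b x"
proof -
  define p where "p = (SOME p. fst p \<in> S \<and> snd p \<in> S \<and> a - b = fst p - snd p)"
  have "fst p \<in> S \<and> snd p \<in> S \<and> a - b = fst p - snd p"
    unfolding p_def by (rule someI[of _ "(a, b)"]) (use assms in auto)
  then have p: "fst p \<in> S" "snd p \<in> S" "a + snd p = fst p + b"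
    by (auto simp: algebra_simps)
  have "\<chi> a x * \<chi> (snd p) x = \<chi> (fst p) x * \<chi> b x"
    using chi_add[of a "snd p" x] chi_add[of "fst p" b x] p assms Xo_pts by simp
  then have "\<chi> a x / \<chi> b x = \<chi> (fst p) x / \<chi> (snd p) x"
    using p assms Xo_nz by (simp add: frac_eq_eq)
  then show ?thesis by (simp add: ch_def Let_def p_def)
qed

lemma M_I: "a \<in> S \<Longrightarrow> b \<in> S \<Longrightarrow> a - b \<in> M"
  by (auto simp: M_def)

lemma M_E:
  assumes "d \<in> M"
  obtains a b where "a \<in> S" "b \<in> S" "d = a - b"
  using assms by (auto simp: M_def)

lemma S_M: "m \<in> S \<Longrightarrow> m \<in> M"
  using M_I[of m 0] S_zero by simp

lemma M_add:
  assumes "d \<in> M" "d' \<in> M"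
  shows "d + d' \<in> M"
proof -
  obtain a b where "a \<in> S" "b \<in> S" "d = a - b" using assms(1) by (rule M_E)
  moreover obtain a' b' where "a' \<in> S" "b' \<in> S" "d' = a' - b'" using assms(2) by (rule M_E)
  ultimately have "d + d' = (a + a') - (b + b')" "a + a' \<in> S" "b + b' \<in> S"
    by (auto simp: S_add)
  then show ?thesis using M_I by presburger
qed

lemma ch_S: "m \<in> S \<Longrightarrow> x \<in> Xo \<Longrightarrow> ch m x = \<chi> m x"
  using ch_diff[of m 0 x] S_zero chi_zero Xo_pts by simp

lemma ch_add:
  assumes "d \<in> M" "d' \<in> M" and x: "x \<in> Xo"
  shows "ch (d + d') x = ch d x * ch d' x"
proof -
  obtain a b where a: "a \<in> S" "b \<in> S" "d = a - b" using assms(1) by (rule M_E)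
  obtain a' b' where b: "a' \<in> S" "b' \<in> S" "d' = a' - b'" using assms(2) by (rule M_E)
  have *: "d + d' = (a + a') - (b + b')" "a + a' \<in> S" "b + b' \<in> S"
    using a b by (auto simp: S_add)
  have "ch (d + d') x = \<chi> (a + a') x / \<chi> (b + b') x"
    unfolding *(1) by (rule ch_diff[OF *(2,3) x])
  then show ?thesis
    using a b x by (simp add: chi_add ch_diff Xo_pts)
qed

lemma ch_base: "d \<in> M \<Longrightarrow> ch d x0 = 1"
  by (elim M_E) (simp add: ch_diff base_Xo chi_base)

text \<open>Fixing the value 0 outside of \<open>M\<close> makes equality of functions the equality of functionals on \<open>M\<close>.\<close>

definition additive :: "('m \<Rightarrow> int) \<Rightarrow> bool" where
  "additive \<rho> \<longleftrightarrow> (\<forall>d. d \<notin> M \<longrightarrow> \<rho> d = 0) \<and> (\<forall>d\<in>M. \<forall>d'\<in>M. \<rho> (d + d') = \<rho> d + \<rho> d') \<and>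
     (\<forall>m\<in>S. 0 \<le> \<rho> m)"

lemma additive_add: "additive \<rho> \<Longrightarrow> d \<in> M \<Longrightarrow> d' \<in> M \<Longrightarrow> \<rho> (d + d') = \<rho> d + \<rho> d'"
  by (simp add: additive_def)

lemma additive_nonneg: "additive \<rho> \<Longrightarrow> m \<in> S \<Longrightarrow> 0 \<le> \<rho> m"
  by (simp add: additive_def)

lemma additive_diff: "additive \<rho> \<Longrightarrow> a \<in> S \<Longrightarrow> b \<in> S \<Longrightarrow> \<rho> (a - b) = \<rho> a - \<rho> b"
  using additive_add[of \<rho> "a - b" b] by (simp add: M_I S_M)

lemma additive_zero: "additive \<rho> \<Longrightarrow> \<rho> 0 = 0"
  using additive_diff[of \<rho> 0 0] S_zero by simp

lemma additive_eqI:
  assumes "additive \<rho>" "additive \<sigma>" "\<And>m. m \<in> S \<Longrightarrow> \<rho> m = \<sigma> m"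
  shows "\<rho> = \<sigma>"
proof
  fix d show "\<rho> d = \<sigma> d"
  proof (cases "d \<in> M")
    case True
    then show ?thesis using assms by (elim M_E) (simp add: additive_diff)
  next
    case False
    then show ?thesis using assms by (simp add: additive_def)
  qed
qed

text \<open>Natural powers suffice on \<open>S\<close>, where \<open>r\<close> is nonnegative. As
  the factors are nonzero, quotients carry the formula over to \<open>M\<close>, with integer
  powers.\<close>

lemma torus_step:
  assumes Q: "finite Q" "\<And>r. r \<in> Q \<Longrightarrow> additive r" "\<And>r. r \<in> Q \<Longrightarrow> z r \<noteq> 0"
    and x: "x \<in> Xo" and y: "y \<in> pts X"
    and eq: "\<And>m. m \<in> S \<Longrightarrow> \<chi> m y = \<chi> m x * (\<Prod>r\<in>Q. z r ^ nat (r m))"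
  shows "y \<in> Xo" and "d \<in> M \<Longrightarrow> ch d y = ch d x * (\<Prod>r\<in>Q. z r powi r d)"
proof -
  have nz: "(\<Prod>r\<in>Q. z r ^ nat (r m)) \<noteq> 0" for m using Q by simp
  show Y: "y \<in> Xo" using y nz eq Xo_nz[OF x] by (simp add: Xo_def)
  have e: "\<chi> m y = \<chi> m x * (\<Prod>r\<in>Q. z r powi r m)" if "m \<in> S" for m
    using eq[OF that] additive_nonneg[OF Q(2) that] by (simp add: power_int_def)
  assume "d \<in> M"
  then obtain a b where ab: "a \<in> S" "b \<in> S" "d = a - b" by (rule M_E)
  have "(\<Prod>r\<in>Q. z r powi r d) = (\<Prod>r\<in>Q. z r powi r a / z r powi r b)"
    by (rule prod.cong) (use ab Q in \<open>auto simp: additive_diff power_int_diff\<close>)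
  then show "ch d y = ch d x * (\<Prod>r\<in>Q. z r powi r d)"
    using ab x Y by (simp add: ch_diff e prod_dividef)
qed

text \<open>Identities between Laurent functions may be checked where a nonzero Laurent function does not
  vanish, by irreducibility of \<open>X\<close>.\<close>

definition Lau :: "('p \<Rightarrow> 'k) \<Rightarrow> bool" where
  "Lau f \<longleftrightarrow> (\<exists>b\<in>S. \<exists>h. regular X h \<and> (\<forall>x\<in>Xo. f x * \<chi> b x = h x))"

lemma LauE:
  assumes "Lau f"
  obtains b h where "b \<in> S" "regular X h" "\<And>x. x \<in> Xo \<Longrightarrow> f x * \<chi> b x = h x"
  using assms unfolding Lau_def by blast

lemma LauI: "b \<in> S \<Longrightarrow> regular X h \<Longrightarrow> (\<And>x. x \<in> Xo \<Longrightarrow> f x * \<chi> b x = h x) \<Longrightarrow> Lau f"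
  unfolding Lau_def by blast

lemma Lau_regular: "regular X f \<Longrightarrow> Lau f"
  by (rule LauI[OF S_zero]) (auto simp: chi_zero Xo_pts)

lemma Lau_const [simp]: "Lau (\<lambda>_. c)"
  by (rule Lau_regular) simp

lemma Lau_cong: "(\<And>x. x \<in> Xo \<Longrightarrow> f x = g x) \<Longrightarrow> Lau f \<longleftrightarrow> Lau g"
  unfolding Lau_def by simp

lemma Lau_add:
  assumes "Lau f" "Lau g"
  shows "Lau (\<lambda>x. f x + g x)"
proof -
  obtain b h where 1: "b \<in> S" "regular X h" "\<And>x. x \<in> Xo \<Longrightarrow> f x * \<chi> b x = h x"
    using assms(1) by (rule LauE) blast
  obtain b' h' where 2: "b' \<in> S" "regular X h'" "\<And>x. x \<in> Xo \<Longrightarrow> g x * \<chi> b' x = h' x"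
    using assms(2) by (rule LauE) blast
  show ?thesis
  proof (rule LauI)
    show "b + b' \<in> S" using 1 2 S_add by blast
    show "regular X (\<lambda>x. h x * \<chi> b' x + h' x * \<chi> b x)"
      using 1 2 by (intro regular_add regular_mult chi_regular)
    show "(f x + g x) * \<chi> (b + b') x = h x * \<chi> b' x + h' x * \<chi> b x" if "x \<in> Xo" for x
      using 1(3)[OF that, symmetric] 2(3)[OF that, symmetric] 1(1) 2(1)
      by (simp add: chi_add Xo_pts that algebra_simps)
  qed
qed

lemma Lau_mult:
  assumes "Lau f" "Lau g"
  shows "Lau (\<lambda>x. f x * g x)"
proof -
  obtain b h where 1: "b \<in> S" "regular X h" "\<And>x. x \<in> Xo \<Longrightarrow> f x * \<chi> b x = h x"
    using assms(1) by (rule LauE) blast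
  obtain b' h' where 2: "b' \<in> S" "regular X h'" "\<And>x. x \<in> Xo \<Longrightarrow> g x * \<chi> b' x = h' x"
    using assms(2) by (rule LauE) blast
  show ?thesis
  proof (rule LauI)
    show "b + b' \<in> S" using 1 2 S_add by blast
    show "regular X (\<lambda>x. h x * h' x)" using 1 2 by (intro regular_mult)
    show "f x * g x * \<chi> (b + b') x = h x * h' x" if "x \<in> Xo" for x
      using 1(3)[OF that, symmetric] 2(3)[OF that, symmetric] 1(1) 2(1)
      by (simp add: chi_add Xo_pts that algebra_simps)
  qed
qed

lemma Lau_power: "Lau f \<Longrightarrow> Lau (\<lambda>x. f x ^ n)"
  by (induction n) (auto intro: Lau_mult)

lemma Lau_sum: "(\<And>i. i \<in> F \<Longrightarrow> Lau (g i)) \<Longrightarrow> Lau (\<lambda>x. \<Sum>i\<in>F. g i x)"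
  by (induction F rule: infinite_finite_induct) (auto intro: Lau_add)

lemma Lau_prod: "(\<And>i. i \<in> F \<Longrightarrow> Lau (g i)) \<Longrightarrow> Lau (\<lambda>x. \<Prod>i\<in>F. g i x)"
  by (induction F rule: infinite_finite_induct) (auto intro: Lau_mult)

lemma Lau_ch: "d \<in> M \<Longrightarrow> Lau (ch d)"
proof (elim M_E)
  fix a b assume "a \<in> S" "b \<in> S" "d = a - b"
  then show "Lau (ch d)"
    by (intro LauI[of b "\<chi> a"]) (auto simp: ch_diff Xo_nz intro: chi_regular)
qed

lemma dense_Xo: "regular X h \<Longrightarrow> (\<And>x. x \<in> Xo \<Longrightarrow> h x = 0) \<Longrightarrow> x \<in> pts X \<Longrightarrow> h x = 0"
  by (rule dense) (auto simp: Xo_def)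

text \<open>Clearing denominators reduces the claim to regular functions: their product vanishes on
  the dense set \<open>Xo\<close>, hence everywhere, and irreducibility of \<open>X\<close>
  applies.\<close>

lemma Lau_domain:
  assumes "Lau f" "Lau g" and fg: "\<And>x. x \<in> Xo \<Longrightarrow> f x * g x = 0"
  shows "(\<forall>x\<in>Xo. f x = 0) \<or> (\<forall>x\<in>Xo. g x = 0)"
proof -
  obtain b h where 1: "b \<in> S" "regular X h" "\<And>x. x \<in> Xo \<Longrightarrow> f x * \<chi> b x = h x"
    using assms(1) by (rule LauE) blast
  obtain b' h' where 2: "b' \<in> S" "regular X h'" "\<And>x. x \<in> Xo \<Longrightarrow> g x * \<chi> b' x = h' x"
    using assms(2) by (rule LauE) blast
  have r: "regular X (\<lambda>x. h x * h' x)" using 1 2 by (intro regular_mult)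
  have "h x * h' x = 0" if "x \<in> Xo" for x
    using 1(3)[OF that, symmetric] 2(3)[OF that, symmetric] fg[OF that] by auto
  then have "h x * h' x = 0" if "x \<in> pts X" for x
    using dense_Xo[OF r] that by blast
  then consider "\<forall>x\<in>pts X. h x = 0" | "\<forall>x\<in>pts X. h' x = 0"
    using irreducible_mult_zero[OF irreducible 1(2) 2(2)] by blast
  then show ?thesis
    by cases (metis 1(1,3) 2(1,3) Xo_nz Xo_pts mult_eq_0_iff)+
qed

text \<open>Laurent functions form a domain, so finitely many conditions
  \<open>w r x \<noteq> 0\<close>, each of them satisfiable, hold together at some point.\<close>

lemma Lau_prod_nonzero:
  assumes "finite Q" "\<And>r. r \<in> Q \<Longrightarrow> Lau (w r)" "\<And>r. r \<in> Q \<Longrightarrow> \<exists>x\<in>Xo. w r x \<noteq> 0"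
  shows "\<exists>x\<in>Xo. (\<Prod>r\<in>Q. w r x) \<noteq> 0"
  using assms
proof (induction Q rule: finite_induct)
  case empty
  then show ?case using base_Xo by auto
next
  case (insert r Q)
  have "Lau (w r)" "Lau (\<lambda>x. \<Prod>r\<in>Q. w r x)" using insert.prems by (auto intro: Lau_prod)
  moreover have "\<exists>x\<in>Xo. w r x \<noteq> 0" "\<exists>x\<in>Xo. (\<Prod>r\<in>Q. w r x) \<noteq> 0"
    using insert.IH insert.prems by simp_all
  ultimately have "\<exists>x\<in>Xo. w r x * (\<Prod>r\<in>Q. w r x) \<noteq> 0"
    using Lau_domain[of "w r" "\<lambda>x. \<Prod>r\<in>Q. w r x"] by blast
  then show ?case using insert.hyps by simp
qed

lemma Lau_eqI:
  assumes f: "Lau f" and g: "Lau g" and q: "Lau q" "\<exists>x\<in>Xo. q x \<noteq> 0"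
    and eq: "\<And>x. x \<in> Xo \<Longrightarrow> q x \<noteq> 0 \<Longrightarrow> f x = g x" and x: "x \<in> Xo"
  shows "f x = g x"
proof -
  have "Lau (\<lambda>x. f x + (-1) * g x)"
    using f g by (intro Lau_add Lau_mult Lau_const)
  from Lau_domain[OF this q(1)] q(2) eq
  have "\<forall>x\<in>Xo. f x + (-1) * g x = 0" by force
  then show ?thesis using x by simp
qed

lemma common_denominator:
  assumes "finite F" "F \<subseteq> M"
  shows "\<exists>b\<in>S. \<forall>d\<in>F. b + d \<in> S"
  using assms
proof (induction F rule: finite_induct)
  case empty
  then show ?case using S_zero by auto
next
  case (insert d F)
  then obtain b where b: "b \<in> S" "\<forall>d\<in>F. b + d \<in> S" by auto
  obtain p q where p: "p \<in> S" "q \<in> S" "d = p - q" using insert.prems by (auto elim: M_E)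
  have "b + q + d = b + p" using p by simp
  moreover have "b + q + d' \<in> S" if "d' \<in> F" for d'
    using S_add[of "b + d'" q] b(2) p(2) that by (simp add: algebra_simps)
  ultimately show ?case
    using b p S_add by (intro bexI[of _ "b + q"]) auto
qed

text \<open>Translation by a common denominator \<open>b\<close> moves all characters into
  \<open>S\<close> and multiplies the relation by \<open>\<chi> b\<close>; there
  \<open>chi_independent\<close> applies.\<close>

lemma ch_independent:
  assumes F: "finite F" "F \<subseteq> M" and z: "\<And>x. x \<in> Xo \<Longrightarrow> (\<Sum>d\<in>F. c d * ch d x) = 0"
    and d: "d \<in> F"
  shows "c d = 0"
proof -
  obtain b where b: "b \<in> S" "\<And>d. d \<in> F \<Longrightarrow> b + d \<in> S" using common_denominator[OF F] by blast
  have "(\<Sum>m\<in>(+) b ` F. c (m - b) * \<chi> m x) = 0" if "x \<in> pts X" for x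
  proof (rule dense_Xo[OF _ _ that])
    show "regular X (\<lambda>x. \<Sum>m\<in>(+) b ` F. c (m - b) * \<chi> m x)"
      using b by (intro regular_sum regular_mult) (auto intro: chi_regular)
    fix x assume x: "x \<in> Xo"
    have "(\<Sum>m\<in>(+) b ` F. c (m - b) * \<chi> m x) = (\<Sum>d\<in>F. c d * \<chi> (b + d) x)"
      by (subst sum.reindex) auto
    also have "\<dots> = \<chi> b x * (\<Sum>d\<in>F. c d * ch d x)"
      unfolding sum_distrib_left
    proof (rule sum.cong)
      fix d assume "d \<in> F"
      then have "\<chi> (b + d) x = \<chi> b x * ch d x"
        using ch_add[of b d x] ch_S x b F S_M by (metis subsetD)
      then show "c d * \<chi> (b + d) x = \<chi> b x * (c d * ch d x)" by simp
    qed simp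
    finally show "(\<Sum>m\<in>(+) b ` F. c (m - b) * \<chi> m x) = 0" using z[OF x] by simp
  qed
  then have "c (b + d - b) = 0"
    using chi_independent[of "(+) b ` F" "\<lambda>m. c (m - b)" "b + d"] F b d by blast
  then show ?thesis by simp
qed

text \<open>The constant 1 is the character \<open>0\<close>, which is not in \<open>F\<close>. A
  vanishing sum would be a relation among distinct characters with coefficient 1 at
  \<open>0\<close>.\<close>

lemma one_plus_nonzero:
  assumes F: "finite F" "F \<subseteq> M" "0 \<notin> F"
  shows "\<exists>x\<in>Xo. 1 + (\<Sum>d\<in>F. c d * ch d x) \<noteq> 0"
proof (rule ccontr)
  assume "\<not> ?thesis"
  then have 0: "1 + (\<Sum>d\<in>F. c d * ch d x) = 0" if "x \<in> Xo" for x using that by blast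
  define c' where "c' d = (if d = 0 then 1 else c d)" for d
  have "(\<Sum>d\<in>insert 0 F. c' d * ch d x) = 0" if "x \<in> Xo" for x
  proof -
    have "(\<Sum>d\<in>F. c' d * ch d x) = (\<Sum>d\<in>F. c d * ch d x)"
      by (rule sum.cong) (use F in \<open>auto simp: c'_def\<close>)
    then show ?thesis
      using 0[OF that] F ch_S[OF S_zero that] by (simp add: c'_def chi_zero Xo_pts that)
  qed
  then have "c' 0 = 0"
    using ch_independent[of "insert 0 F" c' 0] F S_M[OF S_zero] by auto
  then show False by (simp add: c'_def)
qed

text \<open>Functions of weight \<open>-1\<close>: they are divided by \<open>1 + f x\<close> when a shear along \<open>\<rho>\<close> with
  parameter \<open>f\<close> is applied.\<close>

definition Wt :: "('m \<Rightarrow> int) \<Rightarrow> ('p \<Rightarrow> 'k) set" where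
  "Wt \<rho> = {f. \<exists>E c. finite E \<and> E \<subseteq> M \<and> (\<forall>e\<in>E. \<rho> e = -1) \<and>
     (\<forall>x\<in>Xo. f x = (\<Sum>e\<in>E. c e * ch e x))}"

lemma WtE:
  assumes "f \<in> Wt \<rho>"
  obtains E c where "finite E" "E \<subseteq> M" "\<And>e. e \<in> E \<Longrightarrow> \<rho> e = -1"
    "\<And>x. x \<in> Xo \<Longrightarrow> f x = (\<Sum>e\<in>E. c e * ch e x)"
  using assms unfolding Wt_def by blast

lemma Wt_I: "finite E \<Longrightarrow> E \<subseteq> M \<Longrightarrow> (\<And>e. e \<in> E \<Longrightarrow> \<rho> e = -1) \<Longrightarrow>
    (\<lambda>x. \<Sum>e\<in>E. c e * ch e x) \<in> Wt \<rho>"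
  unfolding Wt_def by blast

lemma Wt_zero: "(\<lambda>_. 0) \<in> Wt \<rho>"
  using Wt_I[of "{}" \<rho>] by simp

lemma Wt_ch: "e \<in> M \<Longrightarrow> \<rho> e = -1 \<Longrightarrow> (\<lambda>x. c * ch e x) \<in> Wt \<rho>"
  using Wt_I[of "{e}" \<rho> "\<lambda>_. c"] by simp

lemma Wt_add:
  assumes "f \<in> Wt \<rho>" "g \<in> Wt \<rho>"
  shows "(\<lambda>x. f x + g x) \<in> Wt \<rho>"
proof -
  obtain E c where E: "finite E" "E \<subseteq> M" "\<And>e. e \<in> E \<Longrightarrow> \<rho> e = -1"
    "\<And>x. x \<in> Xo \<Longrightarrow> f x = (\<Sum>e\<in>E. c e * ch e x)" using assms(1) by (rule WtE) blast
  obtain F c' where F: "finite F" "F \<subseteq> M" "\<And>e. e \<in> F \<Longrightarrow> \<rho> e = -1"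
    "\<And>x. x \<in> Xo \<Longrightarrow> g x = (\<Sum>e\<in>F. c' e * ch e x)" using assms(2) by (rule WtE) blast
  define h where "h e = (if e \<in> E then c e else 0) + (if e \<in> F then c' e else 0)" for e
  have "f x + g x = (\<Sum>e\<in>E \<union> F. h e * ch e x)" if "x \<in> Xo" for x
  proof -
    have "(\<Sum>e\<in>E \<union> F. h e * ch e x) = (\<Sum>e\<in>E \<union> F. (if e \<in> E then c e else 0) * ch e x) +
        (\<Sum>e\<in>E \<union> F. (if e \<in> F then c' e else 0) * ch e x)"
      by (simp add: h_def distrib_right sum.distrib)
    also have "(\<Sum>e\<in>E \<union> F. (if e \<in> E then c e else 0) * ch e x) = (\<Sum>e\<in>E. c e * ch e x)"
      by (rule sum.mono_neutral_cong_right) (use E F in auto)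
    also have "(\<Sum>e\<in>E \<union> F. (if e \<in> F then c' e else 0) * ch e x) = (\<Sum>e\<in>F. c' e * ch e x)"
      by (rule sum.mono_neutral_cong_right) (use E F in auto)
    finally show ?thesis using E(4) F(4) that by simp
  qed
  then show ?thesis
    unfolding Wt_def mem_Collect_eq using E(1-3) F(1-3)
    by (intro exI[of _ "E \<union> F"] exI[of _ h]) auto
qed

lemma Wt_sum: "(\<And>i. i \<in> I \<Longrightarrow> f i \<in> Wt \<rho>) \<Longrightarrow> (\<lambda>x. \<Sum>i\<in>I. f i x) \<in> Wt \<rho>"
  by (induction I rule: infinite_finite_induct) (auto intro: Wt_add Wt_zero)

lemma Wt_Lau: "f \<in> Wt \<rho> \<Longrightarrow> Lau f"
  by (elim WtE, subst Lau_cong) (auto intro!: Lau_sum Lau_mult Lau_ch)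

lemma Wt_one_plus: "additive \<rho> \<Longrightarrow> f \<in> Wt \<rho> \<Longrightarrow> \<exists>x\<in>Xo. 1 + f x \<noteq> 0"
proof (elim WtE)
  fix E c assume E: "finite E" "E \<subseteq> M" "\<And>e. e \<in> E \<Longrightarrow> \<rho> e = -1"
    "\<And>x. x \<in> Xo \<Longrightarrow> f x = (\<Sum>e\<in>E. c e * ch e x)" and \<rho>: "additive \<rho>"
  have "0 \<notin> E" using E(3)[of 0] additive_zero[OF \<rho>] by auto
  then show ?thesis using one_plus_nonzero[of E c] E by auto
qed

lemma Wt_scale:
  assumes "f \<in> Wt \<rho>" "x \<in> Xo" "y \<in> Xo" "\<And>d. d \<in> M \<Longrightarrow> \<rho> d = -1 \<Longrightarrow> ch d y = ch d x * w"
  shows "f y = f x * w"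
  using assms(1)
  by (elim WtE) (auto simp: assms(2-) sum_distrib_right subset_iff intro!: sum.cong)

section \<open>Shears and roots\<close>

definition rays :: "('m \<Rightarrow> int) set \<Rightarrow> bool" where
  "rays Q \<longleftrightarrow> finite Q \<and> (\<forall>r\<in>Q. additive r)"

text \<open>In Cox coordinates this is the substitution that multiplies the variable of
  \<open>r\<close> by \<open>z r\<close>. The formula is required on \<open>Xo\<close> only; density
  and the separation of points make it determine \<open>g\<close>, see
  \<open>form_eqI\<close>.\<close>

definition form :: "('m \<Rightarrow> int) set \<Rightarrow> (('m \<Rightarrow> int) \<Rightarrow> 'p \<Rightarrow> 'k) \<Rightarrow> ('p \<Rightarrow> 'p) \<Rightarrow> bool" where
  "form Q z g \<longleftrightarrow> g \<in> carrier (Aut X) \<and>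
     (\<forall>x\<in>Xo. \<forall>m\<in>S. \<chi> m (g x) = \<chi> m x * (\<Prod>r\<in>Q. z r x ^ nat (r m)))"

definition shear :: "('m \<Rightarrow> int) \<Rightarrow> ('p \<Rightarrow> 'k) \<Rightarrow> ('p \<Rightarrow> 'p) \<Rightarrow> bool" where
  "shear \<rho> f g \<longleftrightarrow> g \<in> carrier (Aut X) \<and>
     (\<forall>x\<in>Xo. \<forall>m\<in>S. \<chi> m (g x) = \<chi> m x * (1 + f x) ^ nat (\<rho> m))"

lemma form_Aut: "form Q z g \<Longrightarrow> g \<in> carrier (Aut X)"
  by (simp add: form_def)

lemma shear_Aut: "shear \<rho> f g \<Longrightarrow> g \<in> carrier (Aut X)"
  by (simp add: shear_def)

lemma form_step:
  assumes Q: "rays Q" and g: "form Q z g" and x: "x \<in> Xo" and nz: "\<And>r. r \<in> Q \<Longrightarrow> z r x \<noteq> 0"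
  shows "g x \<in> Xo" and "d \<in> M \<Longrightarrow> ch d (g x) = ch d x * (\<Prod>r\<in>Q. z r x powi r d)"
proof -
  have *: "g x \<in> pts X" using Aut_in[OF form_Aut[OF g]] x by (simp add: Xo_pts)
  have "finite Q" "\<And>r. r \<in> Q \<Longrightarrow> additive r" using Q by (auto simp: rays_def)
  note t = torus_step[OF this nz x *]
  show "g x \<in> Xo" by (rule t(1)) (use g x in \<open>auto simp: form_def\<close>)
  show "ch d (g x) = ch d x * (\<Prod>r\<in>Q. z r x powi r d)" if "d \<in> M"
    by (rule t(2)) (use g x that in \<open>auto simp: form_def\<close>)
qed

text \<open>Composition multiplies the factor \<open>w r\<close> of \<open>h\<close> by
  \<open>z r (h x)\<close>, which is a priori only rational in \<open>x\<close>. A Laurent function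
  \<open>v r\<close> that agrees with the product where no \<open>w r\<close> vanishes is therefore
  given in advance, and \<open>Lau_eqI\<close> removes the restriction.\<close>

lemma form_comp:
  assumes Q: "rays Q" and g: "form Q z g" and h: "form Q w h"
    and w: "\<And>r. r \<in> Q \<Longrightarrow> Lau (w r)" "\<And>r. r \<in> Q \<Longrightarrow> \<exists>x\<in>Xo. w r x \<noteq> 0"
    and v: "\<And>r. r \<in> Q \<Longrightarrow> Lau (v r)"
    and eq: "\<And>x r. x \<in> Xo \<Longrightarrow> h x \<in> Xo \<Longrightarrow> (\<And>r. r \<in> Q \<Longrightarrow> w r x \<noteq> 0) \<Longrightarrow>
      (\<And>d. d \<in> M \<Longrightarrow> ch d (h x) = ch d x * (\<Prod>r\<in>Q. w r x powi r d)) \<Longrightarrow> r \<in> Q \<Longrightarrow>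
      v r x = w r x * z r (h x)"
  shows "form Q v (g \<cdot> h)"
proof -
  have A: "g \<in> carrier (Aut X)" "h \<in> carrier (Aut X)" using g h by (auto simp: form_def)
  interpret Aut: group "Aut X" by (rule group_Aut)
  have fin: "finite Q" using Q by (simp add: rays_def)
  have "\<chi> m (g (h x)) = \<chi> m x * (\<Prod>r\<in>Q. v r x ^ nat (r m))" if m: "m \<in> S" and x: "x \<in> Xo" for m x
  proof (rule Lau_eqI[OF _ _ _ _ _ x])
    have "regular X (\<lambda>x. \<chi> m (g (h x)))"
      using Aut_regular[OF A(2) Aut_regular[OF A(1) chi_regular[OF m]]] by simp
    then show "Lau (\<lambda>x. \<chi> m (g (h x)))" by (rule Lau_regular)
    show "Lau (\<lambda>x. \<chi> m x * (\<Prod>r\<in>Q. v r x ^ nat (r m)))"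
      by (intro Lau_mult Lau_prod Lau_power v Lau_regular chi_regular m)
    show "Lau (\<lambda>x. \<Prod>r\<in>Q. w r x)" by (intro Lau_prod w)
    show "\<exists>x\<in>Xo. (\<Prod>r\<in>Q. w r x) \<noteq> 0" by (rule Lau_prod_nonzero[OF fin w])
    fix x assume x: "x \<in> Xo" and "(\<Prod>r\<in>Q. w r x) \<noteq> 0"
    then have nz: "\<And>r. r \<in> Q \<Longrightarrow> w r x \<noteq> 0" using fin by simp
    note s = form_step[OF Q h x nz]
    have "(\<Prod>r\<in>Q. v r x ^ nat (r m)) = (\<Prod>r\<in>Q. w r x ^ nat (r m) * z r (h x) ^ nat (r m))"
      by (rule prod.cong) (use eq[OF x s(1) nz s(2)] in \<open>auto simp: power_mult_distrib\<close>)
    then show "\<chi> m (g (h x)) = \<chi> m x * (\<Prod>r\<in>Q. v r x ^ nat (r m))"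
      using g h s(1) x m by (simp add: form_def prod.distrib mult.assoc)
  qed
  then show ?thesis
    using A by (simp add: form_def Aut_mult_apply Xo_pts)
qed

lemma form_eqI:
  assumes "form Q z g" "form Q z' g'" "\<And>r x. r \<in> Q \<Longrightarrow> x \<in> Xo \<Longrightarrow> z r x = z' r x"
  shows "g = g'"
proof (rule Aut_eqI)
  show A: "g \<in> carrier (Aut X)" "g' \<in> carrier (Aut X)" using assms by (auto simp: form_def)
  fix x assume x: "x \<in> pts X"
  show "g x = g' x"
  proof (rule chi_separates)
    show "g x \<in> pts X" "g' x \<in> pts X" using A x by (auto intro: Aut_in)
    fix m assume m: "m \<in> S"
    have "\<chi> m (g x) - \<chi> m (g' x) = 0"
    proof (rule dense_Xo[OF _ _ x])
      show "regular X (\<lambda>x. \<chi> m (g x) - \<chi> m (g' x))"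
        using Aut_regular[OF A(1) chi_regular[OF m]] Aut_regular[OF A(2) chi_regular[OF m]]
        by (rule regular_diff)
      fix x assume x: "x \<in> Xo"
      have "(\<Prod>r\<in>Q. z r x ^ nat (r m)) = (\<Prod>r\<in>Q. z' r x ^ nat (r m))"
        by (rule prod.cong) (use assms(3) x in auto)
      then show "\<chi> m (g x) - \<chi> m (g' x) = 0"
        using assms(1,2) x m by (simp add: form_def)
    qed
    then show "\<chi> m (g x) = \<chi> m (g' x)" by simp
  qed
qed

lemma form_one: "form Q (\<lambda>_ _. 1) \<one>\<^bsub>Aut X\<^esub>"
  by (simp add: form_def Aut_one_apply Xo_pts group.is_monoid[OF group_Aut] monoid.one_closed)

lemma shear_form:
  assumes "finite Q" "\<rho> \<in> Q"
  shows "shear \<rho> f g \<longleftrightarrow> form Q (\<lambda>r x. if r = \<rho> then 1 + f x else 1) g"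
proof -
  have "(\<Prod>r\<in>Q. (if r = \<rho> then 1 + f x else 1) ^ nat (r m)) = (1 + f x) ^ nat (\<rho> m)" for x m
  proof -
    have "(\<Prod>r\<in>Q. (if r = \<rho> then 1 + f x else 1) ^ nat (r m)) =
        (\<Prod>r\<in>Q. if r = \<rho> then (1 + f x) ^ nat (r m) else 1)"
      by (rule prod.cong) auto
    then show ?thesis using assms by simp
  qed
  then show ?thesis by (simp add: shear_def form_def)
qed

lemma shear_eqI:
  assumes "shear \<rho> f g" "shear \<rho> f' g'" "\<And>x. x \<in> Xo \<Longrightarrow> f x = f' x"
  shows "g = g'"
proof -
  have "form {\<rho>} (\<lambda>r x. if r = \<rho> then 1 + f x else 1) g"
    "form {\<rho>} (\<lambda>r x. if r = \<rho> then 1 + f' x else 1) g'"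
    using assms(1,2) by (simp_all add: shear_form[symmetric])
  then show ?thesis by (rule form_eqI) (use assms(3) in auto)
qed

lemma shear_step:
  assumes \<rho>: "additive \<rho>" and g: "shear \<rho> f g" and x: "x \<in> Xo" and nz: "1 + f x \<noteq> 0"
  shows "g x \<in> Xo" and "d \<in> M \<Longrightarrow> ch d (g x) = ch d x * (1 + f x) powi \<rho> d"
proof -
  have "form {\<rho>} (\<lambda>r x. if r = \<rho> then 1 + f x else 1) g" "rays {\<rho>}"
    using g \<rho> by (simp_all add: shear_form[symmetric] rays_def)
  note f = form_step[OF this(2,1) x]
  show "g x \<in> Xo" by (rule f(1)) (use nz in auto)
  show "ch d (g x) = ch d x * (1 + f x) powi \<rho> d" if "d \<in> M"
    using f(2)[OF _ that] nz by simp
qed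

lemma shear_zero: "shear \<rho> (\<lambda>_. 0) \<one>\<^bsub>Aut X\<^esub>"
  using form_one[of "{\<rho>}"] by (simp add: shear_def form_def)

text \<open>A function of weight -1 satisfies \<open>f (g' x) = f x / (1 + f' x)\<close>, whence
  \<open>(1 + f') (1 + f / (1 + f')) = 1 + f + f'\<close>.\<close>

lemma shear_add:
  assumes \<rho>: "additive \<rho>" and f: "f \<in> Wt \<rho>" and f': "f' \<in> Wt \<rho>"
    and g: "shear \<rho> f g" and g': "shear \<rho> f' g'"
  shows "shear \<rho> (\<lambda>x. f x + f' x) (g \<cdot> g')"
proof -
  have Q: "rays {\<rho>}" using \<rho> by (simp add: rays_def)
  have F: "form {\<rho>} (\<lambda>r x. if r = \<rho> then 1 + f x else 1) g"
    "form {\<rho>} (\<lambda>r x. if r = \<rho> then 1 + f' x else 1) g'"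
    using g g' by (simp_all add: shear_form[symmetric])
  have "form {\<rho>} (\<lambda>r x. if r = \<rho> then 1 + (f x + f' x) else 1) (g \<cdot> g')"
  proof (rule form_comp[OF Q F])
    fix r assume r: "r \<in> {\<rho>}"
    show "Lau (\<lambda>x. if r = \<rho> then 1 + f' x else 1)"
      using f' r by (simp add: Lau_add Wt_Lau)
    show "Lau (\<lambda>x. if r = \<rho> then 1 + (f x + f' x) else 1)"
      using f f' r by (simp add: Lau_add Wt_Lau)
    show "\<exists>x\<in>Xo. (if r = \<rho> then 1 + f' x else 1) \<noteq> 0"
      using Wt_one_plus[OF \<rho> f'] r by simp
  next
    fix x r assume x: "x \<in> Xo" "g' x \<in> Xo" and r: "r \<in> {\<rho>}"
      and nz: "\<And>r. r \<in> {\<rho>} \<Longrightarrow> (if r = \<rho> then 1 + f' x else 1) \<noteq> 0"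
      and c: "\<And>d. d \<in> M \<Longrightarrow>
        ch d (g' x) = ch d x * (\<Prod>r\<in>{\<rho>}. (if r = \<rho> then 1 + f' x else 1) powi r d)"
    have "f (g' x) = f x * inverse (1 + f' x)"
      by (rule Wt_scale[OF f x]) (simp add: c power_int_minus)
    then show "(if r = \<rho> then 1 + (f x + f' x) else 1) =
        (if r = \<rho> then 1 + f' x else 1) * (if r = \<rho> then 1 + f (g' x) else 1)"
      using r nz[of \<rho>] by (simp add: field_simps)
  qed
  then show ?thesis by (simp add: shear_form[symmetric])
qed

text \<open>A Demazure root, described without a cone. The last condition says that the derivation
  sending \<open>\<chi> m\<close> to \<open>\<rho> m\<close> times \<open>\<chi> (m + e)\<close>
  maps the algebra to itself.\<close>

definition root :: "('m \<Rightarrow> int) \<Rightarrow> 'm \<Rightarrow> bool" where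
  "root \<rho> e \<longleftrightarrow> additive \<rho> \<and> e \<in> M \<and> \<rho> e = -1 \<and> (\<forall>m\<in>S. 0 < \<rho> m \<longrightarrow> m + e \<in> S)"

lemma rootD:
  assumes "root \<rho> e"
  shows "additive \<rho>" "e \<in> M" "\<rho> e = -1" "m \<in> S \<Longrightarrow> 0 < \<rho> m \<Longrightarrow> m + e \<in> S"
  using assms by (auto simp: root_def)

text \<open>Adding \<open>e\<close> is allowed as long as \<rho> is positive and lowers \<rho> by
  one, so \<open>\<rho> m\<close> steps are made; each of them changes \<sigma> by
  \<open>\<sigma> e\<close>.\<close>

lemma root_descend:
  assumes r: "root \<rho> e" and m: "m \<in> S" and \<sigma>: "additive \<sigma>"
  shows "\<exists>m'\<in>S. \<rho> m' = 0 \<and> \<sigma> m' = \<sigma> m + \<rho> m * \<sigma> e"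
  using m
proof (induction "nat (\<rho> m)" arbitrary: m)
  case 0
  then show ?case using additive_nonneg[OF rootD(1)[OF r] 0(2)]
    by (intro bexI[of _ m]) auto
next
  case (Suc k)
  then have p: "0 < \<rho> m" by simp
  have me: "m + e \<in> S" using rootD(4)[OF r Suc(3) p] .
  have 1: "\<rho> (m + e) = \<rho> m - 1" "\<sigma> (m + e) = \<sigma> m + \<sigma> e"
    using additive_add[OF rootD(1)[OF r], of m e] additive_add[OF \<sigma>, of m e] S_M[OF Suc(3)] rootD[OF r]
    by auto
  have "k = nat (\<rho> (m + e))" using 1 Suc(2) by simp
  from Suc(1)[OF this me] obtain m' where "m' \<in> S" "\<rho> m' = 0" "\<sigma> m' = \<sigma> (m + e) + \<rho> (m + e) * \<sigma> e"
    by blast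
  moreover from this(3) have "\<sigma> m' = \<sigma> m + \<rho> m * \<sigma> e"
    unfolding 1 by (simp add: left_diff_distrib)
  ultimately show ?case by blast
qed

text \<open>Moving along \<open>e2\<close> leads to a point of \<open>S\<close> with \<open>\<rho>2 = 0\<close>. If \<open>\<rho>1 > 0\<close> there, then moving
  along \<open>e1\<close> gives \<open>\<rho>2 e1 \<ge> 0\<close>; if \<open>\<rho>1\<close> vanishes at all these points, then \<open>\<rho>1 = \<rho>2\<close>.\<close>

lemma root_nonneg:
  assumes r1: "root \<rho>1 e1" and r2: "root \<rho>2 e2" and ne: "\<rho>1 \<noteq> \<rho>2"
  shows "0 \<le> \<rho>2 e1"
proof (rule ccontr)
  assume neg: "\<not> 0 \<le> \<rho>2 e1"
  note a1 = rootD(1)[OF r1] and a2 = rootD(1)[OF r2]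
  define c where "c = - \<rho>1 e2"
  have *: "\<rho>1 m = c * \<rho>2 m" if m: "m \<in> S" for m
  proof -
    obtain m' where m': "m' \<in> S" "\<rho>2 m' = 0" "\<rho>1 m' = \<rho>1 m + \<rho>2 m * \<rho>1 e2"
      using root_descend[OF r2 m a1] by blast
    have "\<rho>1 m' = 0"
    proof (rule ccontr)
      assume "\<rho>1 m' \<noteq> 0"
      then have "0 < \<rho>1 m'" using additive_nonneg[OF a1 m'(1)] by simp
      then have "m' + e1 \<in> S" using rootD(4)[OF r1 m'(1)] by simp
      then have "0 \<le> \<rho>2 (m' + e1)" by (rule additive_nonneg[OF a2])
      then show False
        using additive_add[OF a2 S_M[OF m'(1)] rootD(2)[OF r1]] m'(2) neg by simp
    qed
    then show ?thesis using m'(3) by (simp add: c_def algebra_simps)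
  qed
  obtain p q where pq: "p \<in> S" "q \<in> S" "e1 = p - q" using rootD(2)[OF r1] by (rule M_E)
  have "\<rho>1 e1 = \<rho>1 p - \<rho>1 q" "\<rho>2 e1 = \<rho>2 p - \<rho>2 q"
    using pq additive_diff[OF a1] additive_diff[OF a2] by auto
  then have "\<rho>1 e1 = c * \<rho>2 e1"
    using *[OF pq(1)] *[OF pq(2)] by (simp add: right_diff_distrib)
  then have "(- \<rho>2 e1) * c = 1" using rootD(3)[OF r1] by (simp add: mult.commute)
  then have "c = 1" using neg pos_zmult_eq_1_iff[of "- \<rho>2 e1" c] by simp
  then have "\<rho>1 = \<rho>2" using * by (intro additive_eqI[OF a1 a2]) simp
  then show False using ne by simp
qed

end

section \<open>Strings of roots and free subgroups\<close>

inductive_set geometric_span :: "(nat \<Rightarrow> 'k::field) set" where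
  geometric: "(\<lambda>k. t * s ^ k) \<in> geometric_span"
| add: "c \<in> geometric_span \<Longrightarrow> c' \<in> geometric_span \<Longrightarrow> (\<lambda>k. c k + c' k) \<in> geometric_span"

lemma geometric_span_scale: "c \<in> geometric_span \<Longrightarrow> (\<lambda>k. r * c k) \<in> geometric_span"
proof (induction rule: geometric_span.induct)
  case (geometric t s)
  show ?case using geometric_span.geometric[of "r * t" s] by (simp add: mult.assoc)
next
  case (add c c')
  then show ?case using geometric_span.add by (fastforce simp: distrib_left)
qed

lemma geometric_span_dilate: "c \<in> geometric_span \<Longrightarrow> (\<lambda>k. r ^ k * c k) \<in> geometric_span"
proof (induction rule: geometric_span.induct)
  case (geometric t s)
  show ?case using geometric_span.geometric[of t "r * s"] by (simp add: power_mult_distrib mult_ac)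
next
  case (add c c')
  then show ?case using geometric_span.add by (fastforce simp: distrib_left)
qed

lemma two_power_inj: "(2::'k::field_char_0) ^ k = 2 ^ j \<longleftrightarrow> k = j"
proof -
  have "(2::'k) ^ k = 2 ^ j \<longleftrightarrow> (of_nat (2 ^ k) :: 'k) = of_nat (2 ^ j)" by simp
  also have "\<dots> \<longleftrightarrow> k = j" unfolding of_nat_eq_iff by simp
  finally show ?thesis .
qed

text \<open>Passing from \<open>c k\<close> to \<open>(2 ^ k - 2 ^ j) * c k\<close> adds the zero
  \<open>j\<close> and no other, since the powers of 2 are distinct in characteristic zero. The new
  sequence is a dilate plus a multiple of the old one, so it stays in the span.\<close>

lemma geometric_span_vanishing:
  assumes "finite J"
  shows "\<exists>c\<in>geometric_span. \<forall>k. c k = (0::'k::field_char_0) \<longleftrightarrow> k \<in> J"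
  using assms
proof (induction J rule: finite_induct)
  case empty
  show ?case using geometric_span.geometric[of 1 1] by (intro bexI[of _ "\<lambda>k. 1 * 1 ^ k"]) auto
next
  case (insert j J)
  then obtain c :: "nat \<Rightarrow> 'k" where c: "c \<in> geometric_span" "\<And>k. c k = 0 \<longleftrightarrow> k \<in> J" by blast
  have "(\<lambda>k. 2 ^ k * c k + - (2 ^ j) * c k) \<in> geometric_span"
    by (intro geometric_span.add geometric_span_scale geometric_span_dilate c)
  moreover have "2 ^ k * c k + - (2 ^ j) * c k = 0 \<longleftrightarrow> k \<in> insert j J" for k
  proof -
    have "2 ^ k * c k + - (2 ^ j) * c k = (2 ^ k - 2 ^ j) * c k" by (simp add: algebra_simps)
    then show ?thesis using c(2) by (auto simp: two_power_inj)
  qed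
  ultimately show ?case by (intro bexI[of _ "\<lambda>k. 2 ^ k * c k + - (2 ^ j) * c k"]) auto
qed

lemma geometric_span_unit:
  "\<exists>c\<in>geometric_span. c i = (1::'k::field_char_0) \<and> (\<forall>k\<le>a. k \<noteq> i \<longrightarrow> c k = 0)"
proof -
  obtain c :: "nat \<Rightarrow> 'k" where c: "c \<in> geometric_span" "\<And>k. c k = 0 \<longleftrightarrow> k \<in> {..a} - {i}"
    using geometric_span_vanishing[of "{..a} - {i}"] by blast
  show ?thesis
    by (rule bexI[OF _ geometric_span_scale[OF c(1), of "inverse (c i)"]]) (use c(2) in auto)
qed

primrec plus_mult :: "'a::ab_group_add \<Rightarrow> 'a \<Rightarrow> nat \<Rightarrow> 'a" where
  "plus_mult d e 0 = d"
| "plus_mult d e (Suc k) = plus_mult d e k + e"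

text \<open>Here \<open>a\<close> and \<open>b\<close> are the inverses of the values of \<open>ch e1\<close> and \<open>ch e2\<close>, so that a shear acts
  on \<open>a\<close> by a translation.\<close>

lemma pingpong_step:
  fixes a b s :: rat
  assumes s: "s = 1 \<or> s = -1" and ab: "\<bar>a * b\<bar> \<le> 1" and a: "- 1 \<le> s * a" and q: "0 < q"
  shows "1 < s * (a + 3 * s)" "\<bar>(a + 3 * s) * (b * (a / (a + 3 * s)) ^ q)\<bar> \<le> 1"
proof -
  show 1: "1 < s * (a + 3 * s)" using s a by auto
  have le: "\<bar>a\<bar> \<le> \<bar>a + 3 * s\<bar>" "a + 3 * s \<noteq> 0" using s a by auto
  then have r: "\<bar>a / (a + 3 * s)\<bar> \<le> 1" by (simp add: abs_divide)
  obtain q' where q': "q = Suc q'" using q gr0_implies_Suc by blast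
  have "(a + 3 * s) * (b * (a / (a + 3 * s)) ^ q) = (a * b) * (a / (a + 3 * s)) ^ q'"
    using le(2) by (simp add: q')
  then have "\<bar>(a + 3 * s) * (b * (a / (a + 3 * s)) ^ q)\<bar> = \<bar>a * b\<bar> * \<bar>a / (a + 3 * s)\<bar> ^ q'"
    by (simp only: abs_mult power_abs)
  also have "\<dots> \<le> 1 * 1"
    by (rule mult_mono) (use ab r in \<open>auto intro: power_le_one\<close>)
  finally show "\<bar>(a + 3 * s) * (b * (a / (a + 3 * s)) ^ q)\<bar> \<le> 1" by simp
qed

context toric_data begin

lemma plus_mult_M: "d \<in> M \<Longrightarrow> e \<in> M \<Longrightarrow> plus_mult d e k \<in> M"
  by (induction k) (auto intro: M_add)

lemma ch_plus_mult:
  "d \<in> M \<Longrightarrow> e \<in> M \<Longrightarrow> x \<in> Xo \<Longrightarrow> ch (plus_mult d e k) x = ch d x * ch e x ^ k"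
  by (induction k) (auto simp: ch_add plus_mult_M)

lemma additive_plus_mult:
  "additive \<rho> \<Longrightarrow> d \<in> M \<Longrightarrow> e \<in> M \<Longrightarrow> \<rho> (plus_mult d e k) = \<rho> d + int k * \<rho> e"
  by (induction k) (auto simp: additive_add plus_mult_M algebra_simps)

text \<open>Each step along \<open>e1\<close> lowers \<rho>1 by one. The starting value is
  \<open>\<rho>1 m + \<rho>1 e2\<close>, so \<rho>1 is positive before each of the first
  \<open>\<rho>1 e2\<close> steps, and the root property of \<open>e1\<close> permits the
  step.\<close>

lemma root_plus_mult:
  assumes r1: "root \<rho>1 e1" and r2: "root \<rho>2 e2" and z: "\<rho>2 e1 = 0" and k: "int k \<le> \<rho>1 e2"
  shows "root \<rho>2 (plus_mult e2 e1 k)"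
  unfolding root_def
proof (intro conjI ballI impI)
  note D1 = rootD[OF r1] and D2 = rootD[OF r2]
  show "additive \<rho>2" by (rule D2)
  show "plus_mult e2 e1 k \<in> M" using D1 D2 by (intro plus_mult_M)
  show "\<rho>2 (plus_mult e2 e1 k) = -1" using D1 D2 z by (simp add: additive_plus_mult)
  fix m assume m: "m \<in> S" "0 < \<rho>2 m"
  show "m + plus_mult e2 e1 k \<in> S" using k
  proof (induction k)
    case 0
    then show ?case using D2(4) m by simp
  next
    case (Suc k)
    then have *: "m + plus_mult e2 e1 k \<in> S" by simp
    have "\<rho>1 (m + plus_mult e2 e1 k) = \<rho>1 m + (\<rho>1 e2 + int k * \<rho>1 e1)"
      using D1 D2 m by (simp add: additive_add additive_plus_mult plus_mult_M S_M)
    then have "0 < \<rho>1 (m + plus_mult e2 e1 k)"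
      using additive_nonneg[OF D1(1) m(1)] D1(3) Suc.prems by simp
    then show ?case using D1(4)[OF *] by (simp add: add.assoc)
  qed
qed

text \<open>Here \<open>u'\<close> is the inverse of \<open>u\<close>. It multiplies
  \<open>ch e2\<close> by a power of \<open>1 - s ch e1\<close>, and the binomial theorem lists the
  string through \<open>e2\<close> in direction \<open>e1\<close>. Since
  \<open>\<rho>2 e1 = 0\<close>, the shear \<open>v\<close> leaves \<open>ch e1\<close> unchanged,
  and the factors of \<open>u\<close> and \<open>u'\<close> along \<rho>1 cancel.\<close>

lemma shear_conj:
  assumes r1: "root \<rho>1 e1" and r2: "root \<rho>2 e2" and z: "\<rho>2 e1 = 0"
    and u: "shear \<rho>1 (\<lambda>x. s * ch e1 x) u" and v: "shear \<rho>2 (\<lambda>x. t * ch e2 x) v"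
    and u': "shear \<rho>1 (\<lambda>x. (- s) * ch e1 x) u'"
  shows "shear \<rho>2 (\<lambda>x. \<Sum>k\<le>nat (\<rho>1 e2). t * (- s) ^ k * of_nat (nat (\<rho>1 e2) choose k) *
           ch (plus_mult e2 e1 k) x) (u \<cdot> (v \<cdot> u'))"
proof -
  note D1 = rootD[OF r1] and D2 = rootD[OF r2]
  have ne: "\<rho>1 \<noteq> \<rho>2" using z D1(3) by auto
  define a where "a = nat (\<rho>1 e2)"
  have a: "\<rho>1 e2 = int a" using root_nonneg[OF r2 r1] ne by (simp add: a_def)
  define Q where "Q = {\<rho>1, \<rho>2}"
  have Q: "rays Q" "finite Q" "\<rho>1 \<in> Q" "\<rho>2 \<in> Q" using D1 D2 by (auto simp: Q_def rays_def)
  define f where "f x = (\<Sum>k\<le>a. t * (- s) ^ k * of_nat (a choose k) * ch (plus_mult e2 e1 k) x)" for x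
  have f: "f x = t * ch e2 x * (1 + (- s) * ch e1 x) ^ a" if "x \<in> Xo" for x
  proof -
    have "(1 + (- s) * ch e1 x) ^ a = (\<Sum>k\<le>a. of_nat (a choose k) * ((- s) * ch e1 x) ^ k)"
      using binomial_ring[of "(- s) * ch e1 x" 1 a] by (simp add: add.commute)
    then have "t * ch e2 x * (1 + (- s) * ch e1 x) ^ a =
        (\<Sum>k\<le>a. t * ch e2 x * (of_nat (a choose k) * ((- s) ^ k * ch e1 x ^ k)))"
      by (simp only: power_mult_distrib sum_distrib_left)
    also have "\<dots> = f x"
      unfolding f_def by (rule sum.cong) (simp_all add: ch_plus_mult D1 D2 that)
    finally show ?thesis by simp
  qed
  have fW: "f \<in> Wt \<rho>2"
    unfolding f_def
    by (rule Wt_sum, rule Wt_ch) (use D1 D2 z in \<open>auto simp: plus_mult_M additive_plus_mult\<close>)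
  let ?w = "\<lambda>r x. if r = \<rho>1 then 1 + (- s) * ch e1 x else 1"
  let ?w2 = "\<lambda>r x. if r = \<rho>1 then 1 + (- s) * ch e1 x else 1 + f x"
  let ?v = "\<lambda>r x. if r = \<rho>2 then 1 + t * ch e2 x else 1"
  let ?z = "\<lambda>r x. if r = \<rho>1 then 1 + s * ch e1 x else 1"
  have U: "form Q ?z u" "form Q ?v v" "form Q ?w u'"
    using u v u' Q by (simp_all add: shear_form[symmetric])
  have Lau_w: "Lau (\<lambda>x. 1 + (- s) * ch e1 x)"
    by (intro Lau_add Lau_mult Lau_const Lau_ch D1)
  have nz_w: "\<exists>x\<in>Xo. 1 + (- s) * ch e1 x \<noteq> 0"
    using Wt_one_plus[OF D1(1) Wt_ch[where \<rho> = \<rho>1 and c = "- s", OF D1(2,3)]] .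
  have Lau_f: "Lau (\<lambda>x. 1 + f x)" by (intro Lau_add Lau_const Wt_Lau[OF fW])
  have nz_f: "\<exists>x\<in>Xo. 1 + f x \<noteq> 0" using Wt_one_plus[OF D2(1) fW] .
  \<comment> \<open>The factor of \<open>u'\<close> along \<rho>1 is still present here; it
    disappears in the composition with \<open>u\<close>.\<close>
  have V: "form Q ?w2 (v \<cdot> u')"
  proof (rule form_comp[OF Q(1) U(2,3)])
    fix r assume "r \<in> Q"
    show "Lau (?w r)" using Lau_w by (cases "r = \<rho>1") auto
    show "\<exists>x\<in>Xo. ?w r x \<noteq> 0" using nz_w base_Xo by auto
    show "Lau (?w2 r)" using Lau_w Lau_f by (cases "r = \<rho>1") auto
  next
    fix x r assume x: "x \<in> Xo" "u' x \<in> Xo" and r: "r \<in> Q"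
      and c: "\<And>d. d \<in> M \<Longrightarrow> ch d (u' x) = ch d x * (\<Prod>r\<in>Q. ?w r x powi r d)"
    have "ch e2 (u' x) = ch e2 x * (1 + (- s) * ch e1 x) ^ a"
      using c[OF D2(2)] ne a by (simp add: Q_def)
    then show "?w2 r x = ?w r x * ?v r (u' x)"
      using r ne f[OF x(1)] by (auto simp: Q_def)
  qed
  have "form Q (\<lambda>r x. if r = \<rho>2 then 1 + f x else 1) (u \<cdot> (v \<cdot> u'))"
  proof (rule form_comp[OF Q(1) U(1) V])
    fix r assume "r \<in> Q"
    show "Lau (?w2 r)" using Lau_w Lau_f by (cases "r = \<rho>1") auto
    show "\<exists>x\<in>Xo. ?w2 r x \<noteq> 0" using nz_w nz_f by auto
    show "Lau (\<lambda>x. if r = \<rho>2 then 1 + f x else 1)" using Lau_f by (cases "r = \<rho>2") auto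
  next
    fix x r assume x: "x \<in> Xo" and r: "r \<in> Q"
      and nz: "\<And>r. r \<in> Q \<Longrightarrow> ?w2 r x \<noteq> 0"
      and c: "\<And>d. d \<in> M \<Longrightarrow> ch d ((v \<cdot> u') x) = ch d x * (\<Prod>r\<in>Q. ?w2 r x powi r d)"
    have "ch e1 ((v \<cdot> u') x) = ch e1 x * inverse (1 + (- s) * ch e1 x)"
      using c[OF D1(2)] ne D1(3) z by (simp add: Q_def power_int_minus)
    then show "(if r = \<rho>2 then 1 + f x else 1) = ?w2 r x * ?z r ((v \<cdot> u') x)"
    proof (cases "r = \<rho>1")
      case True
      \<comment> \<open>With \<open>y\<close> for \<open>ch e1 x\<close> this is
        \<open>(1 - s y) (1 + s y / (1 - s y)) = 1\<close>.\<close>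
      have "(1 + (- s) * ch e1 x) * (1 + s * (ch e1 x * inverse (1 + (- s) * ch e1 x))) =
          (1 + (- s) * ch e1 x) + s * ch e1 x * ((1 + (- s) * ch e1 x) * inverse (1 + (- s) * ch e1 x))"
        by (simp only: distrib_left mult_1_right mult_1_left mult_ac)
      also have "\<dots> = 1" using nz[OF Q(3)] by simp
      finally show ?thesis
        using True ne \<open>ch e1 ((v \<cdot> u') x) = _\<close> by simp
    qed (use r in \<open>auto simp: Q_def\<close>)
  qed
  then have "shear \<rho>2 f (u \<cdot> (v \<cdot> u'))"
    using Q by (simp add: shear_form[symmetric])
  moreover have "f = (\<lambda>x. \<Sum>k\<le>nat (\<rho>1 e2). t * (- s) ^ k * of_nat (nat (\<rho>1 e2) choose k) *
           ch (plus_mult e2 e1 k) x)"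
    unfolding f_def a_def ..
  ultimately show ?thesis by (rule subst[rotated])
qed

definition has_root :: "('p \<Rightarrow> 'p) set \<Rightarrow> ('m \<Rightarrow> int) \<Rightarrow> 'm \<Rightarrow> bool" where
  "has_root G \<rho> e \<longleftrightarrow> root \<rho> e \<and> (\<forall>c. \<exists>g\<in>G. shear \<rho> (\<lambda>x. c * ch e x) g)"

text \<open>Conjugation gives products of shears along the whole string at once, with parameters
  \<open>t s ^ k\<close> up to constants. Since the sequences \<open>t s ^ k\<close> span all sequences on the string, the
  factors can be separated.\<close>

lemma has_root_string:
  assumes G: "subgroup G (Aut X)"
    and h1: "has_root G \<rho>1 e1" and h2: "has_root G \<rho>2 e2" and z: "\<rho>2 e1 = 0"
    and i: "int i \<le> \<rho>1 e2"
  shows "has_root G \<rho>2 (plus_mult e2 e1 i)"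
proof -
  have r: "root \<rho>1 e1" "root \<rho>2 e2" using h1 h2 by (auto simp: has_root_def)
  note D1 = rootD[OF r(1)] and D2 = rootD[OF r(2)]
  define a where "a = nat (\<rho>1 e2)"
  define b where "b k = (- 1) ^ k * (of_nat (a choose k) :: 'k)" for k
  define f where "f c = (\<lambda>x. \<Sum>k\<le>a. c k * b k * ch (plus_mult e2 e1 k) x)" for c :: "nat \<Rightarrow> 'k"
  have fW: "f c \<in> Wt \<rho>2" for c
    unfolding f_def
    by (rule Wt_sum, rule Wt_ch) (use D1 D2 z in \<open>auto simp: plus_mult_M additive_plus_mult\<close>)
  have *: "\<exists>g\<in>G. shear \<rho>2 (f c) g" if "c \<in> geometric_span" for c
    using that
  proof induction
    case (geometric t s)
    have "\<exists>g\<in>G. shear \<rho>1 (\<lambda>x. r * ch e1 x) g" "\<exists>g\<in>G. shear \<rho>2 (\<lambda>x. r * ch e2 x) g" for r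
      using h1 h2 by (auto simp: has_root_def)
    from this(1)[of s] this(2)[of t] this(1)[of "- s"]
    obtain u v u' where uv: "u \<in> G" "v \<in> G" "u' \<in> G" "shear \<rho>1 (\<lambda>x. s * ch e1 x) u"
      "shear \<rho>2 (\<lambda>x. t * ch e2 x) v" "shear \<rho>1 (\<lambda>x. (- s) * ch e1 x) u'"
      by (elim bexE) (rule that)
    have "f (\<lambda>k. t * s ^ k) = (\<lambda>x. \<Sum>k\<le>nat (\<rho>1 e2). t * (- s) ^ k *
        of_nat (nat (\<rho>1 e2) choose k) * ch (plus_mult e2 e1 k) x)"
      unfolding f_def b_def a_def by (simp add: power_minus[of s] mult_ac)
    then have "shear \<rho>2 (f (\<lambda>k. t * s ^ k)) (u \<cdot> (v \<cdot> u'))"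
      using shear_conj[OF r z uv(4-6)] by simp
    then show ?case using uv(1-3) subgroup.m_closed[OF G] by blast
  next
    case (add c c')
    then obtain g g' where g: "g \<in> G" "g' \<in> G" "shear \<rho>2 (f c) g" "shear \<rho>2 (f c') g'" by blast
    have "f (\<lambda>k. c k + c' k) = (\<lambda>x. f c x + f c' x)"
      unfolding f_def by (simp add: algebra_simps sum.distrib)
    then have "shear \<rho>2 (f (\<lambda>k. c k + c' k)) (g \<cdot> g')"
      using shear_add[OF D2(1) fW fW g(3,4)] by simp
    then show ?case using g subgroup.m_closed[OF G] by blast
  qed
  have i: "i \<le> a" using i by (simp add: a_def)
  obtain c :: "nat \<Rightarrow> 'k" where c: "c \<in> geometric_span" "c i = 1" "\<And>k. k \<le> a \<Longrightarrow> k \<noteq> i \<Longrightarrow> c k = 0"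
    using geometric_span_unit by blast
  have b: "b i \<noteq> 0" using i by (simp add: b_def)
  have "\<exists>g\<in>G. shear \<rho>2 (\<lambda>x. t * ch (plus_mult e2 e1 i) x) g" for t
  proof -
    have "f (\<lambda>k. t / b i * c k) = (\<lambda>x. t * ch (plus_mult e2 e1 i) x)"
    proof
      fix x
      have "f (\<lambda>k. t / b i * c k) x =
          (\<Sum>k\<le>a. if k = i then t * ch (plus_mult e2 e1 i) x else 0)"
        unfolding f_def by (rule sum.cong) (use b c in auto)
      then show "f (\<lambda>k. t / b i * c k) x = t * ch (plus_mult e2 e1 i) x" using i by simp
    qed
    then show ?thesis using *[OF geometric_span_scale[OF c(1), of "t / b i"]] by simp
  qed
  then show ?thesis
    using root_plus_mult[OF r z assms(5)] unfolding has_root_def by blast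
qed

text \<open>The shear divides \<open>ch e\<close> by \<open>1 + 3 s / a\<close>, which turns
  \<open>1 / a\<close> into \<open>1 / (a + 3 s)\<close>, and multiplies \<open>ch f\<close> by a
  positive power of the same factor. All values stay in the image of the rationals, so
  \<open>pingpong_step\<close> applies.\<close>

lemma letter_step:
  fixes a b s :: rat
  assumes r: "root \<rho> e" and f: "f \<in> M" "0 < \<rho> f" and s: "s = 1 \<or> s = -1"
    and g: "shear \<rho> (\<lambda>x. (3 * of_rat s) * ch e x) g" and x: "x \<in> Xo"
    and ab: "a \<noteq> 0" "b \<noteq> 0" "ch e x = of_rat (1 / a)" "ch f x = of_rat (1 / b)" "\<bar>a * b\<bar> \<le> 1"
      "- 1 \<le> s * a"
  shows "g x \<in> Xo \<and> (\<exists>a' b'. a' \<noteq> 0 \<and> b' \<noteq> 0 \<and> ch e (g x) = of_rat (1 / a') \<and>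
    ch f (g x) = of_rat (1 / b') \<and> \<bar>a' * b'\<bar> \<le> 1 \<and> 1 < s * a')"
proof -
  note D = rootD[OF r]
  define q where "q = nat (\<rho> f)"
  have q: "0 < q" "\<rho> f = int q" using f by (auto simp: q_def)
  define a' where "a' = a + 3 * s"
  define b' where "b' = b * (a / a') ^ q"
  note p = pingpong_step[OF s ab(5,6) q(1), folded a'_def, folded b'_def]
  have a': "a' \<noteq> 0" using p(1) s by auto
  have b': "b' \<noteq> 0" using a' ab by (simp add: b'_def)
  have e: "1 + 3 * of_rat s * ch e x = of_rat (a' / a)"
  proof -
    have "a' / a = 1 + 3 * s * (1 / a)" using ab(1) by (simp add: a'_def field_simps)
    then show ?thesis
      unfolding ab(3) by (simp only: of_rat_add of_rat_mult of_rat_numeral_eq of_rat_1)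
  qed
  then have nz: "1 + 3 * of_rat s * ch e x \<noteq> 0" using a' ab by simp
  note st = shear_step[OF D(1) g x nz]
  have "ch e (g x) = ch e x * of_rat (a' / a) powi \<rho> e"
    using st(2)[OF D(2)] unfolding e .
  then have "ch e (g x) = of_rat (1 / a * inverse (a' / a))"
    unfolding ab(3) D(3) by (simp only: power_int_minus power_int_1_right of_rat_mult of_rat_inverse)
  moreover have "1 / a * inverse (a' / a) = 1 / a'" using ab(1) by simp
  ultimately have E: "ch e (g x) = of_rat (1 / a')" by (rule subst[rotated])
  have "ch f (g x) = ch f x * of_rat (a' / a) powi \<rho> f"
    using st(2)[OF f(1)] unfolding e .
  then have "ch f (g x) = of_rat (1 / b * (a' / a) ^ q)"
    unfolding ab(4) q(2) by (simp only: power_int_of_nat of_rat_mult of_rat_power)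
  moreover have "1 / b * (a' / a) ^ q = 1 / b'"
    using ab(1,2) a' by (simp add: b'_def power_divide)
  ultimately have F: "ch f (g x) = of_rat (1 / b')" by (rule subst[rotated])
  have p': "1 < s * a'" "\<bar>a' * b'\<bar> \<le> 1" using p unfolding a'_def[symmetric] .
  show ?thesis
    by (rule conjI[OF st(1)], rule exI[of _ a'], rule exI[of _ b'],
        rule conjI[OF a' conjI[OF b' conjI[OF E conjI[OF F conjI[OF p'(2) p'(1)]]]]])
qed

end

section \<open>Ping-pong on reduced words\<close>

context toric_data begin

definition letter_sign :: "bool \<Rightarrow> rat" where
  "letter_sign \<epsilon> = (if \<epsilon> then -1 else 1)"

text \<open>The region of a reduced word depends on its first letter, which acts last: the generator
  decides which coordinate is large, the exponent decides its sign. The empty word stands for the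
  base point.\<close>

fun pingpong_state :: "letter list \<Rightarrow> rat \<Rightarrow> rat \<Rightarrow> bool" where
  "pingpong_state [] a b \<longleftrightarrow> a = 1 \<and> b = 1"
| "pingpong_state ((i, \<epsilon>) # w) a b \<longleftrightarrow> 1 < letter_sign \<epsilon> * (if i then a else b)"

lemma letter_sign_cases: "letter_sign \<epsilon> = 1 \<or> letter_sign \<epsilon> = -1"
  by (simp add: letter_sign_def)

lemma abs_gt_one_other:
  fixes a b :: rat
  assumes "\<bar>a * b\<bar> \<le> 1" "1 < \<bar>a\<bar>"
  shows "\<bar>b\<bar> < 1"
proof (rule ccontr)
  assume "\<not> \<bar>b\<bar> < 1"
  then have "\<bar>a\<bar> * 1 \<le> \<bar>a\<bar> * \<bar>b\<bar>" by (intro mult_left_mono) auto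
  then show False using assms by (simp add: abs_mult)
qed

lemma letter_sign_gt: "1 < letter_sign \<epsilon> * a \<Longrightarrow> 1 < \<bar>a\<bar>"
  by (auto simp: letter_sign_def split: if_splits)

text \<open>If the first letter of \<open>w\<close> moved the same coordinate, reducedness excludes
  the opposite sign, so this coordinate is large in the right direction. If it moved the other one,
  that one exceeds 1 in absolute value, and the bound on \<open>a * b\<close> keeps this one below
  1.\<close>

lemma pingpong_state_bound:
  assumes "pingpong_state w a b" "\<bar>a * b\<bar> \<le> 1" "w = [] \<or> hd w \<noteq> (i, \<not> \<epsilon>)"
  shows "- 1 \<le> letter_sign \<epsilon> * (if i then a else b)"
proof (cases w)
  case Nil
  then show ?thesis using assms(1) by (simp add: letter_sign_def)
next
  case (Cons l w')
  obtain j \<delta> where l: "l = (j, \<delta>)" by fastforce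
  have 1: "1 < letter_sign \<delta> * (if j then a else b)" using assms(1) by (simp add: Cons l)
  show ?thesis
  proof (cases "i = j")
    case True
    then show ?thesis using assms(3) 1 by (auto simp: Cons l letter_sign_def)
  next
    case False
    have "1 < \<bar>if j then a else b\<bar>" using letter_sign_gt[OF 1] .
    then have "\<bar>if i then a else b\<bar> < 1"
      using abs_gt_one_other[of a b] abs_gt_one_other[of b a] assms(2) False
      by (cases i; cases j) (auto simp: mult.commute)
    then show ?thesis by (auto simp: letter_sign_def abs_if split: if_splits)
  qed
qed

text \<open>The two coordinates cannot both exceed 1 in absolute value, a large coordinate has only
  one sign, and the base point \<open>(1, 1)\<close> lies in none of the regions. Hence a point
  reveals the first letter.\<close>

lemma pingpong_state_disjoint:
  assumes "pingpong_state v a b" "pingpong_state w a b" "\<bar>a * b\<bar> \<le> 1"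
  shows "(v = [] \<and> w = []) \<or> (v \<noteq> [] \<and> w \<noteq> [] \<and> hd v = hd w)"
proof -
  have *: "\<not> (1 < letter_sign \<epsilon> * a \<and> 1 < letter_sign \<delta> * b)" for \<epsilon> \<delta>
    using abs_gt_one_other[OF assms(3)] letter_sign_gt[of \<epsilon> a] letter_sign_gt[of \<delta> b] by fastforce
  have **: "\<epsilon> = \<delta>" if "1 < letter_sign \<epsilon> * c" "1 < letter_sign \<delta> * c" for \<epsilon> \<delta> c
    using that by (auto simp: letter_sign_def split: if_splits)
  have ***: "\<not> 1 < letter_sign \<epsilon> * 1" for \<epsilon> by (simp add: letter_sign_def)
  show ?thesis
    using assms(1,2) * ** ***
    by (cases "(v, a, b)" rule: pingpong_state.cases; cases "(w, a, b)" rule: pingpong_state.cases)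
      (auto split: if_splits)
qed

lemma contains_free_group:
  assumes G: "subgroup G (Aut X)"
    and h1: "has_root G \<rho>1 e1" and h2: "has_root G \<rho>2 e2"
    and p: "0 < \<rho>2 e1" and q: "0 < \<rho>1 e2"
  shows "contains_F2 (Aut X) G"
proof -
  interpret Aut: group "Aut X" by (rule group_Aut)
  have r: "root \<rho>1 e1" "root \<rho>2 e2" using h1 h2 by (auto simp: has_root_def)
  note D1 = rootD[OF r(1)] and D2 = rootD[OF r(2)]
  have ex: "\<exists>g. g \<in> G \<and>
      shear (if i then \<rho>1 else \<rho>2) (\<lambda>x. (3 * of_rat (letter_sign \<epsilon>)) * ch (if i then e1 else e2) x) g"
    for i \<epsilon>
    using h1 h2 by (cases i) (auto simp: has_root_def)
  define L where "L = (\<lambda>(i, \<epsilon>). SOME g. g \<in> G \<and>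
    shear (if i then \<rho>1 else \<rho>2) (\<lambda>x. (3 * of_rat (letter_sign \<epsilon>)) * ch (if i then e1 else e2) x) g)"
  have L: "L (i, \<epsilon>) \<in> G \<and> shear (if i then \<rho>1 else \<rho>2)
      (\<lambda>x. (3 * of_rat (letter_sign \<epsilon>)) * ch (if i then e1 else e2) x) (L (i, \<epsilon>))" for i \<epsilon>
    unfolding L_def prod.case by (rule someI_ex[OF ex])
  have LG: "L l \<in> G" for l using L by (cases l) auto
  have LA: "L l \<in> carrier (Aut X)" for l using LG subgroup.subset[OF G] by blast
  have Linv: "L l \<cdot> L (inv_letter l) = \<one>\<^bsub>Aut X\<^esub>" for l
  proof -
    obtain i \<epsilon> where l: "l = (i, \<epsilon>)" by fastforce
    let ?\<rho> = "if i then \<rho>1 else \<rho>2" and ?e = "if i then e1 else e2"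
    have \<rho>: "additive ?\<rho>" "?e \<in> M" "?\<rho> ?e = -1" using D1 D2 by auto
    have "shear ?\<rho> (\<lambda>x. (3 * of_rat (letter_sign \<epsilon>)) * ch ?e x + (3 * of_rat (letter_sign (\<not> \<epsilon>))) * ch ?e x)
        (L (i, \<epsilon>) \<cdot> L (i, \<not> \<epsilon>))"
      by (rule shear_add[OF \<rho>(1) Wt_ch[where \<rho> = ?\<rho>, OF \<rho>(2,3)] Wt_ch[where \<rho> = ?\<rho>, OF \<rho>(2,3)]
            conjunct2[OF L[of i \<epsilon>]] conjunct2[OF L[of i "\<not> \<epsilon>"]]])
    then show ?thesis
      using shear_eqI[OF _ shear_zero[of ?\<rho>], of _ "L (i, \<epsilon>) \<cdot> L (i, \<not> \<epsilon>)"]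
      by (auto simp: l inv_letter_def letter_sign_def of_rat_minus split: if_splits)
  qed
  define h where "h w = foldr (\<lambda>l g. L l \<cdot> g) w \<one>\<^bsub>Aut X\<^esub>" for w
  have h_simps: "h [] = \<one>\<^bsub>Aut X\<^esub>" "h (l # w) = L l \<cdot> h w" for l w
    by (simp_all add: h_def)
  have hG: "h w \<in> G" for w
    by (induction w) (auto simp: h_simps LG subgroup.one_closed[OF G] subgroup.m_closed[OF G])
  have hA: "h w \<in> carrier (Aut X)" for w using hG subgroup.subset[OF G] by blast
  have push: "h (push_letter l w) = L l \<cdot> h w" for l w
  proof (cases w)
    case (Cons k v)
    have "L l \<cdot> (L (inv_letter l) \<cdot> h v) = h v"
      using Linv[of l] LA hA by (simp add: Aut.m_assoc[symmetric])
    then show ?thesis by (simp add: Cons h_simps)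
  qed (simp add: h_simps)
  have h_mult: "h (foldr push_letter u v) = h u \<cdot> h v" for u v
    by (induction u) (simp_all add: h_simps push hA LA Aut.m_assoc)
  \<comment> \<open>The letters act on \<open>x0\<close> from the right end of the word, so the
    induction prepends the letter that acts last.\<close>
  have state: "h w x0 \<in> Xo \<and> (\<exists>a b. a \<noteq> 0 \<and> b \<noteq> 0 \<and> ch e1 (h w x0) = of_rat (1 / a) \<and>
      ch e2 (h w x0) = of_rat (1 / b) \<and> \<bar>a * b\<bar> \<le> 1 \<and> pingpong_state w a b)"
    if "w \<in> carrier F2" for w
    using that
  proof (induction w)
    case Nil
    have "h [] x0 = x0" by (simp add: h_simps Aut_one_apply base_in)
    then show ?case
      using base_Xo D1 D2 by (auto simp: ch_base intro!: exI[of _ 1])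
  next
    case (Cons l w)
    obtain i \<epsilon> where l: "l = (i, \<epsilon>)" by fastforce
    have w: "w \<in> carrier F2" "w = [] \<or> hd w \<noteq> (i, \<not> \<epsilon>)"
      using Cons.prems by (auto simp: F2_def inv_letter_def l successively_Cons)
    define P where "P = h w x0"
    obtain a b where IH: "P \<in> Xo" "a \<noteq> 0" "b \<noteq> 0" "ch e1 P = of_rat (1 / a)"
      "ch e2 P = of_rat (1 / b)" "\<bar>a * b\<bar> \<le> 1" "pingpong_state w a b"
      using Cons.IH[OF w(1)] unfolding P_def by blast
    have P: "h (l # w) x0 = L (i, \<epsilon>) P"
      by (simp add: h_simps l P_def Aut_mult_apply LA hA base_in)
    note bd = pingpong_state_bound[OF IH(7,6) w(2)]
    show ?case
    proof (cases i)
      case True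
      have "shear \<rho>1 (\<lambda>x. (3 * of_rat (letter_sign \<epsilon>)) * ch e1 x) (L (i, \<epsilon>))"
        using L[of i \<epsilon>] True by simp
      from letter_step[OF r(1) D2(2) q letter_sign_cases this IH(1-6)] bd True
      show ?thesis unfolding P by (auto simp: l)
    next
      case False
      have "shear \<rho>2 (\<lambda>x. (3 * of_rat (letter_sign \<epsilon>)) * ch e2 x) (L (i, \<epsilon>))"
        using L[of i \<epsilon>] False by simp
      moreover have "\<bar>b * a\<bar> \<le> 1" using IH(6) by (simp add: mult.commute)
      moreover have "- 1 \<le> letter_sign \<epsilon> * b" using bd False by simp
      ultimately have "L (i, \<epsilon>) P \<in> Xo \<and> (\<exists>a' b'. a' \<noteq> 0 \<and> b' \<noteq> 0 \<and>
        ch e2 (L (i, \<epsilon>) P) = of_rat (1 / a') \<and> ch e1 (L (i, \<epsilon>) P) = of_rat (1 / b') \<and>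
        \<bar>a' * b'\<bar> \<le> 1 \<and> 1 < letter_sign \<epsilon> * a')"
        by (rule letter_step[OF r(2) D1(2) p letter_sign_cases _ IH(1,3,2,5,4)])
      then obtain a' b' where "L (i, \<epsilon>) P \<in> Xo" "a' \<noteq> 0" "b' \<noteq> 0"
        "ch e2 (L (i, \<epsilon>) P) = of_rat (1 / a')" "ch e1 (L (i, \<epsilon>) P) = of_rat (1 / b')"
        "\<bar>a' * b'\<bar> \<le> 1" "1 < letter_sign \<epsilon> * a'"
        by blast
      then show ?thesis
        unfolding P using False by (intro conjI exI[of _ b'] exI[of _ a']) (auto simp: l mult.commute)
    qed
  qed
  \<comment> \<open>The image of \<open>x0\<close> reveals the first letter of a word; cancelling it
    in the group leaves shorter words.\<close>
  have inj: "u = v" if "u \<in> carrier F2" "v \<in> carrier F2" "h u = h v" for u v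
    using that
  proof (induction u arbitrary: v)
    case Nil
    obtain a b where 1: "ch e1 (h [] x0) = of_rat (1 / a)" "ch e2 (h [] x0) = of_rat (1 / b)"
      "\<bar>a * b\<bar> \<le> 1" "pingpong_state [] a b" using state[OF Nil(1)] by blast
    obtain a' b' where 2: "ch e1 (h v x0) = of_rat (1 / a')" "ch e2 (h v x0) = of_rat (1 / b')"
      "\<bar>a' * b'\<bar> \<le> 1" "pingpong_state v a' b'" using state[OF Nil(2)] by blast
    have "a' = a" "b' = b" using 1(1,2) 2(1,2) unfolding Nil(3) by simp_all
    then show ?case using pingpong_state_disjoint[of "[]" a b v] 1 2 by blast
  next
    case (Cons l u)
    obtain a b where 1: "ch e1 (h (l # u) x0) = of_rat (1 / a)" "ch e2 (h (l # u) x0) = of_rat (1 / b)"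
      "\<bar>a * b\<bar> \<le> 1" "pingpong_state (l # u) a b" using state[OF Cons(2)] by blast
    obtain a' b' where 2: "ch e1 (h v x0) = of_rat (1 / a')" "ch e2 (h v x0) = of_rat (1 / b')"
      "\<bar>a' * b'\<bar> \<le> 1" "pingpong_state v a' b'" using state[OF Cons(3)] by blast
    have "a' = a" "b' = b" using 1(1,2) 2(1,2) unfolding Cons(4) by simp_all
    then have "v \<noteq> [] \<and> hd v = l" using pingpong_state_disjoint[of "l # u" a b v] 1 2 by auto
    then obtain v' where v: "v = l # v'" by (cases v) auto
    have "h u = h v'"
      using Cons(4) LA hA unfolding v h_simps by simp
    moreover have "u \<in> carrier F2" "v' \<in> carrier F2"
      using Cons(2,3) by (auto simp: v F2_def successively_Cons)
    ultimately show ?case using Cons(1) v by blast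
  qed
  show ?thesis
    unfolding contains_F2_def
  proof (intro bexI conjI)
    show "h \<in> hom F2 (Aut X)"
      by (rule homI) (auto simp: hA h_mult F2_def)
    show "inj_on h (carrier F2)" using inj by (auto intro: inj_onI)
    show "h ` carrier F2 \<subseteq> G" using hG by auto
  qed
qed

end

section \<open>The triangular case\<close>

text \<open>Absence of two-cycles is required for all roots in \<open>G\<close>, because the
  commutators in \<open>arrow_trans\<close> produce roots that need not be among the generating
  ones. The set \<open>F0\<close> supports all coordinate functions, so a matrix representation that
  involves its weight functions is faithful.\<close>

locale root_group = toric_data X S \<chi> x0
  for X :: "('p, 'k::field_char_0) space" and S :: "'m::ab_group_add set" and \<chi> x0 +
  fixes I :: "'i set" and \<rho> :: "'i \<Rightarrow> 'm \<Rightarrow> int" and e :: "'i \<Rightarrow> 'm"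
    and u :: "'i \<Rightarrow> 'k \<Rightarrow> 'p \<Rightarrow> 'p" and G :: "('p \<Rightarrow> 'p) set" and F0 :: "'m set"
  assumes fin_I: "finite I"
    and roots: "i \<in> I \<Longrightarrow> root (\<rho> i) (e i)"
    and shears: "i \<in> I \<Longrightarrow> shear (\<rho> i) (\<lambda>x. c * ch (e i) x) (u i c)"
    and G_def: "G = generate (Aut X) (\<Union>i\<in>I. range (u i))"
    and F0: "finite F0" "F0 \<subseteq> S"
    and coords_span: "f \<in> coords X \<Longrightarrow> \<exists>a. \<forall>x\<in>pts X. f x = (\<Sum>m\<in>F0. a m * \<chi> m x)"
    and coords_separate: "x \<in> pts X \<Longrightarrow> y \<in> pts X \<Longrightarrow> (\<And>f. f \<in> coords X \<Longrightarrow> f x = f y) \<Longrightarrow> x = y"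
    and no_two_cycle: "has_root G \<rho>1 e1 \<Longrightarrow> has_root G \<rho>2 e2 \<Longrightarrow> \<not> (0 < \<rho>2 e1 \<and> 0 < \<rho>1 e2)"
begin

sublocale Aut: group "Aut X" by (rule group_Aut)

lemma u_Aut: "i \<in> I \<Longrightarrow> u i c \<in> carrier (Aut X)"
  using shears shear_Aut by blast

lemma G_subgroup: "subgroup G (Aut X)"
  unfolding G_def by (rule Aut.generate_is_subgroup) (use u_Aut in auto)

lemma G_Aut: "g \<in> G \<Longrightarrow> g \<in> carrier (Aut X)"
  using subgroup.subset[OF G_subgroup] by blast

lemma G_mult: "g \<in> G \<Longrightarrow> h \<in> G \<Longrightarrow> g \<cdot> h \<in> G"
  by (rule subgroup.m_closed[OF G_subgroup])

lemma G_one: "\<one>\<^bsub>Aut X\<^esub> \<in> G"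
  by (rule subgroup.one_closed[OF G_subgroup])

lemma u_G: "i \<in> I \<Longrightarrow> u i c \<in> G"
  unfolding G_def by (rule generate.incl) blast

lemma has_root_gen: "i \<in> I \<Longrightarrow> has_root G (\<rho> i) (e i)"
  unfolding has_root_def using roots shears u_G by blast

lemma u_inv:
  assumes "i \<in> I"
  shows "inv\<^bsub>Aut X\<^esub> (u i c) = u i (- c)"
proof (rule Aut.inv_equality)
  note D = rootD[OF roots[OF assms]]
  have "shear (\<rho> i) (\<lambda>x. (- c) * ch (e i) x + c * ch (e i) x) (u i (- c) \<cdot> u i c)"
    by (rule shear_add[OF D(1) Wt_ch[where \<rho> = "\<rho> i", OF D(2,3)] Wt_ch[where \<rho> = "\<rho> i", OF D(2,3)]
          shears[OF assms] shears[OF assms]])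
  then show "u i (- c) \<cdot> u i c = \<one>\<^bsub>Aut X\<^esub>"
    by (rule shear_eqI[OF _ shear_zero]) simp
qed (use u_Aut assms in auto)

section \<open>The order on the functionals and the dual characters\<close>

definition Rays :: "('m \<Rightarrow> int) set" where
  "Rays = \<rho> ` I"

lemma fin_Rays: "finite Rays"
  by (simp add: Rays_def fin_I)

lemma Rays_additive: "r \<in> Rays \<Longrightarrow> additive r"
  using roots rootD(1) by (auto simp: Rays_def)

lemma rays_Rays: "rays Rays"
  by (simp add: rays_def fin_Rays Rays_additive)

lemma Rays_root: "r \<in> Rays \<Longrightarrow> \<exists>d. has_root G r d"
  using has_root_gen by (auto simp: Rays_def)

lemma has_rootD: "has_root G r d \<Longrightarrow> root r d"
  by (simp add: has_root_def)

lemma Rays_nonneg: "r \<in> Rays \<Longrightarrow> has_root G r' d \<Longrightarrow> r \<noteq> r' \<Longrightarrow> 0 \<le> r d"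
  using Rays_root root_nonneg has_rootD by metis

text \<open>Any root in \<open>G\<close> may serve as the witness \<open>d\<close>; with generating
  roots alone the relation need not be transitive.\<close>

definition arrow :: "('m \<Rightarrow> int) \<Rightarrow> ('m \<Rightarrow> int) \<Rightarrow> bool" where
  "arrow r r' \<longleftrightarrow> r \<in> Rays \<and> r' \<in> Rays \<and> (\<exists>d. has_root G r d \<and> 0 < r' d)"

lemma arrow_irrefl: "\<not> arrow r r"
  using rootD(3)[OF has_rootD] by (fastforce simp: arrow_def)

text \<open>Absence of two-cycles gives \<open>r1 d2 = 0\<close>, so the string through
  \<open>d1\<close> in direction \<open>d2\<close> consists of roots along \<open>r1\<close>. On its
  member \<open>d1 + d2\<close> the functional \<open>r3\<close> is positive, as
  \<open>r3 d1\<close> is nonnegative.\<close>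

lemma arrow_trans:
  assumes "arrow r1 r2" "arrow r2 r3"
  shows "arrow r1 r3"
proof -
  obtain d1 d2 where d: "has_root G r1 d1" "0 < r2 d1" "has_root G r2 d2" "0 < r3 d2"
    and r: "r1 \<in> Rays" "r2 \<in> Rays" "r3 \<in> Rays"
    using assms by (auto simp: arrow_def)
  note D1 = rootD[OF has_rootD[OF d(1)]] and D2 = rootD[OF has_rootD[OF d(3)]]
  have "r1 \<noteq> r2" using arrow_irrefl assms(1) by blast
  then have z: "r1 d2 = 0" using no_two_cycle[OF d(1,3)] d(2) Rays_nonneg[OF r(1) d(3)] by force
  then have ne: "r3 \<noteq> r1" using d(4) by auto
  have 1: "has_root G r1 (d1 + d2)"
    using has_root_string[OF G_subgroup d(3,1) z, of 1] d(2) by simp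
  have "0 < r3 (d1 + d2)"
    using additive_add[OF Rays_additive[OF r(3)] D1(2) D2(2)] Rays_nonneg[OF r(3) d(1) ne] d(4) by simp
  then show ?thesis using 1 r by (auto simp: arrow_def)
qed

definition height :: "('m \<Rightarrow> int) \<Rightarrow> nat" where
  "height r = card {r'. arrow r r'}"

lemma fin_arrow: "finite {r'. arrow r r'}"
  by (rule finite_subset[OF _ fin_Rays]) (auto simp: arrow_def)

text \<open>By transitivity every successor of \<open>r'\<close> is one of \<open>r\<close>, and
  \<open>r'\<close> itself is a successor of \<open>r\<close> but not of \<open>r'\<close>.\<close>

lemma arrow_height: "arrow r r' \<Longrightarrow> height r' < height r"
  unfolding height_def
  by (rule psubset_card_mono[OF fin_arrow]) (use arrow_trans arrow_irrefl in blast)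

text \<open>The weights of \<open>ell\<close> grow so fast with the height that every generating root lowers \<open>ell\<close>.\<close>

definition base_weight :: int where
  "base_weight = 1 + (\<Sum>i\<in>I. \<Sum>r\<in>Rays. \<bar>r (e i)\<bar>)"

definition ell :: "'m \<Rightarrow> int" where
  "ell m = (\<Sum>r\<in>Rays. base_weight ^ height r * r m)"

lemma base_weight_pos: "0 < base_weight"
  unfolding base_weight_def by (simp add: add_pos_nonneg sum_nonneg)

lemma ell_nonneg: "m \<in> S \<Longrightarrow> 0 \<le> ell m"
  unfolding ell_def
  by (intro sum_nonneg mult_nonneg_nonneg)
    (use base_weight_pos in \<open>auto simp: additive_nonneg Rays_additive\<close>)

lemma ell_add: "d \<in> M \<Longrightarrow> d' \<in> M \<Longrightarrow> ell (d + d') = ell d + ell d'"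
  unfolding ell_def by (simp add: additive_add Rays_additive distrib_left sum.distrib)

text \<open>In units of \<open>base_weight ^ height (\<rho> i)\<close> the term of
  \<open>\<rho> i\<close> is -1. Any other functional that is positive on \<open>e i\<close> has
  smaller height, so its weight is smaller by at least one factor \<open>base_weight\<close>, and
  this factor exceeds the sum of all values that can occur.\<close>

lemma ell_root:
  assumes i: "i \<in> I"
  shows "ell (e i) < 0"
proof -
  let ?K = base_weight and ?R = "Rays - {\<rho> i}"
  have ri: "\<rho> i \<in> Rays" using i by (simp add: Rays_def)
  have wt: "?K * (?K ^ height r * r (e i)) \<le> ?K ^ height (\<rho> i) * \<bar>r (e i)\<bar>" if r: "r \<in> ?R" for r
  proof (cases "0 < r (e i)")
    case True
    then have "arrow (\<rho> i) r" using r ri has_root_gen[OF i] by (auto simp: arrow_def)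
    then have "Suc (height r) \<le> height (\<rho> i)" using arrow_height by (simp add: Suc_le_eq)
    then have "?K ^ Suc (height r) \<le> ?K ^ height (\<rho> i)"
      using base_weight_pos by (intro power_increasing) auto
    from mult_right_mono[OF this, of "r (e i)"] True show ?thesis by (simp add: mult.assoc)
  next
    case False
    then have "r (e i) = 0" using Rays_nonneg[OF _ has_root_gen[OF i], of r] r by force
    then show ?thesis by simp
  qed
  have "(\<Sum>r\<in>?R. \<bar>r (e i)\<bar>) \<le> (\<Sum>r\<in>Rays. \<bar>r (e i)\<bar>)"
    by (rule sum_mono2) (auto simp: fin_Rays)
  also have "\<dots> \<le> (\<Sum>i\<in>I. \<Sum>r\<in>Rays. \<bar>r (e i)\<bar>)"
    using member_le_sum[OF i _ fin_I, of "\<lambda>i. \<Sum>r\<in>Rays. \<bar>r (e i)\<bar>"] by (simp add: sum_nonneg)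
  also have "\<dots> < ?K" by (simp add: base_weight_def)
  finally have lt: "(\<Sum>r\<in>?R. \<bar>r (e i)\<bar>) < ?K" .
  have "?K * (\<Sum>r\<in>?R. ?K ^ height r * r (e i)) \<le> ?K ^ height (\<rho> i) * (\<Sum>r\<in>?R. \<bar>r (e i)\<bar>)"
    unfolding sum_distrib_left by (rule sum_mono) (rule wt)
  also have "\<dots> < ?K ^ height (\<rho> i) * ?K"
    by (rule mult_strict_left_mono[OF lt]) (use base_weight_pos in simp)
  also have "\<dots> = ?K * ?K ^ height (\<rho> i)" by (simp add: mult.commute)
  finally have "(\<Sum>r\<in>?R. ?K ^ height r * r (e i)) < ?K ^ height (\<rho> i)"
    using base_weight_pos by (simp add: mult_less_cancel_left)
  moreover have "ell (e i) = ?K ^ height (\<rho> i) * \<rho> i (e i) + (\<Sum>r\<in>?R. ?K ^ height r * r (e i))"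
    unfolding ell_def by (rule sum.remove[OF fin_Rays ri])
  ultimately show ?thesis using rootD(3)[OF roots[OF i]] by simp
qed

lemma ell_move: "i \<in> I \<Longrightarrow> m \<in> S \<Longrightarrow> ell (m + e i) < ell m"
  using ell_add[of m "e i"] ell_root[of i] S_M[of m] rootD(2)[OF roots[of i]] by simp

lemma move_S: "i \<in> I \<Longrightarrow> m \<in> S \<Longrightarrow> 0 < \<rho> i m \<Longrightarrow> m + e i \<in> S"
  using rootD(4)[OF roots] by blast

text \<open>Take \<open>m\<close> with \<open>r m > 0\<close> and \<open>ell m\<close> minimal.
  Moves along generating roots lower \<open>ell\<close>, so no permitted move keeps \<open>r\<close>
  positive. A generating root along \<open>r\<close> therefore forces \<open>r m = 1\<close>; roots
  along the other functionals do not lower \<open>r\<close>, so these functionals must vanish at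
  \<open>m\<close>.\<close>

lemma dual_vector:
  assumes r: "r \<in> Rays"
  shows "\<exists>m\<in>S. r m = 1 \<and> (\<forall>r'\<in>Rays. r' \<noteq> r \<longrightarrow> r' m = 0)"
proof -
  obtain i where i: "i \<in> I" "r = \<rho> i" using r by (auto simp: Rays_def)
  note D = rootD[OF roots[OF i(1)], folded i(2)]
  obtain p q where "p \<in> S" "q \<in> S" "e i = p - q" using D(2) by (rule M_E)
  then have "0 < r q"
    using additive_diff[OF D(1), of p q] additive_nonneg[OF D(1), of p] D(3) by simp
  with \<open>q \<in> S\<close> have "\<exists>m. m \<in> S \<and> 0 < r m" by blast
  then obtain m where m: "m \<in> S" "0 < r m"
    and min: "\<And>m'. m' \<in> S \<Longrightarrow> 0 < r m' \<Longrightarrow> nat (ell m) \<le> nat (ell m')"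
    using ex_has_least_nat[of "\<lambda>m. m \<in> S \<and> 0 < r m" _ "\<lambda>m. nat (ell m)"] by metis
  have no: "r (m + e j) \<le> 0" if j: "j \<in> I" "0 < \<rho> j m" for j
  proof (rule ccontr)
    assume "\<not> r (m + e j) \<le> 0"
    then have "nat (ell m) \<le> nat (ell (m + e j))" using min move_S[OF j(1) m(1) j(2)] by simp
    then show False
      using ell_move[OF j(1) m(1)] ell_nonneg[OF move_S[OF j(1) m(1) j(2)]] by simp
  qed
  have "r m = 1"
    using no[OF i(1)] m i(2) additive_add[OF D(1) S_M[OF m(1)] D(2)] D(3) by simp
  moreover have "r' m = 0" if r': "r' \<in> Rays" "r' \<noteq> r" for r'
  proof (rule ccontr)
    assume "r' m \<noteq> 0"
    then have pos: "0 < r' m" using additive_nonneg[OF Rays_additive[OF r'(1)] m(1)] by simp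
    obtain j where j: "j \<in> I" "r' = \<rho> j" using r' by (auto simp: Rays_def)
    have "r (m + e j) = r m + r (e j)"
      using additive_add[OF D(1) S_M[OF m(1)] rootD(2)[OF roots[OF j(1)]]] .
    moreover have "0 \<le> r (e j)" using Rays_nonneg[OF r has_root_gen[OF j(1)]] r' j by simp
    ultimately show False using no[OF j(1)] pos j m by simp
  qed
  ultimately show ?thesis using m by blast
qed

text \<open>The weight function of \<open>dual r\<close> plays the role of the Cox coordinate of \<open>r\<close>: it is multiplied
  by exactly \<open>1 + F r\<close>, where \<open>F r\<close> is the parameter of the normal form.\<close>

definition dual :: "('m \<Rightarrow> int) \<Rightarrow> 'm" where
  "dual r = (SOME m. m \<in> S \<and> r m = 1 \<and> (\<forall>r'\<in>Rays. r' \<noteq> r \<longrightarrow> r' m = 0))"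

lemma dual:
  assumes "r \<in> Rays"
  shows "dual r \<in> S" "r (dual r) = 1" "r' \<in> Rays \<Longrightarrow> r' \<noteq> r \<Longrightarrow> r' (dual r) = 0"
  using someI_ex[OF dual_vector[OF assms, unfolded Bex_def]] unfolding dual_def by blast+

text \<open>The exponents that can occur when generating one-parameter subgroups are applied
  repeatedly to \<open>\<chi> m\<close>: a shear along \<open>\<rho> i\<close> adds
  \<open>e i\<close> at most \<open>\<rho> i m'\<close> times to \<open>m'\<close>.\<close>

inductive_set reach :: "'m \<Rightarrow> 'm set" for m where
  refl: "m \<in> reach m"
| step: "m' \<in> reach m \<Longrightarrow> i \<in> I \<Longrightarrow> 0 < \<rho> i m' \<Longrightarrow> m' + e i \<in> reach m"

lemma reach_S:
  assumes "m' \<in> reach m" "m \<in> S"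
  shows "m' \<in> S"
  using assms by induction (auto intro: move_S)

lemma reach_first:
  assumes "m' \<in> reach m"
  shows "m' = m \<or> (\<exists>i\<in>I. 0 < \<rho> i m \<and> m' \<in> reach (m + e i))"
  using assms by induction (blast intro: reach.intros)+

text \<open>Splitting a path at its first step covers \<open>reach m\<close> by finitely many sets
  that start at a smaller value of \<open>ell\<close>, a nonnegative integer on
  \<open>S\<close>.\<close>

lemma fin_reach: "m \<in> S \<Longrightarrow> finite (reach m)"
proof (induction "nat (ell m)" arbitrary: m rule: less_induct)
  case less
  have "reach m \<subseteq> insert m (\<Union>i\<in>{i\<in>I. 0 < \<rho> i m}. reach (m + e i))"
    using reach_first by blast
  moreover have "finite (reach (m + e i))" if "i \<in> I" "0 < \<rho> i m" for i
    using less.hyps[OF _ move_S[OF that(1) less.prems that(2)]] ell_move[OF that(1) less.prems]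
      ell_nonneg[OF move_S[OF that(1) less.prems that(2)]] by simp
  ultimately show ?case using fin_I by (auto intro: finite_subset)
qed

text \<open>The characters in \<open>F0\<close> make the representation faithful, the dual ones make
  the parameters of the normal form visible as matrix entries, and closure under moves makes the
  span stable.\<close>

definition B :: "'m set" where
  "B = (\<Union>m\<in>F0 \<union> dual ` Rays. reach m)"

lemma B_S: "B \<subseteq> S"
  using reach_S F0 dual by (auto simp: B_def)

lemma fin_B: "finite B"
  unfolding B_def using F0 dual fin_Rays by (auto intro: fin_reach)

lemma F0_B: "F0 \<subseteq> B"
  by (auto simp: B_def intro: reach.refl)

lemma dual_B: "r \<in> Rays \<Longrightarrow> dual r \<in> B"
  by (auto simp: B_def intro: reach.refl)

lemma B_move: "m \<in> B \<Longrightarrow> i \<in> I \<Longrightarrow> 0 < \<rho> i m \<Longrightarrow> m + e i \<in> B"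
  by (auto simp: B_def intro: reach.step)

end

section \<open>Expansion of shears in weight functions\<close>

context toric_data begin

lemma plus_mult_S:
  assumes r: "root r d" and m: "m \<in> S" and k: "k \<le> nat (r m)"
  shows "plus_mult m d k \<in> S"
  using k
proof (induction k)
  case (Suc k)
  have "r (plus_mult m d k) = r m - int k"
    using additive_plus_mult[OF rootD(1)[OF r] S_M[OF m] rootD(2)[OF r]] rootD(3)[OF r] by simp
  then show ?case using Suc rootD(4)[OF r] by simp
qed (use m in simp)

lemma plus_mult_inj:
  assumes r: "root r d" and m: "m \<in> M"
  shows "plus_mult m d k = plus_mult m d l \<longleftrightarrow> k = l"
proof
  assume "plus_mult m d k = plus_mult m d l"
  then have "r (plus_mult m d k) = r (plus_mult m d l)" by simp
  then show "k = l"
    using additive_plus_mult[OF rootD(1)[OF r] m rootD(2)[OF r]] rootD(3)[OF r] by simp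
qed simp

text \<open>The binomial formula holds on \<open>Xo\<close>. All exponents occurring in it lie in
  \<open>S\<close>, so both sides are regular and density extends it to \<open>X\<close>.\<close>

lemma shear_expand:
  assumes r: "root r d" and g: "shear r (\<lambda>x. c * ch d x) g" and m: "m \<in> S" and x: "x \<in> pts X"
  shows "\<chi> m (g x) = (\<Sum>k\<le>nat (r m). of_nat (nat (r m) choose k) * c ^ k * \<chi> (plus_mult m d k) x)"
proof -
  let ?s = "\<lambda>x. \<Sum>k\<le>nat (r m). of_nat (nat (r m) choose k) * c ^ k * \<chi> (plus_mult m d k) x"
  have "\<chi> m (g x) - ?s x = 0"
  proof (rule dense_Xo[OF _ _ x])
    have "regular X (\<lambda>x. \<chi> m (g x))"
      using Aut_regular[OF shear_Aut[OF g] chi_regular[OF m]] .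
    then show "regular X (\<lambda>x. \<chi> m (g x) - ?s x)"
      by (intro regular_diff regular_sum regular_mult regular_const chi_regular)
        (use plus_mult_S[OF r m] in auto)
    fix x assume x: "x \<in> Xo"
    have "\<chi> m (g x) = \<chi> m x * (c * ch d x + 1) ^ nat (r m)"
      using g x m by (simp add: shear_def add.commute)
    also have "\<dots> = (\<Sum>k\<le>nat (r m). \<chi> m x * (of_nat (nat (r m) choose k) * (c ^ k * ch d x ^ k)))"
      by (simp add: binomial_ring sum_distrib_left power_mult_distrib)
    also have "\<dots> = ?s x"
    proof (rule sum.cong)
      fix k assume "k \<in> {..nat (r m)}"
      then have "\<chi> (plus_mult m d k) x = \<chi> m x * ch d x ^ k"
        using ch_plus_mult[OF S_M[OF m] rootD(2)[OF r] x, of k]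
          ch_S[OF plus_mult_S[OF r m] x, of k] ch_S[OF m x] by simp
      then show "\<chi> m x * (of_nat (nat (r m) choose k) * (c ^ k * ch d x ^ k)) =
          of_nat (nat (r m) choose k) * c ^ k * \<chi> (plus_mult m d k) x"
        by simp
    qed simp
    finally show "\<chi> m (g x) - ?s x = 0" by simp
  qed
  then show ?thesis by simp
qed

lemma chi_coeff_eq:
  assumes F: "finite F" "F \<subseteq> S" and F': "finite F'" "F' \<subseteq> S"
    and eq: "\<And>x. x \<in> pts X \<Longrightarrow> (\<Sum>m\<in>F. a m * \<chi> m x) = (\<Sum>m\<in>F'. a' m * \<chi> m x)"
  shows "(if m \<in> F then a m else 0) = (if m \<in> F' then a' m else 0)"
proof (cases "m \<in> F \<union> F'")
  case True
  define c where "c m = (if m \<in> F then a m else 0) - (if m \<in> F' then a' m else 0)" for m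
  have "(\<Sum>m\<in>F \<union> F'. c m * \<chi> m x) = 0" if "x \<in> pts X" for x
  proof -
    have "(\<Sum>m\<in>F \<union> F'. c m * \<chi> m x) = (\<Sum>m\<in>F \<union> F'. (if m \<in> F then a m else 0) * \<chi> m x) -
        (\<Sum>m\<in>F \<union> F'. (if m \<in> F' then a' m else 0) * \<chi> m x)"
      by (simp add: c_def left_diff_distrib sum_subtractf)
    also have "(\<Sum>m\<in>F \<union> F'. (if m \<in> F then a m else 0) * \<chi> m x) = (\<Sum>m\<in>F. a m * \<chi> m x)"
      by (rule sum.mono_neutral_cong_right) (use F F' in auto)
    also have "(\<Sum>m\<in>F \<union> F'. (if m \<in> F' then a' m else 0) * \<chi> m x) = (\<Sum>m\<in>F'. a' m * \<chi> m x)"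
      by (rule sum.mono_neutral_cong_right) (use F F' in auto)
    finally show ?thesis using eq[OF that] by simp
  qed
  then have "c m = 0" by (rule chi_independent[rotated 2]) (use F F' True in auto)
  then show ?thesis by (simp add: c_def)
qed auto

end

section \<open>The matrix representation on the span of the weight functions in
  \<open>B\<close>\<close>

context root_group begin

definition N :: nat where "N = card B"

definition b :: "nat \<Rightarrow> 'm" where "b = (SOME b. bij_betw b {..<N} B)"

lemma b_bij: "bij_betw b {..<N} B"
  unfolding b_def N_def
  using ex_bij_betw_nat_finite[OF fin_B, unfolded atLeast0LessThan] by (rule someI_ex)

lemma b_B: "i < N \<Longrightarrow> b i \<in> B"
  using b_bij by (auto simp: bij_betw_def)

lemma b_S: "i < N \<Longrightarrow> b i \<in> S"
  using b_B B_S by blast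

lemma b_inj: "i < N \<Longrightarrow> j < N \<Longrightarrow> b i = b j \<longleftrightarrow> i = j"
  using b_bij by (auto simp: bij_betw_def inj_on_def)

lemma b_surj:
  assumes "m \<in> B"
  shows "\<exists>i<N. b i = m"
proof -
  have "m \<in> b ` {..<N}" using b_bij assms by (simp add: bij_betw_def)
  then show ?thesis by auto
qed

definition idx :: "'m \<Rightarrow> nat" where "idx m = (SOME i. i < N \<and> b i = m)"

lemma idx: "m \<in> B \<Longrightarrow> idx m < N" "m \<in> B \<Longrightarrow> b (idx m) = m"
  using someI_ex[OF b_surj] unfolding idx_def by blast+

lemma idx_b: "i < N \<Longrightarrow> idx (b i) = i"
  using idx[OF b_B] b_inj by blast

lemma sum_b: "(\<Sum>j<N. f (b j)) = (\<Sum>m\<in>B. f m)"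
  by (rule sum.reindex_bij_betw[OF b_bij])

text \<open>Row \<open>i\<close> expands the pullback of \<open>\<chi> (b i)\<close>, so matrix
  products have the same order as compositions.\<close>

definition is_rep :: "'k mat \<Rightarrow> ('p \<Rightarrow> 'p) \<Rightarrow> bool" where
  "is_rep A g \<longleftrightarrow> A \<in> carrier_mat N N \<and>
     (\<forall>i<N. \<forall>x\<in>pts X. \<chi> (b i) (g x) = (\<Sum>j<N. A $$ (i, j) * \<chi> (b j) x))"

text \<open>Triangularity refers to \<open>ell\<close> and not to the enumeration \<open>b\<close>;
  entries between distinct indices with equal \<open>ell\<close> are zero.\<close>

definition unitri :: "'k mat \<Rightarrow> bool" where
  "unitri A \<longleftrightarrow> (\<forall>i<N. A $$ (i, i) = 1) \<and>
     (\<forall>i<N. \<forall>j<N. i \<noteq> j \<longrightarrow> A $$ (i, j) \<noteq> 0 \<longrightarrow> ell (b j) < ell (b i))"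

text \<open>Besides comparing coefficients, independence shows that a character with nonzero
  coefficient in \<open>F\<close> belongs to \<open>B\<close>. This is how membership in
  \<open>B\<close> is established for roots that do not generate.\<close>

lemma b_coeff_eq:
  assumes F: "finite F" "F \<subseteq> S"
    and eq: "\<And>x. x \<in> pts X \<Longrightarrow> (\<Sum>m\<in>F. a m * \<chi> m x) = (\<Sum>j<N. c j * \<chi> (b j) x)"
  shows "m \<in> F \<Longrightarrow> a m \<noteq> 0 \<Longrightarrow> m \<in> B" "j < N \<Longrightarrow> c j = (if b j \<in> F then a (b j) else 0)"
proof -
  have s: "(\<Sum>j<N. c j * \<chi> (b j) x) = (\<Sum>m\<in>B. c (idx m) * \<chi> m x)" for x
    using sum_b[of "\<lambda>m. c (idx m) * \<chi> m x"] by (simp add: idx_b)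
  have *: "(if m \<in> F then a m else 0) = (if m \<in> B then c (idx m) else 0)" for m
    by (rule chi_coeff_eq[OF F fin_B B_S]) (use eq s in simp)
  show "m \<in> B" if "m \<in> F" "a m \<noteq> 0" using *[of m] that by (auto split: if_splits)
  show "c j = (if b j \<in> F then a (b j) else 0)" if "j < N"
    using *[of "b j"] that by (simp add: idx_b b_B)
qed

lemma b_coeff_unique:
  assumes "\<And>x. x \<in> pts X \<Longrightarrow> (\<Sum>j<N. a j * \<chi> (b j) x) = (\<Sum>j<N. c j * \<chi> (b j) x)" "j < N"
  shows "c j = a j"
proof -
  have s: "(\<Sum>j<N. a j * \<chi> (b j) x) = (\<Sum>m\<in>B. a (idx m) * \<chi> m x)" for x
    using sum_b[of "\<lambda>m. a (idx m) * \<chi> m x"] by (simp add: idx_b)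
  have "c j = (if b j \<in> B then a (idx (b j)) else 0)"
    by (rule b_coeff_eq(2)[OF fin_B B_S _ assms(2), of "\<lambda>m. a (idx m)"]) (use assms(1) s in simp)
  then show ?thesis using assms(2) by (simp add: b_B idx_b)
qed

lemma is_rep_unique:
  assumes "is_rep A g" "is_rep A' g"
  shows "A = A'"
proof (rule eq_matI)
  fix i j assume ij: "i < dim_row A'" "j < dim_col A'"
  then have "i < N" "j < N" using assms by (auto simp: is_rep_def)
  then show "A $$ (i, j) = A' $$ (i, j)"
    using b_coeff_unique[of "\<lambda>j. A' $$ (i, j)" "\<lambda>j. A $$ (i, j)" j] assms
    by (simp add: is_rep_def)
qed (use assms in \<open>auto simp: is_rep_def\<close>)

lemma mult_entry:
  assumes "A \<in> carrier_mat N N" "A' \<in> carrier_mat N N" "i < N" "j < N"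
  shows "(A * A') $$ (i, j) = (\<Sum>k<N. A $$ (i, k) * A' $$ (k, j))"
  using assms by (simp add: scalar_prod_def atLeast0LessThan)

lemma is_rep_mult:
  assumes A: "is_rep A g" "is_rep A' h" and g: "g \<in> carrier (Aut X)" "h \<in> carrier (Aut X)"
  shows "is_rep (A * A') (g \<cdot> h)"
  unfolding is_rep_def
proof (intro conjI allI impI ballI)
  have C: "A \<in> carrier_mat N N" "A' \<in> carrier_mat N N" using A by (auto simp: is_rep_def)
  then show "A * A' \<in> carrier_mat N N" by simp
  fix i x assume i: "i < N" and x: "x \<in> pts X"
  have "\<chi> (b i) ((g \<cdot> h) x) = (\<Sum>k<N. A $$ (i, k) * \<chi> (b k) (h x))"
    using A(1) i x g Aut_in[OF g(2) x] by (simp add: is_rep_def Aut_mult_apply)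
  also have "\<dots> = (\<Sum>k<N. \<Sum>j<N. A $$ (i, k) * (A' $$ (k, j) * \<chi> (b j) x))"
    using A(2) x by (simp add: is_rep_def sum_distrib_left)
  also have "\<dots> = (\<Sum>j<N. \<Sum>k<N. A $$ (i, k) * (A' $$ (k, j) * \<chi> (b j) x))"
    by (rule sum.swap)
  also have "\<dots> = (\<Sum>j<N. (A * A') $$ (i, j) * \<chi> (b j) x)"
    by (rule sum.cong) (auto simp: mult_entry[OF C i] sum_distrib_right mult.assoc)
  finally show "\<chi> (b i) ((g \<cdot> h) x) = (\<Sum>j<N. (A * A') $$ (i, j) * \<chi> (b j) x)" .
qed

lemma unitri_mult:
  assumes A: "A \<in> carrier_mat N N" "A' \<in> carrier_mat N N" and u: "unitri A" "unitri A'"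
  shows "unitri (A * A')"
proof -
  have tri: "i = k \<or> ell (b k) < ell (b i)" if "i < N" "k < N" "A $$ (i, k) \<noteq> 0" for i k
    using u(1) that by (auto simp: unitri_def)
  have tri': "i = k \<or> ell (b k) < ell (b i)" if "i < N" "k < N" "A' $$ (i, k) \<noteq> 0" for i k
    using u(2) that by (auto simp: unitri_def)
  show ?thesis
    unfolding unitri_def
  proof (intro conjI allI impI)
  fix i assume i: "i < N"
  have "(A * A') $$ (i, i) = (\<Sum>k<N. if k = i then 1 else 0)"
    unfolding mult_entry[OF A i i]
  proof (rule sum.cong)
    fix k assume k: "k \<in> {..<N}"
    show "A $$ (i, k) * A' $$ (k, i) = (if k = i then 1 else 0)"
    proof (cases "k = i")
      case True
      then show ?thesis using u i by (simp add: unitri_def)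
    next
      case False
      then show ?thesis using tri[of i k] tri'[of k i] i k by fastforce
    qed
  qed simp
  then show "(A * A') $$ (i, i) = 1" using i by simp
next
  fix i j assume i: "i < N" and j: "j < N" and ij: "i \<noteq> j" and "(A * A') $$ (i, j) \<noteq> 0"
  then have "(\<Sum>k<N. A $$ (i, k) * A' $$ (k, j)) \<noteq> 0"
    by (simp add: mult_entry[OF A i j])
  then obtain k where "k \<in> {..<N}" "A $$ (i, k) * A' $$ (k, j) \<noteq> 0"
    by (rule sum.not_neutral_contains_not_neutral)
  then have "k < N" "A $$ (i, k) \<noteq> 0" "A' $$ (k, j) \<noteq> 0" by auto
  then show "ell (b j) < ell (b i)" using tri[OF i, of k] tri'[OF _ j, of k] ij by auto
  qed
qed

lemma is_rep_inj:
  assumes A: "is_rep A g" "is_rep A h" and g: "g \<in> carrier (Aut X)" "h \<in> carrier (Aut X)"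
  shows "g = h"
proof (rule Aut_eqI[OF g])
  fix x assume x: "x \<in> pts X"
  show "g x = h x"
  proof (rule coords_separate)
    show gx: "g x \<in> pts X" "h x \<in> pts X" using g x by (auto intro: Aut_in)
    have eq: "\<chi> m (g x) = \<chi> m (h x)" if "m \<in> B" for m
    proof -
      have "\<chi> (b (idx m)) (g x) = \<chi> (b (idx m)) (h x)"
        using A x idx(1)[OF that] by (simp add: is_rep_def)
      then show ?thesis by (simp add: idx(2)[OF that])
    qed
    fix f assume "f \<in> coords X"
    then obtain a where "\<And>x. x \<in> pts X \<Longrightarrow> f x = (\<Sum>m\<in>F0. a m * \<chi> m x)" using coords_span by blast
    then show "f (g x) = f (h x)"
      using gx eq F0_B by (simp add: subset_iff)
  qed
qed

text \<open>For a root at most one \<open>k\<close> contributes, since \<open>r d = -1\<close> makes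
  the string injective. The sum avoids choosing it and exhibits each entry as a polynomial in
  \<open>c\<close>.\<close>

definition SM :: "('m \<Rightarrow> int) \<Rightarrow> 'm \<Rightarrow> 'k \<Rightarrow> 'k mat" where
  "SM r d c = mat N N (\<lambda>(i, j). \<Sum>k\<in>{k \<in> {..nat (r (b i))}. plus_mult (b i) d k = b j}.
     of_nat (nat (r (b i)) choose k) * c ^ k)"

lemma SM_carrier: "SM r d c \<in> carrier_mat N N"
  by (simp add: SM_def)

lemma plus_mult_B:
  assumes r: "root r d" and cl: "\<And>m. m \<in> B \<Longrightarrow> 0 < r m \<Longrightarrow> m + d \<in> B"
    and m: "m \<in> B" and k: "k \<le> nat (r m)"
  shows "plus_mult m d k \<in> B"
  using k
proof (induction k)
  case (Suc k)
  have "m \<in> M" using m B_S S_M by blast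
  then have "r (plus_mult m d k) = r m - int k"
    using additive_plus_mult[OF rootD(1)[OF r] _ rootD(2)[OF r]] rootD(3)[OF r] by simp
  then show ?case using Suc cl by simp
qed (use m in simp)

lemma rep_shear:
  assumes r: "root r d" and g: "shear r (\<lambda>x. c * ch d x) g"
    and cl: "\<And>m. m \<in> B \<Longrightarrow> 0 < r m \<Longrightarrow> m + d \<in> B"
  shows "is_rep (SM r d c) g"
  unfolding is_rep_def
proof (intro conjI allI impI ballI SM_carrier)
  fix i x assume i: "i < N" and x: "x \<in> pts X"
  let ?K = "{..nat (r (b i))}" and ?t = "\<lambda>k. of_nat (nat (r (b i)) choose k) * c ^ k"
  have "(\<Sum>j<N. SM r d c $$ (i, j) * \<chi> (b j) x) =
      (\<Sum>j<N. \<Sum>k\<in>{k \<in> ?K. plus_mult (b i) d k = b j}. ?t k * \<chi> (plus_mult (b i) d k) x)"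
    by (rule sum.cong) (auto simp: SM_def i sum_distrib_right intro!: sum.cong)
  also have "\<dots> = (\<Sum>m\<in>B. \<Sum>k\<in>{k \<in> ?K. plus_mult (b i) d k = m}. ?t k * \<chi> (plus_mult (b i) d k) x)"
    by (rule sum_b)
  also have "\<dots> = (\<Sum>k\<in>?K. ?t k * \<chi> (plus_mult (b i) d k) x)"
    by (rule sum.group) (use fin_B plus_mult_B[OF r cl b_B[OF i]] in auto)
  also have "\<dots> = \<chi> (b i) (g x)"
    using shear_expand[OF r g b_S[OF i] x] by simp
  finally show "\<chi> (b i) (g x) = (\<Sum>j<N. SM r d c $$ (i, j) * \<chi> (b j) x)" by simp
qed

lemma unitri_SM:
  assumes r: "root r d" and d: "ell d < 0"
  shows "unitri (SM r d c)"
  unfolding unitri_def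
proof (intro conjI allI impI)
  fix i assume i: "i < N"
  then have m: "b i \<in> M" using b_S S_M by blast
  have "{k \<in> {..nat (r (b i))}. plus_mult (b i) d k = b i} = {0}"
    using plus_mult_inj[OF r m, of _ 0] by auto
  then show "SM r d c $$ (i, i) = 1" using i by (simp add: SM_def)
next
  fix i j assume i: "i < N" and j: "j < N" and ne: "i \<noteq> j" and nz: "SM r d c $$ (i, j) \<noteq> 0"
  then have m: "b i \<in> M" using b_S S_M by blast
  have "{k \<in> {..nat (r (b i))}. plus_mult (b i) d k = b j} \<noteq> {}"
  proof
    assume "{k \<in> {..nat (r (b i))}. plus_mult (b i) d k = b j} = {}"
    then have "SM r d c $$ (i, j) = 0" using i j by (simp only: SM_def index_mat prod.case sum.empty)
    then show False using nz by simp
  qed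
  then obtain k where k: "plus_mult (b i) d k = b j" by blast
  then have "k \<noteq> 0" using ne b_inj i j by (cases k) auto
  have "ell (plus_mult (b i) d l) = ell (b i) + int l * ell d" for l
    by (induction l) (auto simp: ell_add plus_mult_M m rootD(2)[OF r] algebra_simps)
  from this[of k] show "ell (b j) < ell (b i)"
    using k d \<open>k \<noteq> 0\<close> by (simp add: mult_pos_neg)
qed

lemma ex_rep_gen:
  assumes "i \<in> I"
  shows "\<exists>A. is_rep A (u i c) \<and> unitri A"
  using rep_shear[OF roots shears, OF assms assms] B_move[OF _ assms]
    unitri_SM[OF roots ell_root, OF assms assms] by blast

text \<open>Inverses are covered by the case of generators, because the inverse of
  \<open>u i c\<close> is \<open>u i (- c)\<close>.\<close>

lemma G_induct [consumes 1, case_names one gen mult]: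
  assumes "g \<in> G" and one: "P \<one>\<^bsub>Aut X\<^esub>" and gen: "\<And>i c. i \<in> I \<Longrightarrow> P (u i c)"
    and mult: "\<And>g h. g \<in> G \<Longrightarrow> h \<in> G \<Longrightarrow> P g \<Longrightarrow> P h \<Longrightarrow> P (g \<cdot> h)"
  shows "P g"
proof -
  have "g \<in> generate (Aut X) (\<Union>i\<in>I. range (u i))" using assms(1) G_def by simp
  then show ?thesis
  proof induction
    case (eng g h)
    then show ?case using mult G_def by simp
  qed (use one gen u_inv in auto)
qed

lemma ex_rep:
  assumes "g \<in> G"
  shows "\<exists>A. is_rep A g \<and> unitri A"
  using assms
proof (induction rule: G_induct)
  case one
  have "is_rep (1\<^sub>m N) \<one>\<^bsub>Aut X\<^esub>"
    by (auto simp: is_rep_def Aut_one_apply if_distrib[of "\<lambda>c. c * _"] cong: if_cong)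
  moreover have "unitri (1\<^sub>m N)" by (auto simp: unitri_def)
  ultimately show ?case by blast
next
  case (gen i c)
  then show ?case by (rule ex_rep_gen)
next
  case (mult g h)
  then obtain A A' where A: "is_rep A g" "unitri A" "is_rep A' h" "unitri A'" by blast
  have "is_rep (A * A') (g \<cdot> h)" 
    by (rule is_rep_mult[OF A(1,3) G_Aut G_Aut]) (use mult in auto)
  moreover have "unitri (A * A')"
    by (rule unitri_mult[OF _ _ A(2,4)]) (use A(1,3) in \<open>simp_all add: is_rep_def\<close>)
  ultimately show ?case by blast
qed

definition R :: "('p \<Rightarrow> 'p) \<Rightarrow> 'k mat" where
  "R g = (THE A. is_rep A g)"

lemma R_eq: "is_rep A g \<Longrightarrow> R g = A"
  unfolding R_def using is_rep_unique by blast

lemma R_rep: "g \<in> G \<Longrightarrow> is_rep (R g) g"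
  using ex_rep R_eq by metis

lemma R_unitri: "g \<in> G \<Longrightarrow> unitri (R g)"
  using ex_rep R_eq by metis

lemma R_carrier: "g \<in> G \<Longrightarrow> R g \<in> carrier_mat N N"
  using R_rep by (simp add: is_rep_def)

lemma R_mult: "g \<in> G \<Longrightarrow> h \<in> G \<Longrightarrow> R (g \<cdot> h) = R g * R h"
  by (intro R_eq is_rep_mult R_rep G_Aut)

lemma R_one: "R \<one>\<^bsub>Aut X\<^esub> = 1\<^sub>m N"
  by (rule R_eq) (auto simp: is_rep_def Aut_one_apply if_distrib[of "\<lambda>c. c * _"] cong: if_cong)

lemma R_inj: "inj_on R G"
  by (rule inj_onI) (metis R_rep is_rep_inj G_Aut)

text \<open>By construction \<open>B\<close> is closed only under generating roots. But all of
  \<open>G\<close> preserves the span of \<open>B\<close>, and for the shear with parameter 1 the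
  coefficient at \<open>m + d\<close> is \<open>r m\<close>, which is nonzero in characteristic
  zero; independence places \<open>m + d\<close> in \<open>B\<close>.\<close>

lemma B_root:
  assumes h: "has_root G r d" and m: "m \<in> B" and pos: "0 < r m"
  shows "m + d \<in> B"
proof -
  note r = has_rootD[OF h]
  have mS: "m \<in> S" "m \<in> M" using m B_S S_M by auto
  obtain g where g: "g \<in> G" "shear r (\<lambda>x. 1 * ch d x) g" using h unfolding has_root_def by blast
  let ?F = "plus_mult m d ` {..nat (r m)}"
  have inj: "inj_on (plus_mult m d) {..nat (r m)}"
    using plus_mult_inj[OF r mS(2)] by (auto simp: inj_on_def)
  \<comment> \<open>Because \<open>r d = -1\<close>, the number of steps from \<open>m\<close> to
    \<open>m'\<close> is \<open>r m - r m'\<close>; this expresses the binomial coefficient through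
    the exponent itself.\<close>
  let ?a = "\<lambda>m'. of_nat (nat (r m) choose (nat (r m - r m'))) :: 'k"
  have rk: "r m - r (plus_mult m d k) = int k" for k
    using additive_plus_mult[OF rootD(1)[OF r] mS(2) rootD(2)[OF r]] rootD(3)[OF r] by simp
  have "(\<Sum>m'\<in>?F. ?a m' * \<chi> m' x) = (\<Sum>j<N. R g $$ (idx m, j) * \<chi> (b j) x)" if x: "x \<in> pts X" for x
  proof -
    have "(\<Sum>m'\<in>?F. ?a m' * \<chi> m' x) = \<chi> m (g x)"
      using shear_expand[OF r g(2) mS(1) x] by (simp add: sum.reindex[OF inj] rk)
    also have "\<dots> = (\<Sum>j<N. R g $$ (idx m, j) * \<chi> (b j) x)"
      using R_rep[OF g(1)] idx[OF m] x by (auto simp: is_rep_def)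
    finally show ?thesis .
  qed
  note eq = this
  have "plus_mult m d 1 \<in> B"
  proof (rule b_coeff_eq(1)[OF _ _ eq])
    show "?F \<subseteq> S" using plus_mult_S[OF r mS(1)] by auto
    show "plus_mult m d 1 \<in> ?F" using pos by (intro imageI) simp
    show "?a (plus_mult m d 1) \<noteq> 0" unfolding rk using pos by simp
  qed auto
  then show ?thesis by simp
qed

lemma R_shear:
  assumes "has_root G r d" "shear r (\<lambda>x. c * ch d x) g"
  shows "R g = SM r d c"
  by (rule R_eq, rule rep_shear[OF has_rootD[OF assms(1)] assms(2)]) (rule B_root[OF assms(1)])

section \<open>The roots in \<open>G\<close> and the normal form\<close>

definition RG :: "(('m \<Rightarrow> int) \<times> 'm) set" where
  "RG = {(r, d). r \<in> Rays \<and> has_root G r d}"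

lemma dual_root: "(r, d) \<in> RG \<Longrightarrow> dual r + d \<in> B"
  using B_root[of r d "dual r"] dual_B[of r] dual(2)[of r] by (simp add: RG_def)

text \<open>The pair \<open>(r, d)\<close> is recovered from \<open>r\<close> and
  \<open>dual r + d\<close>, which range over finite sets.\<close>

lemma fin_RG: "finite RG"
proof (rule finite_subset)
  show "RG \<subseteq> (\<lambda>(r, m). (r, m - dual r)) ` (Rays \<times> B)"
  proof
    fix p assume p: "p \<in> RG"
    obtain r d where rd: "p = (r, d)" by fastforce
    then have "dual r + d \<in> B" "r \<in> Rays" using p dual_root by (auto simp: RG_def)
    then show "p \<in> (\<lambda>(r, m). (r, m - dual r)) ` (Rays \<times> B)"
      unfolding rd by (intro image_eqI[of _ _ "(r, dual r + d)"]) auto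
  qed
  show "finite ((\<lambda>(r, m). (r, m - dual r)) ` (Rays \<times> B))" using fin_Rays fin_B by simp
qed

definition E :: "('m \<Rightarrow> int) \<Rightarrow> 'm set" where
  "E r = {d. (r, d) \<in> RG}"

lemma E_D: "d \<in> E r \<Longrightarrow> r \<in> Rays" "d \<in> E r \<Longrightarrow> has_root G r d"
  by (auto simp: E_def RG_def)

lemma E_root: "d \<in> E r \<Longrightarrow> root r d"
  using E_D has_rootD by blast

lemma fin_E: "finite (E r)"
proof -
  have "E r \<subseteq> snd ` RG" by (force simp: E_def)
  then show ?thesis using fin_RG finite_surj by blast
qed

lemma E_M: "E r \<subseteq> M"
  using rootD(2)[OF E_root] by blast

definition SpanE :: "('m \<Rightarrow> int) \<Rightarrow> ('p \<Rightarrow> 'k) set" where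
  "SpanE r = {f. \<exists>c. \<forall>x\<in>Xo. f x = (\<Sum>d\<in>E r. c d * ch d x)}"

lemma SpanE_Wt:
  assumes "f \<in> SpanE r"
  shows "f \<in> Wt r"
proof -
  obtain c where "\<forall>x\<in>Xo. f x = (\<Sum>d\<in>E r. c d * ch d x)"
    using assms unfolding SpanE_def by blast
  then show ?thesis
    unfolding Wt_def mem_Collect_eq
    by (intro exI[of _ "E r"] exI[of _ c] conjI ballI)
      (simp_all add: fin_E E_M rootD(3)[OF E_root])
qed

lemma SpanE_zero: "(\<lambda>_. 0) \<in> SpanE r"
  unfolding SpanE_def by (auto intro!: exI[of _ "\<lambda>_. 0"])

lemma SpanE_add:
  assumes "f \<in> SpanE r" "g \<in> SpanE r"
  shows "(\<lambda>x. f x + g x) \<in> SpanE r"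
proof -
  obtain c where c: "\<And>x. x \<in> Xo \<Longrightarrow> f x = (\<Sum>d\<in>E r. c d * ch d x)"
    using assms(1) unfolding SpanE_def by blast
  obtain c' where c': "\<And>x. x \<in> Xo \<Longrightarrow> g x = (\<Sum>d\<in>E r. c' d * ch d x)"
    using assms(2) unfolding SpanE_def by blast
  show ?thesis
    unfolding SpanE_def mem_Collect_eq
    by (rule exI[of _ "\<lambda>d. c d + c' d"]) (simp add: c c' distrib_right sum.distrib)
qed

lemma SpanE_sum: "(\<And>i. i \<in> J \<Longrightarrow> f i \<in> SpanE r) \<Longrightarrow> (\<lambda>x. \<Sum>i\<in>J. f i x) \<in> SpanE r"
  by (induction J rule: infinite_finite_induct) (auto intro: SpanE_add SpanE_zero)

lemma SpanE_ch: "d \<in> E r \<Longrightarrow> (\<lambda>x. t * ch d x) \<in> SpanE r"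
  unfolding SpanE_def mem_Collect_eq
  by (rule exI[of _ "\<lambda>d'. if d' = d then t else 0"])
    (simp add: fin_E if_distrib[of "\<lambda>c. c * _"] cong: if_cong)

definition normal_form :: "('p \<Rightarrow> 'p) \<Rightarrow> bool" where
  "normal_form g \<longleftrightarrow> (\<exists>F. form Rays (\<lambda>r x. 1 + F r x) g \<and> (\<forall>r\<in>Rays. F r \<in> SpanE r))"

lemma prod_single_powi:
  assumes "finite Q" "s \<in> Q"
  shows "(\<Prod>r\<in>Q. (if r = s then z else 1) powi r d) = (z :: 'k) powi s d"
proof -
  have "(\<Prod>r\<in>Q. (if r = s then z else 1) powi r d) = (\<Prod>r\<in>Q. if r = s then z powi r d else 1)"
    by (rule prod.cong) auto
  then show ?thesis using assms by simp
qed

text \<open>Precomposition with \<open>u i t\<close> multiplies \<open>ch d\<close> by a power of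
  \<open>1 + t ch (e i)\<close>. For \<open>r = \<rho> i\<close> this cancels as in
  \<open>shear_add\<close>. For other \<open>r\<close> it expands into a string in direction
  \<open>e i\<close>, which stays among the roots in \<open>G\<close> by
  \<open>has_root_string\<close>.\<close>

lemma normal_form_mult_gen:
  assumes i: "i \<in> I" and g: "normal_form g"
  shows "normal_form (g \<cdot> u i t)"
proof -
  obtain F where F: "form Rays (\<lambda>r x. 1 + F r x) g" "\<And>r. r \<in> Rays \<Longrightarrow> F r \<in> SpanE r"
    using g unfolding normal_form_def by blast
  have "\<forall>r\<in>Rays. \<exists>c. \<forall>x\<in>Xo. F r x = (\<Sum>d\<in>E r. c d * ch d x)"
    using F(2) unfolding SpanE_def by blast
  then obtain c where "\<forall>r\<in>Rays. \<forall>x\<in>Xo. F r x = (\<Sum>d\<in>E r. c r d * ch d x)"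
    by (drule_tac bchoice) (elim exE, rule that)
  then have c: "\<And>r x. r \<in> Rays \<Longrightarrow> x \<in> Xo \<Longrightarrow> F r x = (\<Sum>d\<in>E r. c r d * ch d x)" by blast
  note D = rootD[OF roots[OF i]]
  have s: "\<rho> i \<in> Rays" using i by (simp add: Rays_def)
  have eE: "e i \<in> E (\<rho> i)" using s has_root_gen[OF i] by (simp add: E_def RG_def)
  define F' where "F' r x = (if r = \<rho> i then F r x + t * ch (e i) x else
    (\<Sum>d\<in>E r. \<Sum>k\<le>nat (\<rho> i d). (c r d * of_nat (nat (\<rho> i d) choose k) * t ^ k) *
      ch (plus_mult d (e i) k) x))" for r x
  have F'E: "F' r \<in> SpanE r" if r: "r \<in> Rays" for r
  proof (cases "r = \<rho> i")
    case True
    then have "F' r = (\<lambda>x. F r x + t * ch (e i) x)" by (auto simp: F'_def)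
    then show ?thesis using SpanE_add[OF F(2)[OF r] SpanE_ch[of "e i" r t]] eE True by simp
  next
    case False
    have str: "plus_mult d (e i) k \<in> E r" if d: "d \<in> E r" and k: "k \<le> nat (\<rho> i d)" for d k
    proof (cases "k = 0")
      case True
      then show ?thesis using d by simp
    next
      case k0: False
      then have pos: "0 < \<rho> i d" using k by simp
      \<comment> \<open>A string of positive length means \<open>\<rho> i d > 0\<close>; then
        \<open>r (e i) > 0\<close> would give a two-cycle.\<close>
      have "r (e i) = 0"
        using no_two_cycle[OF has_root_gen[OF i] E_D(2)[OF d]] pos
          Rays_nonneg[OF r has_root_gen[OF i] False] by force
      from has_root_string[OF G_subgroup has_root_gen[OF i] E_D(2)[OF d] this, of k]
      show ?thesis using k pos r by (simp add: E_def RG_def)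
    qed
    have "F' r = (\<lambda>x. \<Sum>d\<in>E r. \<Sum>k\<le>nat (\<rho> i d).
      (c r d * of_nat (nat (\<rho> i d) choose k) * t ^ k) * ch (plus_mult d (e i) k) x)"
      using False by (auto simp: F'_def)
    moreover have "\<dots> \<in> SpanE r"
      by (rule SpanE_sum, rule SpanE_sum, rule SpanE_ch) (use str in auto)
    ultimately show ?thesis by simp
  qed
  let ?w = "\<lambda>r x. if r = \<rho> i then 1 + t * ch (e i) x else 1"
  have uf: "form Rays ?w (u i t)"
    using shears[OF i, of t] by (simp add: shear_form[OF fin_Rays s, symmetric])
  have "form Rays (\<lambda>r x. 1 + F' r x) (g \<cdot> u i t)"
  proof (rule form_comp[OF rays_Rays F(1) uf])
    fix r assume r: "r \<in> Rays"
    show "Lau (?w r)"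
      by (cases "r = \<rho> i") (auto intro!: Lau_add Lau_mult Lau_ch D)
    show "\<exists>x\<in>Xo. ?w r x \<noteq> 0"
      using Wt_one_plus[OF D(1) Wt_ch[where \<rho> = "\<rho> i" and c = t, OF D(2,3)]] base_Xo by auto
    show "Lau (\<lambda>x. 1 + F' r x)"
      by (rule Lau_add[OF Lau_const Wt_Lau[OF SpanE_Wt[OF F'E[OF r]]]])
  next
    fix x r assume x: "x \<in> Xo" "u i t x \<in> Xo" and nz: "\<And>r. r \<in> Rays \<Longrightarrow> ?w r x \<noteq> 0" and r: "r \<in> Rays"
      and ch0: "\<And>d. d \<in> M \<Longrightarrow> ch d (u i t x) = ch d x * (\<Prod>r\<in>Rays. ?w r x powi r d)"
    have ch: "ch d (u i t x) = ch d x * (1 + t * ch (e i) x) powi \<rho> i d" if "d \<in> M" for d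
      using ch0[OF that] prod_single_powi[OF fin_Rays s, of "1 + t * ch (e i) x" d] by simp
    have nz': "1 + t * ch (e i) x \<noteq> 0" using nz[OF s] by simp
    show "1 + F' r x = ?w r x * (1 + F r (u i t x))"
    proof (cases "r = \<rho> i")
      case True
      have "F r (u i t x) = F r x * inverse (1 + t * ch (e i) x)"
        by (rule Wt_scale[OF SpanE_Wt[OF F(2)[OF r]] x]) (simp add: ch True power_int_minus)
      then show ?thesis using nz' True by (simp add: F'_def distrib_left)
    next
      case False
      have "F r (u i t x) = (\<Sum>d\<in>E r. c r d * ch d (u i t x))" using c[OF r x(2)] .
      also have "\<dots> = F' r x"
        unfolding F'_def if_not_P[OF False]
      proof (rule sum.cong)
        fix d assume d: "d \<in> E r"
        then have dM: "d \<in> M" using E_M by blast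
        define n where "n = nat (\<rho> i d)"
        have n: "\<rho> i d = int n"
          using Rays_nonneg[OF s E_D(2)[OF d]] False by (simp add: n_def)
        have "ch d (u i t x) = ch d x * (t * ch (e i) x + 1) ^ n"
          using ch[OF dM] n by (simp add: add.commute)
        also have "\<dots> = (\<Sum>k\<le>n. of_nat (n choose k) * t ^ k * (ch d x * ch (e i) x ^ k))"
          by (simp add: binomial_ring power_mult_distrib sum_distrib_left mult_ac)
        finally show "c r d * ch d (u i t x) = (\<Sum>k\<le>nat (\<rho> i d).
            (c r d * of_nat (nat (\<rho> i d) choose k) * t ^ k) * ch (plus_mult d (e i) k) x)"
          by (simp add: n_def[symmetric] sum_distrib_left ch_plus_mult dM D x mult_ac)
      qed simp
      finally show ?thesis using False by simp
    qed
  qed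
  then show ?thesis unfolding normal_form_def using F'E by blast
qed

lemma normal_form_one: "normal_form \<one>\<^bsub>Aut X\<^esub>"
  unfolding normal_form_def
  by (rule exI[of _ "\<lambda>_ _. 0"]) (use form_one[of Rays] SpanE_zero in simp)

text \<open>The induction runs over the right factor with \<open>g\<close> arbitrary, since normal
  forms are updated by generators on the right.\<close>

lemma normal_form_mult:
  assumes "h \<in> G" "g \<in> G" "normal_form g"
  shows "normal_form (g \<cdot> h)"
  using assms
proof (induction arbitrary: g rule: G_induct)
  case one
  then show ?case using G_Aut by simp
next
  case (gen i c)
  then show ?case by (intro normal_form_mult_gen)
next
  case (mult h h')
  then have "normal_form ((g \<cdot> h) \<cdot> h')" using G_mult by blast
  then show ?case using Aut.m_assoc[of g h h'] mult G_Aut by simp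
qed

lemma G_normal_form: "g \<in> G \<Longrightarrow> normal_form g"
  using normal_form_mult[OF _ G_one normal_form_one, of g] G_Aut[of g] by simp

text \<open>At \<open>dual r\<close> the functional \<open>r\<close> takes the value 1 and all
  others vanish, so \<open>g\<close> multiplies its weight function by exactly
  \<open>1 + F r\<close>. As roots are nonzero, the characters \<open>dual r + d\<close> differ from
  \<open>dual r\<close>, and coefficients can be compared.\<close>

lemma dual_coeff:
  assumes g: "g \<in> G" and f: "form Rays (\<lambda>r x. 1 + F r x) g"
    and r: "r \<in> Rays" and F: "\<And>x. x \<in> Xo \<Longrightarrow> F r x = (\<Sum>d\<in>E r. c d * ch d x)" and d: "d \<in> E r"
  shows "R g $$ (idx (dual r), idx (dual r + d)) = c d"
proof -
  let ?v = "dual r"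
  define K where "K = insert ?v ((+) ?v ` E r)"
  define a where "a m = (if m = ?v then 1 else c (m - ?v))" for m
  have vS: "?v \<in> S" using dual r by blast
  have vd: "?v + d' \<in> B" if "d' \<in> E r" for d' using dual_root that by (simp add: E_def)
  have K: "finite K" "K \<subseteq> S" using vS vd B_S fin_E by (auto simp: K_def)
  have nz: "d' \<noteq> 0" if "d' \<in> E r" for d'
    using rootD(3)[OF E_root[OF that]] additive_zero[OF Rays_additive[OF r]] by auto
  have val: "\<chi> ?v (g x) - (\<Sum>m\<in>K. a m * \<chi> m x) = 0" if "x \<in> pts X" for x
  proof (rule dense_Xo[OF _ _ that])
    show "regular X (\<lambda>x. \<chi> ?v (g x) - (\<Sum>m\<in>K. a m * \<chi> m x))"
      using Aut_regular[OF G_Aut[OF g] chi_regular[OF vS]] K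
      by (intro regular_diff regular_sum regular_mult regular_const chi_regular) auto
    fix x assume x: "x \<in> Xo"
    have "(\<Prod>s\<in>Rays. (1 + F s x) ^ nat (s ?v)) = (\<Prod>s\<in>Rays. if s = r then 1 + F r x else 1)"
    proof (rule prod.cong)
      fix s assume "s \<in> Rays"
      then show "(1 + F s x) ^ nat (s ?v) = (if s = r then 1 + F r x else 1)"
        using dual(2)[OF r] dual(3)[OF r, of s] by (cases "s = r") simp_all
    qed simp
    then have "\<chi> ?v (g x) = \<chi> ?v x * (1 + F r x)"
      using f x vS r fin_Rays by (simp add: form_def)
    also have "\<dots> = \<chi> ?v x + (\<Sum>d\<in>E r. c d * (\<chi> ?v x * ch d x))"
      by (simp add: F[OF x] distrib_left sum_distrib_left mult_ac)
    also have "(\<Sum>d\<in>E r. c d * (\<chi> ?v x * ch d x)) = (\<Sum>d\<in>E r. c d * \<chi> (?v + d) x)"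
    proof (rule sum.cong)
      fix d' assume d': "d' \<in> E r"
      have "?v + d' \<in> S" using vd[OF d'] B_S by blast
      then have "\<chi> (?v + d') x = \<chi> ?v x * ch d' x"
        using ch_add[OF S_M[OF vS] _ x, of d'] E_M d' ch_S x vS by auto
      then show "c d' * (\<chi> ?v x * ch d' x) = c d' * \<chi> (?v + d') x" by simp
    qed simp
    also have "(\<Sum>d\<in>E r. c d * \<chi> (?v + d) x) = (\<Sum>m\<in>(+) ?v ` E r. a m * \<chi> m x)"
      by (subst sum.reindex) (auto simp: a_def nz intro!: sum.cong)
    also have "\<chi> ?v x + \<dots> = (\<Sum>m\<in>K. a m * \<chi> m x)"
      unfolding K_def using nz fin_E by (subst sum.insert) (auto simp: a_def)
    finally show "\<chi> ?v (g x) - (\<Sum>m\<in>K. a m * \<chi> m x) = 0" by simp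
  qed
  have vB: "?v \<in> B" using dual_B r by blast
  have eq: "(\<Sum>m\<in>K. a m * \<chi> m x) = (\<Sum>j<N. R g $$ (idx ?v, j) * \<chi> (b j) x)" if "x \<in> pts X" for x
  proof -
    have "\<chi> (b (idx ?v)) (g x) = (\<Sum>j<N. R g $$ (idx ?v, j) * \<chi> (b j) x)"
      using R_rep[OF g] idx(1)[OF vB] that by (simp add: is_rep_def)
    then show ?thesis using val[OF that] by (simp add: idx(2)[OF vB])
  qed
  have "R g $$ (idx ?v, idx (?v + d)) = (if b (idx (?v + d)) \<in> K then a (b (idx (?v + d))) else 0)"
    by (rule b_coeff_eq(2)[OF K eq]) (use idx vd d in auto)
  then show ?thesis using idx[OF vd[OF d]] d nz[OF d] by (simp add: K_def a_def)
qed

section \<open>Ordered products of root elements\<close>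

definition U :: "('m \<Rightarrow> int) \<times> 'm \<Rightarrow> 'k \<Rightarrow> 'p \<Rightarrow> 'p" where
  "U p c = (SOME g. g \<in> G \<and> shear (fst p) (\<lambda>x. c * ch (snd p) x) g)"

lemma U:
  assumes "p \<in> RG"
  shows "U p c \<in> G" "shear (fst p) (\<lambda>x. c * ch (snd p) x) (U p c)"
proof -
  have "\<exists>g. g \<in> G \<and> shear (fst p) (\<lambda>x. c * ch (snd p) x) g"
    using assms unfolding RG_def has_root_def Bex_def by (cases p) simp
  from someI_ex[OF this]
  show "U p c \<in> G" "shear (fst p) (\<lambda>x. c * ch (snd p) x) (U p c)" unfolding U_def by auto
qed

definition W :: "(('m \<Rightarrow> int) \<times> 'm) list \<Rightarrow> (('m \<Rightarrow> int) \<times> 'm \<Rightarrow> 'k) \<Rightarrow> 'p \<Rightarrow> 'p" where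
  "W L c = foldr (\<lambda>p g. U p (c p) \<cdot> g) L \<one>\<^bsub>Aut X\<^esub>"

definition PM :: "(('m \<Rightarrow> int) \<times> 'm) list \<Rightarrow> (('m \<Rightarrow> int) \<times> 'm \<Rightarrow> 'k) \<Rightarrow> 'k mat" where
  "PM L c = foldr (\<lambda>p A. SM (fst p) (snd p) (c p) * A) L (1\<^sub>m N)"

lemma W_G: "set L \<subseteq> RG \<Longrightarrow> W L c \<in> G"
  by (induction L) (auto simp: W_def G_one G_mult U)

lemma R_W: "set L \<subseteq> RG \<Longrightarrow> R (W L c) = PM L c"
proof (induction L)
  case Nil
  then show ?case by (simp add: W_def PM_def R_one)
next
  case (Cons p L)
  then have p: "p \<in> RG" "set L \<subseteq> RG" by auto
  have "R (U p (c p)) = SM (fst p) (snd p) (c p)"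
    by (rule R_shear[OF _ U(2)[OF p(1)]]) (use p in \<open>auto simp: RG_def\<close>)
  then have "R (U p (c p) \<cdot> W L c) = SM (fst p) (snd p) (c p) * PM L c"
    using R_mult[OF U(1)[OF p(1)] W_G[OF p(2)]] Cons.IH p by simp
  then show ?case by (simp add: W_def PM_def)
qed

definition FL :: "(('m \<Rightarrow> int) \<times> 'm) set \<Rightarrow> (('m \<Rightarrow> int) \<times> 'm \<Rightarrow> 'k) \<Rightarrow> ('m \<Rightarrow> int) \<Rightarrow> 'p \<Rightarrow> 'k" where
  "FL L c r x = (\<Sum>d\<in>{d. (r, d) \<in> L}. c (r, d) * ch d x)"

lemma FL_Wt:
  assumes "L \<subseteq> RG"
  shows "FL L c r \<in> Wt r"
proof -
  have "{d. (r, d) \<in> L} \<subseteq> E r" using assms by (auto simp: E_def)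
  then show ?thesis
    unfolding FL_def using fin_E[of r] E_M[of r] rootD(3)[OF E_root[of _ r]]
    by (intro Wt_I) (auto intro: finite_subset)
qed

text \<open>For a root \<open>(s, d)\<close> in front of \<open>L\<close>, only the factor
  \<open>1 + F\<close> of \<open>s\<close> divides \<open>ch d\<close>, and it cancels:
  \<open>(1 + F) (1 + c ch d / (1 + F)) = 1 + F + c ch d\<close>. Thus each root contributes its own
  parameter without interaction.\<close>

lemma form_W:
  assumes "set L \<subseteq> RG" "distinct L" "sorted_wrt (\<lambda>p q. height (fst p) \<le> height (fst q)) L"
  shows "form Rays (\<lambda>r x. 1 + FL (set L) c r x) (W L c)"
  using assms
proof (induction L)
  case Nil
  then show ?case using form_one[of Rays] by (simp add: W_def FL_def)
next
  case (Cons p L)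
  obtain s d where p: "p = (s, d)" by fastforce
  have sd: "s \<in> Rays" "has_root G s d" "(s, d) \<in> RG" "(s, d) \<notin> set L" "set L \<subseteq> RG"
    using Cons.prems by (auto simp: p RG_def)
  note D = rootD[OF has_rootD[OF sd(2)]]
  let ?c = "c (s, d)"
  have IH: "form Rays (\<lambda>r x. 1 + FL (set L) c r x) (W L c)" using Cons by simp
  have Uf: "form Rays (\<lambda>r x. if r = s then 1 + ?c * ch d x else 1) (U p (c p))"
    using U(2)[OF sd(3), of ?c] by (simp add: p shear_form[OF fin_Rays sd(1), symmetric])
  have FLc: "FL (set (p # L)) c r x = FL (set L) c r x + (if r = s then ?c * ch d x else 0)" for r x
  proof (cases "r = s")
    case True
    have "{d'. (s, d') \<in> set (p # L)} = insert d {d'. (s, d') \<in> set L}" by (auto simp: p)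
    moreover have "finite {d'. (s, d') \<in> set L}"
      by (rule finite_subset[OF _ fin_E[of s]]) (use sd(5) in \<open>auto simp: E_def\<close>)
    ultimately show ?thesis using sd(4) True by (simp add: FL_def add.commute)
  next
    case False
    then have "{d'. (r, d') \<in> set (p # L)} = {d'. (r, d') \<in> set L}" by (auto simp: p)
    then show ?thesis using False by (simp add: FL_def)
  qed
  have "form Rays (\<lambda>r x. 1 + FL (set (p # L)) c r x) (U p (c p) \<cdot> W L c)"
  proof (rule form_comp[OF rays_Rays Uf IH])
    fix r assume r: "r \<in> Rays"
    show "Lau (\<lambda>x. 1 + FL (set L) c r x)"
      by (rule Lau_add[OF Lau_const Wt_Lau[OF FL_Wt[OF sd(5)]]])
    show "Lau (\<lambda>x. 1 + FL (set (p # L)) c r x)"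
      by (rule Lau_add[OF Lau_const Wt_Lau[OF FL_Wt[OF Cons.prems(1)]]])
    show "\<exists>x\<in>Xo. 1 + FL (set L) c r x \<noteq> 0"
      by (rule Wt_one_plus[OF Rays_additive[OF r] FL_Wt[OF sd(5)]])
  next
    fix x r assume x: "x \<in> Xo" and nz: "\<And>r. r \<in> Rays \<Longrightarrow> 1 + FL (set L) c r x \<noteq> 0" and r: "r \<in> Rays"
      and ch0: "\<And>d. d \<in> M \<Longrightarrow> ch d (W L c x) = ch d x * (\<Prod>r\<in>Rays. (1 + FL (set L) c r x) powi r d)"
    have "(\<Prod>r\<in>Rays. (1 + FL (set L) c r x) powi r d) =
        (\<Prod>r\<in>Rays. (if r = s then 1 + FL (set L) c s x else 1) powi r d)"
    proof (rule prod.cong)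
      fix r assume r: "r \<in> Rays"
      show "(1 + FL (set L) c r x) powi r d = (if r = s then 1 + FL (set L) c s x else 1) powi r d"
      proof (cases "r = s \<or> {d. (r, d) \<in> set L} = {}")
        case True
        then show ?thesis by (auto simp: FL_def)
      next
        case False
        then obtain d' where d': "(r, d') \<in> set L" "r \<noteq> s" by blast
        \<comment> \<open>A functional occurring later has at least the height of \<open>s\<close>,
          so there is no arrow from \<open>s\<close> to it, and it vanishes on
          \<open>d\<close>.\<close>
        then have "height s \<le> height r" using Cons.prems(3) by (auto simp: p)
        then have "\<not> arrow s r" using arrow_height by fastforce
        then have "r d = 0" using r sd(1,2) Rays_nonneg[OF r sd(2) d'(2)] by (force simp: arrow_def)
        then show ?thesis by simp
      qed
    qed simp
    then have "ch d (W L c x) = ch d x * inverse (1 + FL (set L) c s x)"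
      using ch0[OF D(2)] D(3) by (simp add: prod_single_powi[OF fin_Rays sd(1)] power_int_minus)
    then show "1 + FL (set (p # L)) c r x = (1 + FL (set L) c r x) *
        (if r = s then 1 + ?c * ch d (W L c x) else 1)"
      unfolding FLc using nz[OF sd(1)] by (simp add: distrib_left mult.assoc)
  qed
  then show ?case by (simp add: W_def)
qed

text \<open>Sorting by height makes the functionals of later roots vanish on the characters of earlier
  ones, unless the functionals coincide.\<close>

definition L0 :: "(('m \<Rightarrow> int) \<times> 'm) list" where
  "L0 = (SOME L. set L = RG \<and> distinct L \<and> sorted_wrt (\<lambda>p q. height (fst p) \<le> height (fst q)) L)"

lemma L0: "set L0 = RG" "distinct L0" "sorted_wrt (\<lambda>p q. height (fst p) \<le> height (fst q)) L0"
proof -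
  obtain L where "set L = RG" "distinct L" using finite_distinct_list[OF fin_RG] by blast
  then have "\<exists>L. set L = RG \<and> distinct L \<and> sorted_wrt (\<lambda>p q. height (fst p) \<le> height (fst q)) L"
    by (intro exI[of _ "sort_key (height \<circ> fst) L"])
      (use sorted_sort_key[of "height \<circ> fst" L] in \<open>simp add: sorted_map comp_def\<close>)
  from someI_ex[OF this]
  show "set L0 = RG" "distinct L0" "sorted_wrt (\<lambda>p q. height (fst p) \<le> height (fst q)) L0"
    unfolding L0_def by blast+
qed

definition coeffs_of :: "'k mat \<Rightarrow> ('m \<Rightarrow> int) \<times> 'm \<Rightarrow> 'k" where
  "coeffs_of A = (\<lambda>(r, d). A $$ (idx (dual r), idx (dual r + d)))"

text \<open>By \<open>dual_coeff\<close> and \<open>form_W\<close> the normal form of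
  \<open>g\<close> and that of the ordered product have the same parameters, and a form determines
  the automorphism.\<close>

lemma G_eq_W:
  assumes g: "g \<in> G"
  shows "g = W L0 (coeffs_of (R g))"
proof -
  obtain F where F: "form Rays (\<lambda>r x. 1 + F r x) g" "\<And>r. r \<in> Rays \<Longrightarrow> F r \<in> SpanE r"
    using G_normal_form[OF g] unfolding normal_form_def by blast
  have "form Rays (\<lambda>r x. 1 + FL (set L0) (coeffs_of (R g)) r x) (W L0 (coeffs_of (R g)))"
    by (rule form_W) (use L0 in auto)
  from F(1) this show ?thesis
  proof (rule form_eqI)
    fix r x assume r: "r \<in> Rays" and x: "x \<in> Xo"
    obtain c where c: "\<And>x. x \<in> Xo \<Longrightarrow> F r x = (\<Sum>d\<in>E r. c d * ch d x)"
      using F(2)[OF r] unfolding SpanE_def by blast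
    have "(\<Sum>d\<in>E r. c d * ch d x) = (\<Sum>d\<in>E r. coeffs_of (R g) (r, d) * ch d x)"
      by (rule sum.cong) (use dual_coeff[OF g F(1) r c] in \<open>auto simp: coeffs_of_def\<close>)
    then show "1 + F r x = 1 + FL (set L0) (coeffs_of (R g)) r x"
      using c[OF x] by (simp add: FL_def L0 E_def)
  qed
qed

text \<open>By \<open>G_eq_W\<close> the matrix of an element of \<open>G\<close> is rebuilt from
  some of its entries. Conversely, a solution \<open>A\<close> is the matrix of
  \<open>W L0 (coeffs_of A)\<close>. Since \<open>PM\<close> is polynomial in its parameters, these
  are polynomial equations in the entries.\<close>

lemma range_R: "R ` G = {A \<in> carrier_mat N N. A = PM L0 (coeffs_of A)}"
proof (intro equalityI subsetI)
  fix A assume "A \<in> R ` G"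
  then obtain g where g: "g \<in> G" "A = R g" by blast
  then show "A \<in> {A \<in> carrier_mat N N. A = PM L0 (coeffs_of A)}"
    using R_carrier[OF g(1)] G_eq_W[OF g(1)] R_W[of L0 "coeffs_of (R g)"] L0(1) by simp
next
  fix A assume "A \<in> {A \<in> carrier_mat N N. A = PM L0 (coeffs_of A)}"
  then have "A = R (W L0 (coeffs_of A))" using R_W[of L0] L0(1) by simp
  then show "A \<in> R ` G" using W_G[of L0] L0(1) by blast
qed

end

section \<open>\<open>G\<close> as a closed group of unipotent matrices\<close>

lemma group_GL: "group (GL m :: 'k::field mat monoid)"
proof (rule groupI)
  fix A :: "'k mat" assume A: "A \<in> carrier (GL m)"
  then have "A \<in> Units (ring_mat TYPE('k) m ())"
    using det_non_zero_imp_unit[of A m] by (simp add: GL_def)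
  then obtain C where C: "C \<in> carrier_mat m m" "C * A = 1\<^sub>m m"
    by (auto simp: Units_def ring_mat_simps)
  then have "det C * det A = 1" using A det_mult[of C m A] by (simp add: GL_def)
  then have "det C \<noteq> 0" by auto
  then show "\<exists>C\<in>carrier (GL m). C \<otimes>\<^bsub>GL m\<^esub> A = \<one>\<^bsub>GL m\<^esub>"
    using C by (auto simp: GL_def)
qed (auto simp: GL_def det_mult assoc_mult_mat)

lemma regular_GL_entry:
  "i < m \<Longrightarrow> j < m \<Longrightarrow> regular \<lparr>pts = Z, coords = GL_coords m\<rparr> (\<lambda>A. A $$ (i, j))"
  by (rule regular_coord) (auto simp: GL_coords_def)

lemma morphism_fst: "morphism (prod_space V W) V fst"
  unfolding morphism_def by (auto simp: prod_space_def intro: regular_coord)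

lemma morphism_snd: "morphism (prod_space V W) W snd"
  unfolding morphism_def by (auto simp: prod_space_def intro: regular_coord)

context root_group begin

lemma R_det: "g \<in> G \<Longrightarrow> det (R g) \<noteq> 0"
proof
  assume g: "g \<in> G" and 0: "det (R g) = 0"
  have ig: "inv\<^bsub>Aut X\<^esub> g \<in> G" using g by (rule subgroup.m_inv_closed[OF G_subgroup])
  have "R g * R (inv\<^bsub>Aut X\<^esub> g) = 1\<^sub>m N"
    using R_mult[OF g ig] R_one G_Aut[OF g] by simp
  then have "det (R g) * det (R (inv\<^bsub>Aut X\<^esub> g)) = 1"
    using det_mult[OF R_carrier[OF g] R_carrier[OF ig]] by simp
  then show False using 0 by simp
qed

lemma R_GL: "g \<in> G \<Longrightarrow> R g \<in> carrier (GL N)"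
  using R_carrier R_det by (simp add: GL_def)

lemma subgroup_R: "subgroup (R ` G) (GL N)"
proof
  show "R ` G \<subseteq> carrier (GL N)" using R_GL by blast
  show "\<one>\<^bsub>GL N\<^esub> \<in> R ` G" using R_one G_one by (force simp: GL_def)
next
  fix A C assume "A \<in> R ` G" "C \<in> R ` G"
  then show "A \<otimes>\<^bsub>GL N\<^esub> C \<in> R ` G"
    by (auto simp: GL_def R_mult[symmetric] G_mult)
next
  fix A assume "A \<in> R ` G"
  then obtain g where g: "g \<in> G" "A = R g" by blast
  have ig: "inv\<^bsub>Aut X\<^esub> g \<in> G" using g(1) by (rule subgroup.m_inv_closed[OF G_subgroup])
  have "inv\<^bsub>GL N\<^esub> (R g) = R (inv\<^bsub>Aut X\<^esub> g)"
  proof (rule group.inv_equality[OF group_GL])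
    show "R (inv\<^bsub>Aut X\<^esub> g) \<otimes>\<^bsub>GL N\<^esub> R g = \<one>\<^bsub>GL N\<^esub>"
      using R_mult[OF ig g(1)] R_one G_Aut[OF g(1)] by (simp add: GL_def)
  qed (use R_GL g ig in auto)
  then show "inv\<^bsub>GL N\<^esub> A \<in> R ` G" using g ig by auto
qed

lemma PM_carrier: "PM L c \<in> carrier_mat N N"
  by (induction L) (auto simp: PM_def intro: mult_carrier_mat[OF SM_carrier])

lemma regular_PM:
  assumes "set L \<subseteq> RG" "i < N" "j < N"
  shows "regular \<lparr>pts = Z, coords = GL_coords N\<rparr> (\<lambda>A. PM L (coeffs_of A) $$ (i, j))"
  using assms
proof (induction L arbitrary: i j)
  case Nil
  then show ?case by (simp add: PM_def)
next
  case (Cons p L)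
  obtain r d where p: "p = (r, d)" by fastforce
  then have rd: "(r, d) \<in> RG" "r \<in> Rays" using Cons.prems(1) by (auto simp: RG_def)
  have co: "regular \<lparr>pts = Z, coords = GL_coords N\<rparr> (\<lambda>A. coeffs_of A (r, d))"
    unfolding coeffs_of_def prod.case
    by (rule regular_GL_entry) (use idx(1) dual_B[OF rd(2)] dual_root[OF rd(1)] in auto)
  have "regular \<lparr>pts = Z, coords = GL_coords N\<rparr>
      (\<lambda>A. \<Sum>k<N. SM r d (coeffs_of A (r, d)) $$ (i, k) * PM L (coeffs_of A) $$ (k, j))"
  proof (rule regular_sum, rule regular_mult)
    fix k assume k: "k \<in> {..<N}"
    have "(\<lambda>A. SM r d (coeffs_of A (r, d)) $$ (i, k)) =
        (\<lambda>A. \<Sum>l\<in>{l \<in> {..nat (r (b i))}. plus_mult (b i) d l = b k}.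
          of_nat (nat (r (b i)) choose l) * coeffs_of A (r, d) ^ l)"
      using Cons.prems k by (simp add: SM_def)
    then show "regular \<lparr>pts = Z, coords = GL_coords N\<rparr> (\<lambda>A. SM r d (coeffs_of A (r, d)) $$ (i, k))"
      by (simp only:) (intro regular_sum regular_mult regular_power regular_const co)
    show "regular \<lparr>pts = Z, coords = GL_coords N\<rparr> (\<lambda>A. PM L (coeffs_of A) $$ (k, j))"
      using Cons.IH Cons.prems k by simp
  qed
  moreover have "PM (p # L) c = SM r d (c (r, d)) * PM L c" for c
    by (simp add: PM_def p)
  ultimately show ?case
    using mult_entry[OF SM_carrier PM_carrier Cons.prems(2,3)] by simp
qed

lemma closed_R: "zariski_closed \<lparr>pts = carrier (GL N), coords = GL_coords N\<rparr> (R ` G)"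
  unfolding zariski_closed_def
proof (intro exI conjI ballI)
  let ?P = "{\<lambda>A. A $$ (i, j) - PM L0 (coeffs_of A) $$ (i, j) | i j. i < N \<and> j < N}"
  show "regular \<lparr>pts = carrier (GL N), coords = GL_coords N\<rparr> f" if "f \<in> ?P" for f
    using that L0(1) by (auto intro!: regular_diff regular_GL_entry regular_PM)
  show "R ` G = {x \<in> pts \<lparr>pts = carrier (GL N), coords = GL_coords N\<rparr>. \<forall>f\<in>?P. f x = 0}"
  proof (intro equalityI subsetI)
    fix A assume A: "A \<in> R ` G"
    then have "A = PM L0 (coeffs_of A)" unfolding range_R by blast
    then have "A $$ (i, j) - PM L0 (coeffs_of A) $$ (i, j) = 0" for i j by simp
    then show "A \<in> {x \<in> pts \<lparr>pts = carrier (GL N), coords = GL_coords N\<rparr>. \<forall>f\<in>?P. f x = 0}"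
      using A R_GL by auto
  next
    fix A assume A: "A \<in> {x \<in> pts \<lparr>pts = carrier (GL N), coords = GL_coords N\<rparr>. \<forall>f\<in>?P. f x = 0}"
    then have c: "A \<in> carrier_mat N N" by (simp add: GL_def)
    have "A = PM L0 (coeffs_of A)"
    proof (rule eq_matI)
      fix i j assume "i < dim_row (PM L0 (coeffs_of A))" "j < dim_col (PM L0 (coeffs_of A))"
      then have "i < N" "j < N" using PM_carrier[of L0 "coeffs_of A"] by auto
      then have "(\<lambda>A. A $$ (i, j) - PM L0 (coeffs_of A) $$ (i, j)) \<in> ?P" by blast
      then show "A $$ (i, j) = PM L0 (coeffs_of A) $$ (i, j)" using A by force
    qed (use c PM_carrier[of L0 "coeffs_of A"] in auto)
    then show "A \<in> R ` G" unfolding range_R using c by blast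
  qed
qed

text \<open>A nonzero entry of \<open>R g - 1\<close> lowers \<open>ell\<close> by at least one, so
  a nonzero entry of the power \<open>k\<close> lowers it by at least \<open>k\<close>, while
  \<open>ell\<close> is nonnegative on \<open>B\<close>.\<close>

lemma unipotent_R:
  assumes "g \<in> G"
  shows "unipotent_mat N (R g)"
proof -
  let ?D = "R g - 1\<^sub>m N"
  have C: "R g \<in> carrier_mat N N" "?D \<in> carrier_mat N N" using R_carrier[OF assms] by auto
  have D: "ell (b j) < ell (b i)" if "i < N" "j < N" "?D $$ (i, j) \<noteq> 0" for i j
    using R_unitri[OF assms] that C by (cases "i = j") (auto simp: unitri_def)
  have Dk: "?D ^\<^sub>m k \<in> carrier_mat N N" for k using C(2) by (rule pow_carrier_mat)
  have pw: "ell (b j) + int k \<le> ell (b i)" if "i < N" "j < N" "(?D ^\<^sub>m k) $$ (i, j) \<noteq> 0" for i j k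
    using that
  proof (induction k arbitrary: i j)
    case 0
    then show ?case using C by (cases "i = j") auto
  next
    case (Suc k)
    have "(\<Sum>l<N. (?D ^\<^sub>m k) $$ (i, l) * ?D $$ (l, j)) \<noteq> 0"
      using Suc.prems mult_entry[OF Dk C(2), of i j k] by simp
    then obtain l where "l \<in> {..<N}" "(?D ^\<^sub>m k) $$ (i, l) * ?D $$ (l, j) \<noteq> 0"
      by (rule sum.not_neutral_contains_not_neutral)
    then have l: "l < N" "(?D ^\<^sub>m k) $$ (i, l) \<noteq> 0" "?D $$ (l, j) \<noteq> 0" by auto
    show ?case using Suc.IH[OF Suc.prems(1) l(1,2)] D[OF l(1) Suc.prems(2) l(3)] by simp
  qed
  \<comment> \<open>The sum of the nonnegative values of \<open>ell\<close> bounds each of them; one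
    step more is impossible.\<close>
  define k where "k = Suc (nat (\<Sum>i<N. ell (b i)))"
  have "?D ^\<^sub>m k = 0\<^sub>m N N"
  proof (rule eq_matI)
    fix i j assume "i < dim_row (0\<^sub>m N N :: 'k mat)" "j < dim_col (0\<^sub>m N N :: 'k mat)"
    then have ij: "i < N" "j < N" by auto
    have "ell (b i) \<le> (\<Sum>i<N. ell (b i))"
      by (rule member_le_sum) (use ij ell_nonneg b_S in auto)
    then have "\<not> ell (b j) + int k \<le> ell (b i)" using ell_nonneg[OF b_S[OF ij(2)]] by (simp add: k_def)
    then show "(?D ^\<^sub>m k) $$ (i, j) = 0\<^sub>m N N $$ (i, j)" using pw[OF ij, of k] ij by auto
  qed (use Dk[of k] in auto)
  then show ?thesis unfolding unipotent_mat_def using C by blast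
qed

theorem unipotent_algebraic_group: "is_unipotent_algebraic_group X G"
proof -
  \<comment> \<open>The matrix group acts through the inverse of the injective map
    \<open>R\<close>.\<close>
  define \<pi> where "\<pi> = inv_into G R"
  have \<pi>R: "\<pi> (R g) = g" if "g \<in> G" for g using that R_inj by (simp add: \<pi>_def)
  have \<pi>G: "\<pi> A \<in> G" "R (\<pi> A) = A" if "A \<in> R ` G" for A
    using that by (auto simp: \<pi>_def inv_into_into f_inv_into_f)
  let ?GL = "(GL N)\<lparr>carrier := R ` G\<rparr>" and ?V = "\<lparr>pts = R ` G, coords = GL_coords N\<rparr>"
  have grp: "group ?GL" by (rule group.subgroup_imp_group[OF group_GL subgroup_R])
  have hom: "\<pi> \<in> hom ?GL (BijGroup (pts X))"
  proof (rule homI)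
    fix A assume "A \<in> carrier ?GL"
    then have "\<pi> A \<in> carrier (Aut X)" using \<pi>G(1)[of A] G_Aut by simp
    then show "\<pi> A \<in> carrier (BijGroup (pts X))" by (simp add: mem_Aut BijGroup_def)
  next
    fix A C assume "A \<in> carrier ?GL" "C \<in> carrier ?GL"
    then obtain g h where g: "g \<in> G" "h \<in> G" "A = R g" "C = R h" by auto
    have "\<pi> (R g * R h) = g \<cdot> h" using \<pi>R[OF G_mult[OF g(1,2)]] R_mult g by simp
    moreover have "g \<cdot> h = g \<otimes>\<^bsub>BijGroup (pts X)\<^esub> h" by (simp add: Aut_def)
    ultimately show "\<pi> (A \<otimes>\<^bsub>?GL\<^esub> C) = \<pi> A \<otimes>\<^bsub>BijGroup (pts X)\<^esub> \<pi> C"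
      using g by (simp add: GL_def \<pi>R)
  qed
  have faithful: "faithful_action ?GL (pts X) \<pi>"
    unfolding faithful_action_def group_action_def faithful_action_axioms_def group_hom_def
      group_hom_axioms_def
    using grp hom group_BijGroup \<pi>G(2) by (auto intro: inj_on_inverseI[of _ R])
  have mor: "morphism (prod_space ?V X) X (\<lambda>(A, x). \<pi> A x)"
    unfolding morphism_def
  proof (intro conjI ballI)
    show "(\<lambda>(A, x). \<pi> A x) ` pts (prod_space ?V X) \<subseteq> pts X"
      using \<pi>G(1) Aut_in[OF G_Aut] by (auto simp: prod_space_def)
    fix f assume "f \<in> coords X"
    then obtain a where a: "\<And>x. x \<in> pts X \<Longrightarrow> f x = (\<Sum>m\<in>F0. a m * \<chi> m x)" using coords_span by blast
    \<comment> \<open>A coordinate of the image point is bilinear in matrix entries and weight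
      functions, which makes the action regular in both arguments jointly.\<close>
    let ?h = "\<lambda>p. \<Sum>m\<in>F0. a m * (\<Sum>j<N. fst p $$ (idx m, j) * \<chi> (b j) (snd p))"
    have "regular (prod_space ?V X) ?h"
    proof (intro regular_sum regular_mult regular_const)
      fix m j assume m: "m \<in> F0" and j: "j \<in> {..<N}"
      then have "idx m < N" using idx F0_B by blast
      then show "regular (prod_space ?V X) (\<lambda>p. fst p $$ (idx m, j))"
        using regular_comp[OF regular_GL_entry morphism_fst] j by (simp add: comp_def)
      show "regular (prod_space ?V X) (\<lambda>p. \<chi> (b j) (snd p))"
        using regular_comp[OF chi_regular morphism_snd, OF b_S] j by (simp add: comp_def)
    qed
    moreover have "(f \<circ> (\<lambda>(A, x). \<pi> A x)) p = ?h p" if p: "p \<in> pts (prod_space ?V X)" for p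
    proof -
      obtain g x where g: "p = (R g, x)" "g \<in> G" "x \<in> pts X" using p by (auto simp: prod_space_def)
      have "\<chi> m (g x) = (\<Sum>j<N. R g $$ (idx m, j) * \<chi> (b j) x)" if "m \<in> F0" for m
      proof -
        have m: "m \<in> B" using that F0_B by blast
        have "\<chi> (b (idx m)) (g x) = (\<Sum>j<N. R g $$ (idx m, j) * \<chi> (b j) x)"
          using R_rep[OF g(2)] idx(1)[OF m] g(3) by (simp add: is_rep_def)
        then show ?thesis by (simp add: idx(2)[OF m])
      qed
      then show ?thesis using g a[OF Aut_in[OF G_Aut[OF g(2)] g(3)]] by (simp add: \<pi>R)
    qed
    ultimately show "regular (prod_space ?V X) (f \<circ> (\<lambda>(A, x). \<pi> A x))"
      using regular_cong[of "prod_space ?V X" "f \<circ> (\<lambda>(A, x). \<pi> A x)" ?h] by blast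
  qed
  have act: "effective_regular_action ?GL (GL_coords N) X \<pi>"
    unfolding effective_regular_action_def using faithful mor by simp
  have uni: "unipotent_linear_group N (R ` G)"
    unfolding unipotent_linear_group_def using subgroup_R closed_R unipotent_R by blast
  have "G = \<pi> ` (R ` G)" using \<pi>R by force
  then show ?thesis
    unfolding is_unipotent_algebraic_group_def using act uni by blast
qed

end

context toric_data begin

section \<open>One-parameter subgroups normalized by the torus\<close>

text \<open>An equality of two differences becomes an equality of sums in \<open>S\<close>, where
  \<open>f\<close> is additive; so \<open>f a - f b\<close> depends on \<open>a - b\<close>
  only.\<close>

lemma additive_extension:
  fixes f :: "'m \<Rightarrow> int"
  assumes add: "\<And>m m'. m \<in> S \<Longrightarrow> m' \<in> S \<Longrightarrow> f (m + m') = f m + f m'"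
    and nonneg: "\<And>m. m \<in> S \<Longrightarrow> 0 \<le> f m"
  shows "\<exists>\<rho>. additive \<rho> \<and> (\<forall>m\<in>S. \<rho> m = f m)"
proof -
  define sp where "sp d = (SOME p. fst p \<in> S \<and> snd p \<in> S \<and> d = fst p - snd p)" for d
  define \<rho> where "\<rho> d = (if d \<in> M then f (fst (sp d)) - f (snd (sp d)) else 0)" for d
  have \<rho>: "\<rho> (a - b) = f a - f b" if "a \<in> S" "b \<in> S" for a b
  proof -
    let ?p = "sp (a - b)"
    have "fst ?p \<in> S \<and> snd ?p \<in> S \<and> a - b = fst ?p - snd ?p"
      unfolding sp_def by (rule someI[of _ "(a, b)"]) (use that in auto)
    then have p: "fst ?p \<in> S" "snd ?p \<in> S" "a + snd ?p = fst ?p + b"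
      by (auto simp: algebra_simps)
    have "f a + f (snd ?p) = f (fst ?p) + f b"
      using add[of a "snd ?p"] add[of "fst ?p" b] p that by simp
    then show ?thesis using that by (simp add: \<rho>_def M_I)
  qed
  have f0: "f 0 = 0" using add[of 0 0] S_zero by simp
  have S: "\<rho> m = f m" if "m \<in> S" for m using \<rho>[OF that S_zero] f0 by simp
  have "\<rho> (d + d') = \<rho> d + \<rho> d'" if d: "d \<in> M" "d' \<in> M" for d d'
  proof -
    obtain a b where a: "a \<in> S" "b \<in> S" "d = a - b" using d(1) by (rule M_E)
    obtain a' b' where b: "a' \<in> S" "b' \<in> S" "d' = a' - b'" using d(2) by (rule M_E)
    have *: "d + d' = (a + a') - (b + b')" using a b by simp
    show ?thesis
      unfolding * \<rho>[OF S_add[OF a(1) b(1)] S_add[OF a(2) b(2)]]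
      using a b add \<rho> by simp
  qed
  then have "additive \<rho>"
    using S nonneg by (auto simp: additive_def \<rho>_def)
  then show ?thesis using S by blast
qed

lemma poly_eq_by_pderiv:
  fixes p q :: "'k poly"
  assumes "pderiv p = pderiv q" "poly p 0 = poly q 0"
  shows "p = q"
proof -
  have "pderiv (p - q) = 0" using assms(1) by (simp add: pderiv_diff)
  then have "degree (p - q) = 0" by (simp add: pderiv_eq_0_iff)
  then obtain c where c: "p - q = [:c:]" by (rule degree_eq_zeroE)
  have "poly (p - q) 0 = 0" using assms(2) by simp
  then show ?thesis using c by simp
qed

text \<open>Degrees add under products and drop by one along \<open>e\<close>, so the degree is the
  functional \<rho>. The linear coefficients are additive as well and equal \<kappa> times the
  degree; integrating the derivative then yields powers of \<open>1 + \<kappa> c\<close>.\<close>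

lemma homogeneous_exponential:
  fixes p :: "'m \<Rightarrow> 'k poly"
  assumes e: "e \<in> M"
    and p0: "\<And>m. m \<in> S \<Longrightarrow> poly (p m) 0 = 1"
    and pmult: "\<And>m m'. m \<in> S \<Longrightarrow> m' \<in> S \<Longrightarrow> p (m + m') = p m * p m'"
    and dz: "\<And>m. m \<in> S \<Longrightarrow> coeff (p m) 1 = 0 \<Longrightarrow> pderiv (p m) = 0"
    and dn: "\<And>m. m \<in> S \<Longrightarrow> coeff (p m) 1 \<noteq> 0 \<Longrightarrow>
      m + e \<in> S \<and> pderiv (p m) = smult (coeff (p m) 1) (p (m + e))"
    and ex: "\<exists>m\<in>S. coeff (p m) 1 \<noteq> 0"
  shows "\<exists>\<kappa> \<rho>. \<kappa> \<noteq> 0 \<and> root \<rho> e \<and> (\<forall>m\<in>S. p m = [:1, \<kappa>:] ^ nat (\<rho> m))"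
proof -
  define l where "l m = coeff (p m) 1" for m
  have nz: "p m \<noteq> 0" if "m \<in> S" for m using p0[OF that] by auto
  have deg0: "degree (p m) = 0 \<longleftrightarrow> l m = 0" if "m \<in> S" for m
  proof
    assume "degree (p m) = 0"
    then show "l m = 0" by (simp add: l_def coeff_eq_0)
  next
    assume "l m = 0"
    then show "degree (p m) = 0" using dz[OF that] by (simp add: l_def pderiv_eq_0_iff)
  qed
  have desc: "m + e \<in> S" "degree (p m) = Suc (degree (p (m + e)))" if "m \<in> S" "l m \<noteq> 0" for m
  proof -
    show "m + e \<in> S" using dn that by (simp add: l_def)
    have "pderiv (p m) = smult (l m) (p (m + e))" using dn that by (simp add: l_def)
    then have "degree (p m) - 1 = degree (p (m + e))"
      using that(2) degree_pderiv[of "p m"] by simp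
    then show "degree (p m) = Suc (degree (p (m + e)))" using deg0 that by force
  qed
  have degadd: "degree (p (m + m')) = degree (p m) + degree (p m')" if "m \<in> S" "m' \<in> S" for m m'
    using pmult[OF that] nz that by (simp add: degree_mult_eq)
  obtain \<rho> where \<rho>: "additive \<rho>" "\<And>m. m \<in> S \<Longrightarrow> \<rho> m = int (degree (p m))"
    using additive_extension[of "\<lambda>m. int (degree (p m))"] degadd by auto
  obtain m0 where m0: "m0 \<in> S" "l m0 \<noteq> 0" using ex by (auto simp: l_def)
  have \<rho>e: "\<rho> e = -1"
    using additive_add[OF \<rho>(1) S_M[OF m0(1)] e] \<rho>(2)[OF m0(1)] \<rho>(2)[OF desc(1)[OF m0]] desc(2)[OF m0]
    by simp
  have "m + e \<in> S" if "m \<in> S" "0 < \<rho> m" for m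
    using desc(1)[OF that(1)] deg0[OF that(1)] \<rho>(2)[OF that(1)] that(2) by auto
  then have root: "root \<rho> e"
    unfolding root_def using \<rho>(1) e \<rho>e by blast
  have ladd: "l (m + m') = l m + l m'" if "m \<in> S" "m' \<in> S" for m m'
  proof -
    have "coeff (p m) 0 = 1" "coeff (p m') 0 = 1"
      using p0 that by (simp_all add: poly_0_coeff_0)
    then show ?thesis using pmult[OF that] by (simp add: l_def coeff_mult)
  qed
  obtain m1 where m1: "m1 \<in> S" "degree (p m1) = 1"
  proof -
    have "\<exists>m1\<in>S. degree (p m1) = 1" if "m \<in> S" "degree (p m) = Suc k" for k m
      using that
    proof (induction k arbitrary: m)
      case (Suc k)
      then have "l m \<noteq> 0" using deg0 by force
      then show ?case using Suc.IH[OF desc(1)] desc(2) Suc.prems by force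
    qed auto
    then show ?thesis using that m0 desc(2)[OF m0] by blast
  qed
  define \<kappa> where "\<kappa> = l m1"
  have \<kappa>: "\<kappa> \<noteq> 0" using m1(2) deg0[OF m1(1)] by (simp add: \<kappa>_def)
  have l1: "m1 + e \<in> S" "l (m1 + e) = 0"
    using desc[OF m1(1)] \<kappa> m1(2) deg0[of "m1 + e"] by (simp_all add: \<kappa>_def)
  \<comment> \<open>Compare the sums \<open>m + (m1 + e)\<close> and \<open>(m + e) + m1\<close>;
    the linear coefficient vanishes at \<open>m1 + e\<close>.\<close>
  have le: "l m = l (m + e) + \<kappa>" if "m \<in> S" "m + e \<in> S" for m
  proof -
    have "l m + l (m1 + e) = l (m + e) + l m1"
      using ladd[OF that(1) l1(1)] ladd[OF that(2) m1(1)] by (simp add: add_ac)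
    then show ?thesis using l1 by (simp add: \<kappa>_def)
  qed
  have ldeg: "l m = \<kappa> * of_nat (degree (p m))" if "m \<in> S" for m
    using that
  proof (induction "degree (p m)" arbitrary: m)
    case 0
    then show ?case using deg0 by simp
  next
    case (Suc k)
    then have n: "l m \<noteq> 0" using deg0 by force
    note d = desc[OF Suc.prems n]
    have "l (m + e) = \<kappa> * of_nat (degree (p (m + e)))"
      by (rule Suc.hyps(1)) (use d Suc.hyps(2) in auto)
    then show ?case using le[OF Suc.prems d(1)] d(2) by (simp add: distrib_left)
  qed
  have pm: "p m = [:1, \<kappa>:] ^ degree (p m)" if "m \<in> S" for m
    using that
  proof (induction "degree (p m)" arbitrary: m)
    case 0
    then obtain c where "p m = [:c:]" by (metis degree_eq_zeroE)
    then show ?case using p0[OF 0(2)] 0(1) by (simp add: one_pCons)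
  next
    case (Suc k)
    then have n: "l m \<noteq> 0" using deg0 by force
    note d = desc[OF Suc.prems n]
    have k: "degree (p (m + e)) = k" using d Suc.hyps(2) by simp
    have IH: "p (m + e) = [:1, \<kappa>:] ^ k"
      using Suc.hyps(1)[of "m + e"] k d(1) by simp
    have "pderiv (p m) = smult (l m) ([:1, \<kappa>:] ^ k)"
      using dn[OF Suc.prems] n IH by (simp add: l_def)
    also have "l m = \<kappa> * of_nat (Suc k)" using ldeg[OF Suc.prems] Suc.hyps(2) by simp
    also have "smult (\<kappa> * of_nat (Suc k)) ([:1, \<kappa>:] ^ k) = pderiv ([:1, \<kappa>:] ^ Suc k)"
      unfolding pderiv_power_Suc by (simp add: pderiv_pCons mult.commute)
    finally have "p m = [:1, \<kappa>:] ^ Suc k"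
      by (rule poly_eq_by_pderiv) (use p0[OF Suc.prems] in \<open>simp add: poly_power\<close>)
    then show ?case using Suc.hyps(2) by simp
  qed
  have "\<forall>m\<in>S. p m = [:1, \<kappa>:] ^ nat (\<rho> m)"
    using pm \<rho>(2) by simp
  then show ?thesis using \<kappa> root by blast
qed

end

section \<open>Characters of the torus and semi-invariant functions\<close>

lemma two_powi_inj: "(2::'k::field_char_0) powi a = 2 powi b \<longleftrightarrow> a = b"
proof
  have *: "a = b" if "a \<le> b" "(2::'k) powi a = 2 powi b" for a b
  proof -
    have "(2::'k) powi (b - a) = 1"
      using that(2) by (simp add: power_int_diff)
    moreover have "b - a = int (nat (b - a))" using that(1) by simp
    ultimately have "(2::'k) ^ nat (b - a) = 2 ^ 0" by (metis power_int_of_nat power_0)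
    then show ?thesis using that(1) unfolding two_power_inj by simp
  qed
  assume "(2::'k) powi a = 2 powi b"
  then show "a = b" using *[of a b] *[of b a] by (cases "a \<le> b") auto
qed simp

definition exponents :: "nat \<Rightarrow> (nat \<Rightarrow> int) set" where
  "exponents n = {m. \<forall>i\<ge>n. m i = 0}"

definition torus_char :: "nat \<Rightarrow> (nat \<Rightarrow> int) \<Rightarrow> (nat \<Rightarrow> 'k::field) \<Rightarrow> 'k" where
  "torus_char n m t = (\<Prod>i<n. t i powi m i)"

lemma torus_char_zero: "torus_char n 0 t = 1"
  by (simp add: torus_char_def)

lemma torus_char_add:
  "t \<in> carrier (torus n) \<Longrightarrow> torus_char n (m + m') t = torus_char n m t * torus_char n m' t"
  by (simp add: torus_char_def torus_def power_int_add prod.distrib)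

lemma torus_char_mult:
  "torus_char n m (s \<otimes>\<^bsub>torus n\<^esub> t) = torus_char n m s * torus_char n m t"
  by (simp add: torus_char_def torus_def power_int_mult_distrib prod.distrib)

lemma torus_char_nz: "t \<in> carrier (torus n) \<Longrightarrow> torus_char n m t \<noteq> 0"
  by (simp add: torus_char_def torus_def)

lemma torus_char_one: "torus_char n m \<one>\<^bsub>torus n\<^esub> = 1"
  by (simp add: torus_char_def torus_def)

lemma torus_char_distinct:
  assumes "m \<in> exponents n" "m' \<in> exponents n" "m \<noteq> m'"
  shows "\<exists>t\<in>carrier (torus n). torus_char n m t \<noteq> (torus_char n m' t :: 'k::field_char_0)"
proof -
  obtain i where i: "m i \<noteq> m' i" using assms(3) by auto
  then have n: "i < n" using assms by (metis (mono_tags) exponents_def mem_Collect_eq not_le)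
  define t where "t = (\<lambda>j. if j = i then 2 else 1 :: 'k)"
  have c: "torus_char n m t = 2 powi m i" for m
  proof -
    have "torus_char n m t = (\<Prod>j<n. if j = i then 2 powi m j else 1)"
      unfolding torus_char_def by (rule prod.cong) (auto simp: t_def)
    then show ?thesis using n by simp
  qed
  have "t \<in> carrier (torus n)" using n by (auto simp: torus_def t_def)
  then show ?thesis using i c two_powi_inj by (intro bexI[of _ t]) auto
qed

lemma exponents_zero: "0 \<in> exponents n"
  by (simp add: exponents_def)

lemma exponents_add: "m \<in> exponents n \<Longrightarrow> m' \<in> exponents n \<Longrightarrow> m + m' \<in> exponents n"
  by (simp add: exponents_def)

lemma exponents_diff: "m \<in> exponents n \<Longrightarrow> m' \<in> exponents n \<Longrightarrow> m - m' \<in> exponents n"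
  by (simp add: exponents_def)

lemma torus_mult_closed: "s \<in> carrier (torus n) \<Longrightarrow> t \<in> carrier (torus n) \<Longrightarrow>
    s \<otimes>\<^bsub>torus n\<^esub> t \<in> carrier (torus n)"
  by (simp add: torus_def)

lemma torus_one_closed: "\<one>\<^bsub>torus n\<^esub> \<in> carrier (torus n)"
  by (simp add: torus_def)

lemma torus_char_independent:
  fixes c :: "(nat \<Rightarrow> int) \<Rightarrow> 'k::field_char_0"
  assumes "finite F" "F \<subseteq> exponents n" "m \<in> F"
    and "\<And>t. t \<in> carrier (torus n) \<Longrightarrow> (\<Sum>m\<in>F. c m * torus_char n m t) = 0"
  shows "c m = 0"
proof (rule characters_independent[where \<psi> = "torus_char n" and f = "monoid.mult (torus n)"
      and A = "carrier (torus n)" and I = F])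
  show "\<exists>a\<in>carrier (torus n). torus_char n i a \<noteq> (torus_char n j a :: 'k)"
    if "i \<in> F" "j \<in> F" "i \<noteq> j" for i j
    by (rule torus_char_distinct) (use that assms(2) in auto)
  show "\<exists>a\<in>carrier (torus n). torus_char n i a \<noteq> (0 :: 'k)" if "i \<in> F" for i
    using torus_one_closed torus_char_nz by blast
qed (use assms torus_mult_closed torus_char_mult in auto)

locale toric_variety =
  fixes X :: "(nat \<Rightarrow> 'k::field_char_0, 'k) space" and n :: nat
    and \<tau> :: "(nat \<Rightarrow> 'k) \<Rightarrow> (nat \<Rightarrow> 'k) \<Rightarrow> (nat \<Rightarrow> 'k)"
  assumes affine: "affine_variety X" and toric: "toric_action n X \<tau>"
begin

abbreviation "T \<equiv> carrier (torus n) :: (nat \<Rightarrow> 'k) set"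

lemma torus_act: "effective_regular_action (torus n) (torus_coords n) X \<tau>"
  using toric by (simp add: toric_action_def)

lemma irr: "irreducible_space X"
  using affine by (simp add: affine_variety_def)

definition base_point :: "nat \<Rightarrow> 'k" where
  "base_point = (SOME x. x \<in> pts X \<and> zariski_open X (orbit (torus n) \<tau> x))"

lemma base_point: "base_point \<in> pts X" "zariski_open X (orbit (torus n) \<tau> base_point)"
proof -
  have "\<exists>x. x \<in> pts X \<and> zariski_open X (orbit (torus n) \<tau> x)"
    using toric by (auto simp: toric_action_def)
  from someI_ex[OF this]
  show "base_point \<in> pts X" "zariski_open X (orbit (torus n) \<tau> base_point)"
    unfolding base_point_def by auto
qed

lemma \<tau>_Aut: "t \<in> T \<Longrightarrow> \<tau> t \<in> carrier (Aut X)"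
  by (rule action_in_Aut[OF torus_act])

lemma \<tau>_in: "t \<in> T \<Longrightarrow> x \<in> pts X \<Longrightarrow> \<tau> t x \<in> pts X"
  by (rule Aut_in[OF \<tau>_Aut])

lemma \<tau>_mult: "s \<in> T \<Longrightarrow> t \<in> T \<Longrightarrow> x \<in> pts X \<Longrightarrow> \<tau> (s \<otimes>\<^bsub>torus n\<^esub> t) x = \<tau> s (\<tau> t x)"
  by (rule action_mult[OF torus_act])

lemma \<tau>_one:
  assumes "x \<in> pts X"
  shows "\<tau> \<one>\<^bsub>torus n\<^esub> x = x"
proof -
  let ?e = "\<one>\<^bsub>torus n\<^esub> :: nat \<Rightarrow> 'k"
  have e: "?e \<in> T" by (rule torus_one_closed)
  have "?e \<otimes>\<^bsub>torus n\<^esub> ?e = ?e" by (simp add: torus_def)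
  then have "\<tau> ?e (\<tau> ?e x) = \<tau> ?e x" using \<tau>_mult[OF e e assms] by simp
  moreover have "inj_on (\<tau> ?e) (pts X)"
    using \<tau>_Aut[OF e] by (auto simp: mem_Aut Bij_def bij_betw_def)
  ultimately show ?thesis using \<tau>_in[OF e] assms by (auto simp: inj_on_def)
qed

lemma orbit_dense:
  assumes f: "regular X f" and 0: "\<And>t. t \<in> T \<Longrightarrow> f (\<tau> t base_point) = 0" and x: "x \<in> pts X"
  shows "f x = 0"
proof (rule zariski_open_dense[OF irr base_point(2) _ f _ x])
  show "orbit (torus n) \<tau> base_point \<noteq> {}"
    using torus_one_closed by (auto simp: orbit_def)
  show "f y = 0" if "y \<in> orbit (torus n) \<tau> base_point" for y
    using that 0 by (auto simp: orbit_def)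
qed

definition semi_invariant :: "(nat \<Rightarrow> int) \<Rightarrow> ((nat \<Rightarrow> 'k) \<Rightarrow> 'k) \<Rightarrow> bool" where
  "semi_invariant m f \<longleftrightarrow> regular X f \<and> (\<forall>t\<in>T. \<forall>x\<in>pts X. f (\<tau> t x) = torus_char n m t * f x)"

text \<open>On the orbit of \<open>base_point\<close> a semi-invariant function is determined by its
  value there, and the orbit is dense.\<close>

lemma semi_invariant_eqI:
  assumes f: "semi_invariant m f" and g: "semi_invariant m g" and eq: "f base_point = g base_point"
    and x: "x \<in> pts X"
  shows "f x = g x"
proof -
  have "f x - g x = 0"
  proof (rule orbit_dense[OF _ _ x])
    show "regular X (\<lambda>x. f x - g x)"
      using f g by (auto simp: semi_invariant_def intro: regular_diff)
    show "f (\<tau> t base_point) - g (\<tau> t base_point) = 0" if "t \<in> T" for t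
      using that f g eq base_point(1) by (simp add: semi_invariant_def)
  qed
  then show ?thesis by simp
qed

text \<open>These are the characters whose functions on the open orbit extend to regular functions
  on \<open>X\<close>. The value 1 at \<open>base_point\<close> makes the extensions unique and
  multiplicative.\<close>

definition weights :: "(nat \<Rightarrow> int) set" where
  "weights = {m \<in> exponents n. \<exists>f. semi_invariant m f \<and> f base_point = 1}"

definition weight_fun :: "(nat \<Rightarrow> int) \<Rightarrow> (nat \<Rightarrow> 'k) \<Rightarrow> 'k" where
  "weight_fun m = (SOME f. semi_invariant m f \<and> f base_point = 1)"

lemma weight_fun:
  assumes "m \<in> weights"
  shows "semi_invariant m (weight_fun m)" "weight_fun m base_point = 1"
  using someI_ex[of "\<lambda>f. semi_invariant m f \<and> f base_point = 1"] assms
  unfolding weights_def weight_fun_def by auto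

lemma weight_fun_orbit:
  "m \<in> weights \<Longrightarrow> t \<in> T \<Longrightarrow> weight_fun m (\<tau> t base_point) = torus_char n m t"
  using weight_fun[of m] base_point(1) by (simp add: semi_invariant_def)

lemma weight_fun_eqI:
  "m \<in> weights \<Longrightarrow> semi_invariant m f \<Longrightarrow> x \<in> pts X \<Longrightarrow> f x = f base_point * weight_fun m x"
  by (rule semi_invariant_eqI[of m f "\<lambda>x. f base_point * weight_fun m x"])
    (auto simp: semi_invariant_def weight_fun weight_fun[unfolded semi_invariant_def]
      intro!: regular_mult)

lemma semi_invariant_mult:
  "semi_invariant m f \<Longrightarrow> semi_invariant m' g \<Longrightarrow> semi_invariant (m + m') (\<lambda>x. f x * g x)"
  by (auto simp: semi_invariant_def torus_char_add intro: regular_mult)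

lemma semi_invariant_one: "semi_invariant 0 (\<lambda>_. 1)"
  by (simp add: semi_invariant_def torus_char_zero)

lemma weights_zero: "0 \<in> weights"
  using semi_invariant_one by (auto simp: weights_def exponents_zero)

lemma weights_add: "m \<in> weights \<Longrightarrow> m' \<in> weights \<Longrightarrow> m + m' \<in> weights"
  using semi_invariant_mult[OF weight_fun(1) weight_fun(1), of m m'] weight_fun(2)[of m]
    weight_fun(2)[of m']
  by (auto simp: weights_def exponents_add intro!: exI)

text \<open>The action expands \<open>f (\<tau> t x)\<close> in characters of \<open>t\<close>.
  Comparing expansions at \<open>\<tau> s x\<close> and \<open>x\<close> shows that the coefficients
  are semi-invariant, hence multiples of weight functions; the neutral element \<open>t\<close>
  recovers \<open>f\<close>.\<close>

lemma regular_decomposition: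
  assumes f: "regular X f"
  shows "\<exists>F a. finite F \<and> F \<subseteq> weights \<and> (\<forall>x\<in>pts X. f x = (\<Sum>m\<in>F. a m * weight_fun m x))"
proof -
  have "\<exists>F h. finite F \<and> F \<subseteq> exponents n \<and> (\<forall>m. regular X (h m)) \<and>
      (\<forall>t\<in>T. \<forall>x\<in>pts X. f (\<tau> t x) = (\<Sum>m\<in>F. torus_char n m t * h m x))"
  proof (rule action_expansion[OF torus_act _ _ _ _ _ f])
    fix c :: "(nat \<Rightarrow> 'k) \<Rightarrow> 'k" assume "c \<in> torus_coords n"
    then obtain i where i: "i < n" "c = (\<lambda>t. t i) \<or> c = (\<lambda>t. inverse (t i))"
      by (auto simp: torus_coords_def)
    have u: "torus_char n (\<lambda>j. if j = i then z else 0) t = t i powi z" for z and t :: "nat \<Rightarrow> 'k"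
    proof -
      have "torus_char n (\<lambda>j. if j = i then z else 0) t = (\<Prod>j<n. if j = i then t j powi z else 1)"
        unfolding torus_char_def by (rule prod.cong) auto
      then show ?thesis using i(1) by simp
    qed
    have ex: "(\<lambda>j. if j = i then z else 0) \<in> exponents n" for z :: int
      using i(1) by (simp add: exponents_def)
    from i(2) show "\<exists>m\<in>exponents n. \<forall>t\<in>T. c t = torus_char n m t"
    proof
      assume "c = (\<lambda>t. t i)"
      then show ?thesis using u[of 1] ex[of 1] by (intro bexI[OF _ ex[of 1]]) simp
    next
      assume "c = (\<lambda>t. inverse (t i))"
      then show ?thesis using u[of "-1"] by (intro bexI[OF _ ex[of "-1"]]) (simp add: power_int_minus)
    qed
  qed (auto simp: exponents_zero exponents_add torus_char_zero torus_char_add)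
  then obtain F h where F: "finite F" "F \<subseteq> exponents n" and h: "\<forall>m. regular X (h m)"
    and e: "\<forall>t\<in>T. \<forall>x\<in>pts X. f (\<tau> t x) = (\<Sum>m\<in>F. torus_char n m t * h m x)"
    by (elim exE conjE) (rule that)
  have semi: "semi_invariant m (h m)" if m: "m \<in> F" for m
    unfolding semi_invariant_def
  proof (intro conjI ballI)
    show "regular X (h m)" using h by blast
    fix s x assume s: "s \<in> T" and x: "x \<in> pts X"
    have "h m (\<tau> s x) - torus_char n m s * h m x = 0"
    proof (rule torus_char_independent[OF F m, of "\<lambda>m. h m (\<tau> s x) - torus_char n m s * h m x"])
      fix t :: "nat \<Rightarrow> 'k" assume t: "t \<in> T"
      have "(\<Sum>m\<in>F. (h m (\<tau> s x) - torus_char n m s * h m x) * torus_char n m t) =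
        (\<Sum>m\<in>F. torus_char n m t * h m (\<tau> s x)) -
        (\<Sum>m\<in>F. torus_char n m (t \<otimes>\<^bsub>torus n\<^esub> s) * h m x)"
        by (simp add: torus_char_mult algebra_simps sum_subtractf)
      also have "\<dots> = f (\<tau> t (\<tau> s x)) - f (\<tau> (t \<otimes>\<^bsub>torus n\<^esub> s) x)"
        using e t s x by (simp add: \<tau>_in torus_mult_closed)
      also have "\<dots> = 0" using \<tau>_mult[OF t s x] by simp
      finally show "(\<Sum>m\<in>F. (h m (\<tau> s x) - torus_char n m s * h m x) * torus_char n m t) = 0" .
    qed
    then show "h m (\<tau> s x) = torus_char n m s * h m x" by simp
  qed
  let ?F = "F \<inter> weights"
  have val: "h m x = (if m \<in> weights then h m base_point * weight_fun m x else 0)"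
    if m: "m \<in> F" and x: "x \<in> pts X" for m x
  proof (cases "m \<in> weights")
    case True
    then show ?thesis using weight_fun_eqI[OF True semi[OF m] x] by simp
  next
    case False
    \<comment> \<open>A nonzero value at \<open>base_point\<close> could be scaled to 1 and would
      make \<open>m\<close> a weight.\<close>
    have "h m base_point = 0"
    proof (rule ccontr)
      assume nz: "h m base_point \<noteq> 0"
      have "semi_invariant m (\<lambda>x. inverse (h m base_point) * h m x)"
        using semi[OF m] by (auto simp: semi_invariant_def intro: regular_mult)
      then have "m \<in> weights"
        using nz m F(2) by (auto simp: weights_def intro!: exI)
      then show False using False by simp
    qed
    then show ?thesis
      using semi_invariant_eqI[OF semi[OF m], of "\<lambda>_. 0" x] x False by (simp add: semi_invariant_def)
  qed
  have "f x = (\<Sum>m\<in>?F. h m base_point * weight_fun m x)" if x: "x \<in> pts X" for x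
  proof -
    have "f x = (\<Sum>m\<in>F. h m x)"
      using e torus_one_closed \<tau>_one x by (metis (no_types, lifting) mult_1 sum.cong torus_char_one)
    also have "\<dots> = (\<Sum>m\<in>?F. h m base_point * weight_fun m x)"
      by (rule sum.mono_neutral_cong_right) (use F val[OF _ x] in auto)
    finally show ?thesis .
  qed
  then show ?thesis using F by (intro exI[of _ ?F] exI[of _ "\<lambda>m. h m base_point"]) auto
qed

lemma coords_X: "\<exists>N. coords X = {\<lambda>x. x i | i. i < N} \<and> pts X \<subseteq> {x. \<forall>i\<ge>N. x i = 0}"
proof -
  obtain N Z where "zariski_closed (affine_space N) Z" "X = (affine_space N)\<lparr>pts := Z\<rparr>"
    using affine by (auto simp: affine_variety_def)
  then show ?thesis
    by (intro exI[of _ N]) (auto simp: affine_space_def zariski_closed_def)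
qed

lemma fin_coords: "finite (coords X)"
proof -
  obtain N where "coords X = {\<lambda>x. x i | i. i < N}" using coords_X by blast
  then have "coords X = (\<lambda>i x. x i) ` {..<N}" by auto
  then show ?thesis by simp
qed

lemma coords_separate:
  assumes "x \<in> pts X" "y \<in> pts X" "\<And>f. f \<in> coords X \<Longrightarrow> f x = f y"
  shows "x = y"
proof
  fix i
  obtain N where N: "coords X = {\<lambda>x. x i | i. i < N}" "pts X \<subseteq> {x. \<forall>i\<ge>N. x i = 0}"
    using coords_X by blast
  show "x i = y i"
  proof (cases "i < N")
    case True
    then have "(\<lambda>x. x i) \<in> coords X" using N by blast
    from assms(3)[OF this] show ?thesis .
  next
    case False
    then show ?thesis
      using subsetD[OF N(2) assms(1)] subsetD[OF N(2) assms(2)] by simp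
  qed
qed

sublocale toric_data X weights weight_fun base_point
proof
  show "irreducible_space X" by (rule irr)
  show "0 \<in> weights" by (rule weights_zero)
  show "m + m' \<in> weights" if "m \<in> weights" "m' \<in> weights" for m m'
    using that by (rule weights_add)
  show "weight_fun 0 x = 1" if "x \<in> pts X" for x
    using weight_fun_eqI[OF weights_zero semi_invariant_one that] by simp
  show "weight_fun (m + m') x = weight_fun m x * weight_fun m' x"
    if "m \<in> weights" "m' \<in> weights" "x \<in> pts X" for m m' x
    using weight_fun_eqI[OF weights_add[OF that(1,2)]
        semi_invariant_mult[OF weight_fun(1)[OF that(1)] weight_fun(1)[OF that(2)]] that(3)]
      weight_fun(2) that by simp
  show "regular X (weight_fun m)" if "m \<in> weights" for m
    using weight_fun(1)[OF that] by (simp add: semi_invariant_def)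
  show "\<exists>F a. finite F \<and> F \<subseteq> weights \<and> (\<forall>x\<in>pts X. f x = (\<Sum>m\<in>F. a m * weight_fun m x))"
    if "regular X f" for f
    using that by (rule regular_decomposition)
  show "base_point \<in> pts X" by (rule base_point)
  show "weight_fun m base_point = 1" if "m \<in> weights" for m using that by (rule weight_fun)
  show "h x = 0" if "regular X h" "\<And>x. x \<in> pts X \<Longrightarrow> \<forall>m\<in>weights. weight_fun m x \<noteq> 0 \<Longrightarrow> h x = 0"
    "x \<in> pts X" for h x
    by (rule orbit_dense[OF that(1) that(2) that(3)])
      (auto simp: \<tau>_in base_point weight_fun_orbit torus_char_nz)
  show "a m = 0" if "finite F" "F \<subseteq> weights" "\<And>x. x \<in> pts X \<Longrightarrow> (\<Sum>m\<in>F. a m * weight_fun m x) = 0"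
    "m \<in> F" for F a m
  proof (rule torus_char_independent[OF that(1) _ that(4)])
    show "F \<subseteq> exponents n" using that(2) by (auto simp: weights_def)
    fix t :: "nat \<Rightarrow> 'k" assume t: "t \<in> T"
    have "(\<Sum>m\<in>F. a m * torus_char n m t) = (\<Sum>m\<in>F. a m * weight_fun m (\<tau> t base_point))"
      by (rule sum.cong) (use that(2) weight_fun_orbit t in auto)
    then show "(\<Sum>m\<in>F. a m * torus_char n m t) = 0"
      using that(3)[OF \<tau>_in[OF t base_point(1)]] by simp
  qed
  show "x = y" if "x \<in> pts X" "y \<in> pts X" "\<And>m. m \<in> weights \<Longrightarrow> weight_fun m x = weight_fun m y" for x y
  proof (rule coords_separate[OF that(1,2)])
    fix f assume "f \<in> coords X"
    then obtain F a where F: "F \<subseteq> weights" "\<forall>x\<in>pts X. f x = (\<Sum>m\<in>F. a m * weight_fun m x)"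
      using regular_decomposition[OF regular_coord] by blast
    have "(\<Sum>m\<in>F. a m * weight_fun m x) = (\<Sum>m\<in>F. a m * weight_fun m y)"
      by (rule sum.cong) (use F(1) that(3) in auto)
    then show "f x = f y" using F(2) that by simp
  qed
qed

lemma coords_support:
  "\<exists>F0. finite F0 \<and> F0 \<subseteq> weights \<and>
     (\<forall>f\<in>coords X. \<exists>a. \<forall>x\<in>pts X. f x = (\<Sum>m\<in>F0. a m * weight_fun m x))"
proof -
  have "\<forall>f\<in>coords X. \<exists>F. finite F \<and> F \<subseteq> weights \<and>
      (\<exists>a. \<forall>x\<in>pts X. f x = (\<Sum>m\<in>F. a m * weight_fun m x))"
  proof
    fix f assume "f \<in> coords X"
    from regular_decomposition[OF regular_coord[OF this]]
    show "\<exists>F. finite F \<and> F \<subseteq> weights \<and>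
      (\<exists>a. \<forall>x\<in>pts X. f x = (\<Sum>m\<in>F. a m * weight_fun m x))"
      by (elim exE conjE) (intro exI conjI)
  qed
  from bchoice[OF this] obtain F where F: "\<forall>f\<in>coords X. finite (F f) \<and> F f \<subseteq> weights \<and>
      (\<exists>a. \<forall>x\<in>pts X. f x = (\<Sum>m\<in>F f. a m * weight_fun m x))"
    by (elim exE) (rule that)
  let ?F = "\<Union>f\<in>coords X. F f"
  have fin: "finite ?F" using F fin_coords by auto
  have "\<exists>a. \<forall>x\<in>pts X. f x = (\<Sum>m\<in>?F. a m * weight_fun m x)" if f: "f \<in> coords X" for f
  proof -
    obtain a where a: "\<forall>x\<in>pts X. f x = (\<Sum>m\<in>F f. a m * weight_fun m x)" using F f by blast
    have "(\<Sum>m\<in>?F. (if m \<in> F f then a m else 0) * weight_fun m x) = (\<Sum>m\<in>F f. a m * weight_fun m x)" for x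
      by (rule sum.mono_neutral_cong_right) (use fin f in auto)
    then show ?thesis using a by (intro exI[of _ "\<lambda>m. if m \<in> F f then a m else 0"]) simp
  qed
  then show ?thesis using fin F by (intro exI[of _ ?F]) auto
qed

end

section \<open>Homogeneity of a normalized additive action\<close>

locale Ga_action = toric_variety X n \<tau> for X :: "(nat \<Rightarrow> 'k::field_char_0, 'k) space" and n \<tau> +
  fixes \<alpha> :: "'k \<Rightarrow> (nat \<Rightarrow> 'k) \<Rightarrow> (nat \<Rightarrow> 'k)"
  assumes Ga: "effective_regular_action additive_group {\<lambda>t. t} X \<alpha>"
    and normalized: "\<tau> ` carrier (torus n) \<subseteq> normalizer (Aut X) (range \<alpha>)"
begin

lemma \<alpha>_Aut: "\<alpha> c \<in> carrier (Aut X)"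
  by (rule action_in_Aut[OF Ga]) (simp add: additive_group_def)

lemma \<alpha>_in: "x \<in> pts X \<Longrightarrow> \<alpha> c x \<in> pts X"
  by (rule Aut_in[OF \<alpha>_Aut])

lemma \<alpha>_add: "x \<in> pts X \<Longrightarrow> \<alpha> (c + d) x = \<alpha> c (\<alpha> d x)"
  using action_mult[OF Ga, of c d x] by (simp add: additive_group_def)

lemma \<alpha>_mult: "\<alpha> (c + d) = \<alpha> c \<cdot> \<alpha> d"
  using action_mult_Aut[OF Ga, of c d] by (simp add: additive_group_def)

lemma \<alpha>_inj: "\<alpha> c = \<alpha> d \<Longrightarrow> c = d"
  using action_inj[OF Ga] by (simp add: inj_on_def additive_group_def)

lemma \<alpha>_zero:
  assumes "x \<in> pts X"
  shows "\<alpha> 0 x = x"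
proof -
  have "\<alpha> 0 (\<alpha> 0 x) = \<alpha> 0 x" using \<alpha>_add[OF assms, of 0 0] by simp
  moreover have "inj_on (\<alpha> 0) (pts X)"
    using \<alpha>_Aut[of 0] by (auto simp: mem_Aut Bij_def bij_betw_def)
  ultimately show ?thesis using \<alpha>_in assms by (auto simp: inj_on_def)
qed

lemma conj_ex:
  assumes t: "t \<in> T"
  shows "\<exists>d. \<tau> t \<cdot> \<alpha> c = \<alpha> d \<cdot> \<tau> t"
proof -
  interpret Aut: group "Aut X" by (rule group_Aut)
  have sub: "range \<alpha> \<subseteq> carrier (Aut X)" using \<alpha>_Aut by auto
  have "\<tau> t \<in> normalizer (Aut X) (range \<alpha>)" using normalized t by auto
  then have eq: "\<tau> t <#\<^bsub>Aut X\<^esub> range \<alpha> #>\<^bsub>Aut X\<^esub> inv\<^bsub>Aut X\<^esub> \<tau> t = range \<alpha>"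
    using sub by (simp add: normalizer_def stabilizer_def)
  have "(\<tau> t \<cdot> \<alpha> c) \<cdot> inv\<^bsub>Aut X\<^esub> \<tau> t \<in> range \<alpha>"
    by (subst eq[symmetric]) (auto simp: l_coset_def r_coset_def)
  then obtain d where d: "(\<tau> t \<cdot> \<alpha> c) \<cdot> inv\<^bsub>Aut X\<^esub> \<tau> t = \<alpha> d" by blast
  then have "\<alpha> d \<cdot> \<tau> t = \<tau> t \<cdot> \<alpha> c"
    using \<tau>_Aut[OF t] \<alpha>_Aut by (simp add: Aut.m_assoc d[symmetric])
  then show ?thesis by metis
qed

text \<open>Conjugation by \<open>t\<close> as a map of the additive parameter. Its additivity
  follows from the group law, and its value at 1 turns out to be the inverse of a character of
  \<open>t\<close> in \<open>degree_vector\<close>.\<close>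

definition twist :: "(nat \<Rightarrow> 'k) \<Rightarrow> 'k \<Rightarrow> 'k" where
  "twist t c = (SOME d. \<tau> t \<cdot> \<alpha> c = \<alpha> d \<cdot> \<tau> t)"

lemma twist: "t \<in> T \<Longrightarrow> \<tau> t \<cdot> \<alpha> c = \<alpha> (twist t c) \<cdot> \<tau> t"
  unfolding twist_def by (rule someI_ex[OF conj_ex])

lemma twist_apply:
  assumes "t \<in> T" "x \<in> pts X"
  shows "\<tau> t (\<alpha> c x) = \<alpha> (twist t c) (\<tau> t x)"
  using arg_cong[OF twist[OF assms(1)], of "\<lambda>g. g x"] assms
  by (simp add: Aut_mult_apply \<tau>_Aut \<alpha>_Aut)

lemma twist_add:
  assumes t: "t \<in> T"
  shows "twist t (c + d) = twist t c + twist t d"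
proof (rule \<alpha>_inj)
  interpret Aut: group "Aut X" by (rule group_Aut)
  note A = \<tau>_Aut[OF t] \<alpha>_Aut
  have "\<alpha> (twist t (c + d)) \<cdot> \<tau> t = \<tau> t \<cdot> (\<alpha> c \<cdot> \<alpha> d)"
    using twist[OF t, of "c + d"] by (simp add: \<alpha>_mult)
  also have "\<dots> = \<alpha> (twist t c) \<cdot> \<tau> t \<cdot> \<alpha> d"
    using A by (simp add: Aut.m_assoc[symmetric] twist[OF t])
  also have "\<dots> = \<alpha> (twist t c + twist t d) \<cdot> \<tau> t"
    using A by (simp add: Aut.m_assoc twist[OF t] \<alpha>_mult)
  finally show "\<alpha> (twist t (c + d)) = \<alpha> (twist t c + twist t d)" using A by simp
qed

lemma twist_multiple: "t \<in> T \<Longrightarrow> twist t (of_nat k * c) = of_nat k * twist t c"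
proof (induction k)
  case 0
  then show ?case using twist_add[of t 0 0] by simp
next
  case (Suc k)
  then show ?case by (simp add: distrib_right twist_add)
qed

lemma expansion:
  assumes m: "m \<in> weights"
  shows "\<exists>P a. finite P \<and> snd ` P \<subseteq> weights \<and>
    (\<forall>c. \<forall>x\<in>pts X. weight_fun m (\<alpha> c x) = (\<Sum>p\<in>P. a p * c ^ fst p * weight_fun (snd p) x))"
proof -
  have "\<exists>F h. finite F \<and> F \<subseteq> (UNIV :: nat set) \<and> (\<forall>i. regular X (h i)) \<and>
      (\<forall>c\<in>carrier additive_group. \<forall>x\<in>pts X. weight_fun m (\<alpha> c x) = (\<Sum>i\<in>F. c ^ i * h i x))"
    by (rule action_expansion[OF Ga _ _ _ _ _ chi_regular[OF m]])
      (auto simp: power_add intro!: exI[of _ 1])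
  then obtain F h where F: "finite F" and h: "\<forall>i::nat. regular X (h i)"
    and e: "\<forall>c\<in>carrier additive_group. \<forall>x\<in>pts X. weight_fun m (\<alpha> c x) = (\<Sum>i\<in>F. c ^ i * h i x)"
    by (elim exE conjE) (rule that)
  have "\<forall>i. \<exists>Q. finite (fst Q) \<and> fst Q \<subseteq> weights \<and>
      (\<forall>x\<in>pts X. h i x = (\<Sum>m\<in>fst Q. snd Q m * weight_fun m x))"
  proof
    fix i
    obtain F a where "finite F \<and> F \<subseteq> weights \<and> (\<forall>x\<in>pts X. h i x = (\<Sum>m\<in>F. a m * weight_fun m x))"
      using regular_decomposition[OF h[rule_format, of i]] by (elim exE) (rule that)
    then show "\<exists>Q. finite (fst Q) \<and> fst Q \<subseteq> weights \<and>
      (\<forall>x\<in>pts X. h i x = (\<Sum>m\<in>fst Q. snd Q m * weight_fun m x))"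
      by (intro exI[of _ "(F, a)"]) simp
  qed
  from choice[OF this] obtain Q where Q: "\<forall>i. finite (fst (Q i)) \<and> fst (Q i) \<subseteq> weights \<and>
      (\<forall>x\<in>pts X. h i x = (\<Sum>m\<in>fst (Q i). snd (Q i) m * weight_fun m x))"
    by (elim exE) (rule that)
  let ?P = "SIGMA i:F. fst (Q i)" and ?a = "\<lambda>p. snd (Q (fst p)) (snd p)"
  have "weight_fun m (\<alpha> c x) = (\<Sum>p\<in>?P. ?a p * c ^ fst p * weight_fun (snd p) x)" if x: "x \<in> pts X" for c x
  proof -
    have "weight_fun m (\<alpha> c x) = (\<Sum>i\<in>F. c ^ i * h i x)"
      using e x by (simp add: additive_group_def)
    also have "\<dots> = (\<Sum>i\<in>F. \<Sum>m\<in>fst (Q i). snd (Q i) m * c ^ i * weight_fun m x)"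
      by (rule sum.cong) (use Q x in \<open>auto simp: sum_distrib_left mult_ac\<close>)
    also have "\<dots> = (\<Sum>p\<in>?P. ?a p * c ^ fst p * weight_fun (snd p) x)"
      using F Q by (subst sum.Sigma) (auto simp: split_def)
    finally show ?thesis .
  qed
  moreover have "finite ?P" using F Q by auto
  moreover have "snd ` ?P \<subseteq> weights"
  proof
    fix w assume "w \<in> snd ` ?P"
    then obtain i where "w \<in> fst (Q i)" by auto
    then show "w \<in> weights" using Q by blast
  qed
  ultimately show ?thesis by (intro exI[of _ ?P] exI[of _ ?a]) simp
qed

text \<open>Replacing \<open>c\<close> by all its multiples \<open>k c\<close> separates the powers of \<open>c\<close>, although \<open>twist t\<close> is so
  far only known to be additive.\<close>

lemma twist_power:
  assumes P: "finite P" "snd ` P \<subseteq> weights"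
    and ex: "\<And>c x. x \<in> pts X \<Longrightarrow>
      weight_fun m (\<alpha> c x) = (\<Sum>p\<in>P. a p * c ^ fst p * weight_fun (snd p) x)"
    and m: "m \<in> weights" and p: "p \<in> P" "a p \<noteq> 0" and t: "t \<in> T"
  shows "twist t c ^ fst p * torus_char n (snd p) t = c ^ fst p * torus_char n m t"
proof -
  let ?A = "{k::nat. 0 < k} \<times> T"
  let ?f = "\<lambda>(k::nat, s) (k', s'). (k * k', s \<otimes>\<^bsub>torus n\<^esub> s')"
  let ?\<psi> = "\<lambda>p (k::nat, s). of_nat k ^ fst p * torus_char n (snd p) s"
  let ?b = "\<lambda>p. a p * (c ^ fst p * torus_char n m t - twist t c ^ fst p * torus_char n (snd p) t)"
  have Pe: "snd p \<in> exponents n" if "p \<in> P" for p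
    using P(2) that by (auto simp: weights_def)
  have "?b p = 0"
  proof (rule characters_independent[where \<psi> = ?\<psi> and f = ?f and A = ?A and I = P])
    show "finite P" by (rule P)
    show "?f a b \<in> ?A" if "a \<in> ?A" "b \<in> ?A" for a b
      using that by (auto simp: torus_mult_closed)
    show "?\<psi> i (?f a b) = ?\<psi> i a * ?\<psi> i b" if "i \<in> P" "a \<in> ?A" "b \<in> ?A" for i a b
      by (cases a; cases b) (simp add: power_mult_distrib torus_char_mult mult_ac)
    show "\<exists>a\<in>?A. ?\<psi> i a \<noteq> (0 :: 'k)" if "i \<in> P" for i
      by (rule bexI[of _ "(1, \<one>\<^bsub>torus n\<^esub>)"]) (auto simp: torus_char_one torus_one_closed)
    show "\<exists>a\<in>?A. ?\<psi> i a \<noteq> (?\<psi> j a :: 'k)" if ij: "i \<in> P" "j \<in> P" "i \<noteq> j" for i j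
    proof (cases "fst i = fst j")
      case False
      then have "(2::'k) ^ fst i \<noteq> 2 ^ fst j" by (simp add: two_power_inj)
      then show ?thesis
        by (intro bexI[of _ "(2, \<one>\<^bsub>torus n\<^esub>)"]) (auto simp: torus_char_one torus_one_closed)
    next
      case True
      then have "snd i \<noteq> snd j" using ij(3) by (simp add: prod_eq_iff)
      then obtain s where "s \<in> T" "torus_char n (snd i) s \<noteq> torus_char n (snd j) s"
        using torus_char_distinct[OF Pe Pe, OF ij(1,2)] by blast
      then show ?thesis by (intro bexI[of _ "(1, s)"]) auto
    qed
    fix ks assume "ks \<in> ?A"
    then obtain k s where ks: "ks = (k, s)" "s \<in> T" by auto
    let ?x = "\<tau> s base_point" and ?c = "of_nat k * c"
    have x: "?x \<in> pts X" by (rule \<tau>_in[OF ks(2) base_point(1)])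
    have val: "weight_fun (snd p) ?x = torus_char n (snd p) s" if "p \<in> P" for p
      using weight_fun_orbit[OF _ ks(2)] P(2) that by auto
    have "torus_char n m t * weight_fun m (\<alpha> ?c ?x) = weight_fun m (\<tau> t (\<alpha> ?c ?x))"
      using weight_fun(1)[OF m] t \<alpha>_in[OF x] by (simp add: semi_invariant_def)
    also have "\<dots> = weight_fun m (\<alpha> (twist t ?c) (\<tau> t ?x))" by (simp add: twist_apply[OF t x])
    finally have "torus_char n m t * (\<Sum>p\<in>P. a p * ?c ^ fst p * weight_fun (snd p) ?x) =
        (\<Sum>p\<in>P. a p * twist t ?c ^ fst p * weight_fun (snd p) (\<tau> t ?x))"
      by (simp only: ex[OF x] ex[OF \<tau>_in[OF t x]])
    also have "\<dots> = (\<Sum>p\<in>P. a p * twist t ?c ^ fst p * (torus_char n (snd p) t * weight_fun (snd p) ?x))"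
      by (rule sum.cong) (use weight_fun(1) P(2) t x in \<open>auto simp: semi_invariant_def\<close>)
    finally have "0 = (\<Sum>p\<in>P. torus_char n m t * (a p * ?c ^ fst p * weight_fun (snd p) ?x)) -
        (\<Sum>p\<in>P. a p * twist t ?c ^ fst p * (torus_char n (snd p) t * weight_fun (snd p) ?x))"
      by (simp add: sum_distrib_left)
    also have "\<dots> = (\<Sum>p\<in>P. ?b p * ?\<psi> p ks)"
      unfolding sum_subtractf[symmetric] twist_multiple[OF t]
      by (rule sum.cong) (simp_all add: ks(1) val power_mult_distrib algebra_simps)
    finally show "(\<Sum>p\<in>P. ?b p * ?\<psi> p ks) = 0" by simp
  qed (use p in auto)
  then show ?thesis using p(2) by simp
qed

definition expo :: "(nat \<Rightarrow> int) \<Rightarrow> (nat \<times> (nat \<Rightarrow> int)) set \<times> (nat \<times> (nat \<Rightarrow> int) \<Rightarrow> 'k)" where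
  "expo m = (SOME Pa. finite (fst Pa) \<and> snd ` fst Pa \<subseteq> weights \<and>
    (\<forall>c. \<forall>x\<in>pts X. weight_fun m (\<alpha> c x) =
      (\<Sum>p\<in>fst Pa. snd Pa p * c ^ fst p * weight_fun (snd p) x)))"

abbreviation "P m \<equiv> fst (expo m)"
abbreviation "a m \<equiv> snd (expo m)"

lemma expo:
  assumes m: "m \<in> weights"
  shows "finite (P m)" "snd ` P m \<subseteq> weights"
    "x \<in> pts X \<Longrightarrow> weight_fun m (\<alpha> c x) = (\<Sum>p\<in>P m. a m p * c ^ fst p * weight_fun (snd p) x)"
proof -
  obtain Q q where "finite Q \<and> snd ` Q \<subseteq> weights \<and>
    (\<forall>c. \<forall>x\<in>pts X. weight_fun m (\<alpha> c x) = (\<Sum>p\<in>Q. q p * c ^ fst p * weight_fun (snd p) x))"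
    using expansion[OF m] by (elim exE) (rule that)
  then have "\<exists>Pa. finite (fst Pa) \<and> snd ` fst Pa \<subseteq> weights \<and>
    (\<forall>c. \<forall>x\<in>pts X. weight_fun m (\<alpha> c x) =
      (\<Sum>p\<in>fst Pa. snd Pa p * c ^ fst p * weight_fun (snd p) x))"
    by (intro exI[of _ "(Q, q)"]) simp
  from someI_ex[OF this, folded expo_def]
  show "finite (P m)" "snd ` P m \<subseteq> weights"
    "x \<in> pts X \<Longrightarrow> weight_fun m (\<alpha> c x) = (\<Sum>p\<in>P m. a m p * c ^ fst p * weight_fun (snd p) x)"
    by blast+
qed

text \<open>A polynomial in the additive parameter: its values are those of
  \<open>weight_fun m\<close> along the orbit of \<open>x\<close> under \<alpha>.\<close>

definition pol :: "(nat \<Rightarrow> int) \<Rightarrow> (nat \<Rightarrow> 'k) \<Rightarrow> 'k poly" where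
  "pol m x = (\<Sum>p\<in>P m. monom (a m p * weight_fun (snd p) x) (fst p))"

lemma poly_pol: "m \<in> weights \<Longrightarrow> x \<in> pts X \<Longrightarrow> poly (pol m x) c = weight_fun m (\<alpha> c x)"
  by (simp add: pol_def poly_sum poly_monom expo(3) mult_ac)

lemma coeff_pol: "coeff (pol m x) j =
    (\<Sum>p\<in>P m. if fst p = j then a m p * weight_fun (snd p) x else 0)"
  by (simp add: pol_def coeff_sum coeff_monom)

lemma pol_shift:
  assumes m: "m \<in> weights" and x: "x \<in> pts X"
  shows "pcompose (pol m x) [:d, 1:] = pol m (\<alpha> d x)"
proof (rule poly_ext)
  fix c
  have "poly (pcompose (pol m x) [:d, 1:]) c = weight_fun m (\<alpha> (c + d) x)"
    using poly_pol[OF m x] by (simp add: poly_pcompose add.commute)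
  also have "\<dots> = poly (pol m (\<alpha> d x)) c"
    using poly_pol[OF m \<alpha>_in[OF x]] \<alpha>_add[OF x] by simp
  finally show "poly (pcompose (pol m x) [:d, 1:]) c = poly (pol m (\<alpha> d x)) c" .
qed

text \<open>Translating the argument by \<open>d\<close> amounts to moving the point by
  \<open>\<alpha> d\<close>. Every value of the derivative is thus a linear coefficient, that is,
  the value of the associated derivation at the moved point.\<close>

lemma poly_pderiv_pol:
  assumes m: "m \<in> weights" and x: "x \<in> pts X"
  shows "poly (pderiv (pol m x)) d = coeff (pol m (\<alpha> d x)) 1"
proof -
  have "poly (pderiv (pol m x)) d = poly (pderiv (pcompose (pol m x) [:d, 1:])) 0"
    by (simp add: pderiv_pcompose poly_pcompose pderiv_pCons)
  also have "\<dots> = coeff (pol m (\<alpha> d x)) 1"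
    unfolding pol_shift[OF m x] by (simp add: poly_0_coeff_0 coeff_pderiv)
  finally show ?thesis .
qed

text \<open>Otherwise the associated derivation kills every weight function, all polynomials along
  orbits are constant, and \<open>\<alpha> 1 = \<alpha> 0\<close> contradicts effectiveness.\<close>

lemma nontrivial: "\<exists>m\<in>weights. \<exists>p\<in>P m. fst p = 1 \<and> a m p \<noteq> 0"
proof (rule ccontr)
  assume no: "\<not> ?thesis"
  have c0: "coeff (pol m x) 1 = 0" if "m \<in> weights" for m x
    unfolding coeff_pol by (rule sum.neutral) (use no that in auto)
  have "weight_fun m (\<alpha> 1 x) = weight_fun m x" if m: "m \<in> weights" and x: "x \<in> pts X" for m x
  proof -
    have "pderiv (pol m x) = 0"
      by (rule poly_ext) (simp add: poly_pderiv_pol[OF m x] c0[OF m] del: One_nat_def)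
    then have "degree (pol m x) = 0" by (simp add: pderiv_eq_0_iff)
    then obtain k where "pol m x = [:k:]" by (rule degree_eq_zeroE)
    then have "poly (pol m x) 1 = poly (pol m x) 0" by simp
    then show ?thesis using poly_pol[OF m x] \<alpha>_zero[OF x] by simp
  qed
  then have "\<alpha> 1 x = \<alpha> 0 x" if "x \<in> pts X" for x
    using chi_separates[OF \<alpha>_in[OF that] that] \<alpha>_zero[OF that] that by simp
  then have "\<alpha> 1 = \<alpha> 0" using Aut_eqI[OF \<alpha>_Aut \<alpha>_Aut] by blast
  then show False using \<alpha>_inj by fastforce
qed

text \<open>One term of first order fixes \<open>e\<close>: there \<open>twist_power\<close> shows
  that \<open>twist t 1\<close> is the inverse of the character of \<open>e\<close>. For every other
  term the same identity with \<open>c = 1\<close> forces the weight \<open>m + j e\<close> at the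
  power \<open>j\<close>.\<close>

lemma degree_vector:
  "\<exists>e\<in>M. (\<forall>m\<in>weights. \<forall>p\<in>P m. a m p \<noteq> 0 \<longrightarrow> snd p = plus_mult m e (fst p)) \<and>
     (\<exists>m\<in>weights. \<exists>p\<in>P m. fst p = 1 \<and> a m p \<noteq> 0)"
proof -
  obtain m0 p0 where m0: "m0 \<in> weights" "p0 \<in> P m0" "fst p0 = 1" "a m0 p0 \<noteq> 0"
    using nontrivial by blast
  define e where "e = snd p0 - m0"
  have p0: "snd p0 \<in> weights" using expo(2)[OF m0(1)] m0(2) by blast
  have eM: "e \<in> M" unfolding e_def by (rule M_I[OF p0 m0(1)])
  have en: "e \<in> exponents n"
    using p0 m0(1) by (simp add: e_def weights_def exponents_diff)
  have tw: "torus_char n m0 t = twist t 1 * torus_char n (snd p0) t" if t: "t \<in> T" for t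
    using twist_power[OF expo[OF m0(1)] m0(1,2,4) t, where c = 1] m0(3) by simp
  have tw: "twist t 1 * torus_char n e t = 1" if t: "t \<in> T" for t
  proof -
    have "torus_char n (snd p0) t = torus_char n m0 t * torus_char n e t"
      using torus_char_add[OF t, of m0 e] by (simp add: e_def)
    then show ?thesis using tw[OF t] torus_char_nz[OF t, of m0] by simp
  qed
  have char_pm: "torus_char n (plus_mult m e j) t = torus_char n m t * torus_char n e t ^ j"
    if "t \<in> T" for m j t
    by (induction j) (simp_all add: torus_char_add[OF that] del: plus_fun_apply)
  have ex_pm: "plus_mult m e j \<in> exponents n" if "m \<in> weights" for m j
  proof (induction j)
    case 0
    then show ?case using that by (simp add: weights_def)
  next
    case (Suc j)
    then show ?case unfolding plus_mult.simps by (rule exponents_add[OF _ en])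
  qed
  have "snd p = plus_mult m e (fst p)" if m: "m \<in> weights" and p: "p \<in> P m" "a m p \<noteq> 0" for m p
  proof (rule ccontr)
    assume ne: "snd p \<noteq> plus_mult m e (fst p)"
    have "snd p \<in> exponents n" using expo(2)[OF m] p(1) by (auto simp: weights_def)
    then obtain t where t: "t \<in> T" "torus_char n (snd p) t \<noteq> torus_char n (plus_mult m e (fst p)) t"
      using torus_char_distinct[OF _ ex_pm[OF m] ne] by blast
    have "torus_char n m t = twist t 1 ^ fst p * torus_char n (snd p) t"
      using twist_power[OF expo[OF m] m p t(1), where c = 1] by simp
    then have "torus_char n (plus_mult m e (fst p)) t =
        (twist t 1 * torus_char n e t) ^ fst p * torus_char n (snd p) t"
      by (simp add: char_pm[OF t(1)] power_mult_distrib)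
    then show False using tw[OF t(1)] t(2) by simp
  qed
  then show ?thesis using eM m0 by blast
qed

text \<open>Homogeneity turns the expansion on \<open>Xo\<close> into a polynomial
  \<open>p m\<close>, read off at the base point and evaluated at \<open>c * ch e x\<close>. The
  group law and multiplicativity of the weight functions give the hypotheses of
  \<open>homogeneous_exponential\<close>.\<close>

theorem root_shear:
  "\<exists>\<kappa> \<rho> e. \<kappa> \<noteq> 0 \<and> root \<rho> e \<and> (\<forall>c. shear \<rho> (\<lambda>x. (\<kappa> * c) * ch e x) (\<alpha> c))"
proof -
  obtain e where e: "e \<in> M"
    and deg: "\<And>m p. m \<in> weights \<Longrightarrow> p \<in> P m \<Longrightarrow> a m p \<noteq> 0 \<Longrightarrow> snd p = plus_mult m e (fst p)"
    and nt: "\<exists>m\<in>weights. \<exists>p\<in>P m. fst p = 1 \<and> a m p \<noteq> 0"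
    using degree_vector by blast
  define p where "p m = pol m base_point" for m
  have formula: "weight_fun m (\<alpha> c x) = weight_fun m x * poly (p m) (c * ch e x)"
    if m: "m \<in> weights" and x: "x \<in> Xo" for m c x
  proof -
    have "weight_fun m (\<alpha> c x) = (\<Sum>q\<in>P m. a m q * c ^ fst q * weight_fun (snd q) x)"
      using expo(3)[OF m Xo_pts[OF x]] .
    also have "\<dots> = (\<Sum>q\<in>P m. weight_fun m x * (a m q * weight_fun (snd q) base_point * (c * ch e x) ^ fst q))"
    proof (rule sum.cong)
      fix q assume q: "q \<in> P m"
      then have w: "snd q \<in> weights" using expo(2)[OF m] by blast
      show "a m q * c ^ fst q * weight_fun (snd q) x =
          weight_fun m x * (a m q * weight_fun (snd q) base_point * (c * ch e x) ^ fst q)"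
      proof (cases "a m q = 0")
        case False
        have "weight_fun (snd q) x = weight_fun m x * ch e x ^ fst q"
          using ch_plus_mult[OF S_M[OF m] e x, of "fst q"] deg[OF m q False] ch_S[OF w x] ch_S[OF m x]
          by simp
        then show ?thesis by (simp add: chi_base[OF w] power_mult_distrib)
      qed simp
    qed simp
    also have "\<dots> = weight_fun m x * poly (p m) (c * ch e x)"
      by (simp add: p_def pol_def poly_sum poly_monom sum_distrib_left)
    finally show ?thesis .
  qed
  \<comment> \<open>The derivation maps \<open>weight_fun m\<close> to a multiple of
    \<open>weight_fun (m + e)\<close>; if \<open>m + e\<close> is not a weight, the multiple is
    zero.\<close>
  have linear: "coeff (pol m x) 1 = coeff (p m) 1 * weight_fun (m + e) x" 
    if m: "m \<in> weights" and x: "x \<in> pts X" for m x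
  proof -
    have "coeff (pol m x) 1 = (\<Sum>q\<in>P m. (if fst q = 1 then a m q * weight_fun (snd q) base_point else 0) *
        weight_fun (m + e) x)"
      unfolding coeff_pol
    proof (rule sum.cong)
      fix q assume q: "q \<in> P m"
      then have w: "snd q \<in> weights" using expo(2)[OF m] by blast
      show "(if fst q = 1 then a m q * weight_fun (snd q) x else 0) =
          (if fst q = 1 then a m q * weight_fun (snd q) base_point else 0) * weight_fun (m + e) x"
        using deg[OF m q] chi_base[OF w] by (cases "a m q = 0") auto
    qed simp
    then show ?thesis by (simp add: p_def coeff_pol sum_distrib_right)
  qed
  have in_S: "m + e \<in> weights" if m: "m \<in> weights" and nz: "coeff (p m) 1 \<noteq> 0" for m
  proof -
    obtain q where q: "q \<in> P m" "(if fst q = 1 then a m q * weight_fun (snd q) base_point else 0) \<noteq> 0"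
      using nz unfolding p_def coeff_pol by (rule sum.not_neutral_contains_not_neutral)
    then have "fst q = 1" "a m q \<noteq> 0" by (auto split: if_splits)
    then show ?thesis using deg[OF m q(1)] expo(2)[OF m] q(1) by force
  qed
  have "\<exists>\<kappa> \<rho>. \<kappa> \<noteq> 0 \<and> root \<rho> e \<and> (\<forall>m\<in>weights. p m = [:1, \<kappa>:] ^ nat (\<rho> m))"
  proof (rule homogeneous_exponential[OF e])
    fix m assume m: "m \<in> weights"
    show "poly (p m) 0 = 1"
      by (simp add: p_def poly_pol[OF m base_in] \<alpha>_zero[OF base_in] chi_base[OF m])
    show "p (m + m') = p m * p m'" if m': "m' \<in> weights" for m'
      by (rule poly_ext)
        (simp add: p_def poly_pol base_in m m' S_add chi_add[OF m m' \<alpha>_in[OF base_in]])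
    show "pderiv (p m) = 0" if "coeff (p m) 1 = 0"
      by (rule poly_ext)
        (simp add: p_def poly_pderiv_pol[OF m base_in] linear[OF m \<alpha>_in[OF base_in]] that[unfolded p_def]
            del: One_nat_def)
    show "m + e \<in> weights \<and> pderiv (p m) = smult (coeff (p m) 1) (p (m + e))" if nz: "coeff (p m) 1 \<noteq> 0"
    proof
      show i: "m + e \<in> weights" by (rule in_S[OF m nz])
      show "pderiv (p m) = smult (coeff (p m) 1) (p (m + e))"
        by (rule poly_ext)
          (simp add: p_def poly_pderiv_pol[OF m base_in] linear[OF m \<alpha>_in[OF base_in]]
            poly_pol[OF i base_in] del: One_nat_def)
    qed
  next
    obtain m q where m: "m \<in> weights" and q: "q \<in> P m" "fst q = 1" "a m q \<noteq> 0" using nt by blast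
    have "coeff (p m) 1 \<noteq> 0"
    proof
      have sq: "snd q = m + e" using deg[OF m q(1,3)] q(2) by simp
      have w: "m + e \<in> weights" using sq expo(2)[OF m] q(1) by force
      assume "coeff (p m) 1 = 0"
      moreover have "coeff (p m) 1 = (\<Sum>q'\<in>P m. if q' = q then a m q else 0)"
        unfolding p_def coeff_pol
      proof (rule sum.cong)
        fix q' assume q': "q' \<in> P m"
        have w': "snd q' \<in> weights" using expo(2)[OF m] q' by blast
        show "(if fst q' = 1 then a m q' * weight_fun (snd q') base_point else 0) =
            (if q' = q then a m q else 0)"
        proof (cases "a m q' = 0")
          case True
          then show ?thesis using q(3) by auto
        next
          case False
          show ?thesis
          proof (cases "fst q' = 1")
            case True
            \<comment> \<open>Homogeneity makes the weights of two first-order terms equal, so no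
              other term can cancel \<open>a m q\<close>.\<close>
            then have "q' = q" using deg[OF m q' False] sq q(2) by (intro prod_eqI) simp_all
            then show ?thesis using chi_base[OF w'] q(2) by simp
          next
            case False
            then have "q' \<noteq> q" using q(2) by auto
            then show ?thesis using False by simp
          qed
        qed
      qed simp
      ultimately show False using q expo(1)[OF m] by simp
    qed
    then show "\<exists>m\<in>weights. coeff (p m) 1 \<noteq> 0" using m by blast
  qed
  then obtain \<kappa> \<rho> where \<kappa>: "\<kappa> \<noteq> 0" "root \<rho> e" "\<forall>m\<in>weights. p m = [:1, \<kappa>:] ^ nat (\<rho> m)"
    by blast
  have "shear \<rho> (\<lambda>x. (\<kappa> * c) * ch e x) (\<alpha> c)" for c
    unfolding shear_def
    using \<alpha>_Aut formula \<kappa>(3) by (simp add: poly_power mult_ac)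
  then show ?thesis using \<kappa> by blast
qed

end

theorem theorem1p1:
  fixes X :: "(nat \<Rightarrow> 'k::{alg_closed_field, field_char_0}, 'k) space"
    and n s :: nat
    and \<tau> :: "(nat \<Rightarrow> 'k) \<Rightarrow> (nat \<Rightarrow> 'k) \<Rightarrow> (nat \<Rightarrow> 'k)"
    and U :: "nat \<Rightarrow> ((nat \<Rightarrow> 'k) \<Rightarrow> (nat \<Rightarrow> 'k)) set"
    and G :: "((nat \<Rightarrow> 'k) \<Rightarrow> (nat \<Rightarrow> 'k)) set"
  assumes "affine_variety X"
    and "normal_variety X"
    and "toric_action n X \<tau>"
    and "\<not> has_torus_factor X"
    and "\<And>i. i \<in> {1..s} \<Longrightarrow> Ga_subgroup X (U i)"
    and "\<And>i. i \<in> {1..s} \<Longrightarrow> \<tau> ` carrier (torus n) \<subseteq> normalizer (Aut X) (U i)"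
    and "G = generate (Aut X) (\<Union>i \<in> {1..s}. U i)"
  shows "is_unipotent_algebraic_group X G \<or> contains_F2 (Aut X) G"
proof -
  interpret toric_variety X n \<tau> by unfold_locales (fact assms)+
  have "\<forall>i\<in>{1..s}. \<exists>d. root (fst d) (fst (snd d)) \<and> U i = range (snd (snd d)) \<and>
      (\<forall>c. shear (fst d) (\<lambda>x. c * ch (fst (snd d)) x) (snd (snd d) c))"
  proof
    fix i assume i: "i \<in> {1..s}"
    obtain \<alpha> where \<alpha>: "effective_regular_action additive_group {\<lambda>t. t} X \<alpha>" "U i = range \<alpha>"
      using assms(5)[OF i] unfolding Ga_subgroup_def by blast
    interpret Ga_action X n \<tau> \<alpha>
      by unfold_locales (use \<alpha> assms(6)[OF i] in auto)
    obtain \<kappa> \<rho> e where \<kappa>: "\<kappa> \<noteq> 0" "root \<rho> e" "\<And>c. shear \<rho> (\<lambda>x. (\<kappa> * c) * ch e x) (\<alpha> c)"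
      using root_shear by blast
    \<comment> \<open>Dividing the parameter by \<kappa> normalizes the shears without changing the
      subgroup.\<close>
    have "shear \<rho> (\<lambda>x. c * ch e x) (\<alpha> (c / \<kappa>))" for c
      using \<kappa>(3)[of "c / \<kappa>"] \<kappa>(1) by simp
    moreover have "range \<alpha> = range (\<lambda>c. \<alpha> (c / \<kappa>))"
    proof (intro equalityI subsetI)
      fix g assume "g \<in> range \<alpha>"
      then obtain c where "g = \<alpha> c" by blast
      then have "g = \<alpha> (\<kappa> * c / \<kappa>)" using \<kappa>(1) by simp
      then show "g \<in> range (\<lambda>c. \<alpha> (c / \<kappa>))" by (rule range_eqI)
    qed auto
    ultimately show "\<exists>d. root (fst d) (fst (snd d)) \<and> U i = range (snd (snd d)) \<and>
      (\<forall>c. shear (fst d) (\<lambda>x. c * ch (fst (snd d)) x) (snd (snd d) c))"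
      using \<kappa>(2) \<alpha>(2) by (intro exI[of _ "(\<rho>, e, \<lambda>c. \<alpha> (c / \<kappa>))"]) simp
  qed
  from bchoice[OF this] obtain d where d: "\<forall>i\<in>{1..s}. root (fst (d i)) (fst (snd (d i))) \<and>
      U i = range (snd (snd (d i))) \<and>
      (\<forall>c. shear (fst (d i)) (\<lambda>x. c * ch (fst (snd (d i))) x) (snd (snd (d i)) c))"
    by (elim exE) (rule that)
  define u where "u i = snd (snd (d i))" for i
  have G: "G = generate (Aut X) (\<Union>i\<in>{1..s}. range (u i))"
    using assms(7) d by (simp add: u_def)
  have u: "u i c \<in> carrier (Aut X)" if "i \<in> {1..s}" for i c
    using d that shear_Aut unfolding u_def by blast
  have sub: "subgroup G (Aut X)"
    unfolding G by (rule group.generate_is_subgroup[OF group_Aut]) (use u in auto)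
  show ?thesis
  proof (cases "\<exists>\<rho>1 e1 \<rho>2 e2. has_root G \<rho>1 e1 \<and> has_root G \<rho>2 e2 \<and> 0 < \<rho>2 e1 \<and> 0 < \<rho>1 e2")
    case True
    then show ?thesis using contains_free_group[OF sub] by blast
  next
    case False
    obtain F0 where F0: "finite F0" "F0 \<subseteq> weights"
        "\<forall>f\<in>coords X. \<exists>a. \<forall>x\<in>pts X. f x = (\<Sum>m\<in>F0. a m * weight_fun m x)"
      using coords_support by (elim exE conjE) (rule that)
    interpret root_group X weights weight_fun base_point "{1..s}" "\<lambda>i. fst (d i)"
      "\<lambda>i. fst (snd (d i))" u G F0
    proof
      show "finite {1..s}" by simp
      show "root (fst (d i)) (fst (snd (d i)))" if "i \<in> {1..s}" for i using d that by blast
      show "shear (fst (d i)) (\<lambda>x. c * ch (fst (snd (d i))) x) (u i c)" if "i \<in> {1..s}" for i c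
        using d that unfolding u_def by blast
      show "G = generate (Aut X) (\<Union>i\<in>{1..s}. range (u i))" by (rule G)
      show "finite F0" "F0 \<subseteq> weights" by (rule F0)+
      show "\<exists>a. \<forall>x\<in>pts X. f x = (\<Sum>m\<in>F0. a m * weight_fun m x)" if "f \<in> coords X" for f
        using F0(3) that by (rule bspec)
      show "x = y" if "x \<in> pts X" "y \<in> pts X" "\<And>f. f \<in> coords X \<Longrightarrow> f x = f y" for x y
        using that by (rule coords_separate)
      show "\<not> (0 < \<rho>2 e1 \<and> 0 < \<rho>1 e2)" if "has_root G \<rho>1 e1" "has_root G \<rho>2 e2" for \<rho>1 e1 \<rho>2 e2
        using False that by blast
    qed
    show ?thesis using unipotent_algebraic_group by blast
  qed
qed

end
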